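(* Let $(\mathcal{H},\Lambda)$ be a Hopf Galois order setting over a field $\Bbbk$ and let $\mathfrak{m}$ be a maximal ideal of $\Lambda$ of finite codimension. Assume that the stabilizer $\mathrm{Stab}(\mathcal{H},\mathfrak{m})$ is finite-dimensional. Then for every $\mathcal{H}$-Galois $\Lambda$-order $F$: (i) $\mathrm{Irr}(F,\mathfrak{m})$ is finite; (ii) $V^{\mathfrak{m}}$ is finite-dimensional for every $[V]\in\mathrm{Irr}(F,\mathfrak{m})$. The same holds with $F$ replaced by $F^{\mathrm{op}}$.
   Context: Let $\Bbbk$ be an arbitrary field; all algebras are over $\Bbbk$ and $\otimes=\otimes_{\Bbbk}$. A Hopf Galois order setting (or setting) is a pair $(\mathcal{H},\Lambda)$ where $\mathcal{H}$ is a left coideal subalgebra (a subalgebra with $\Delta(\mathcal{H})\subset\tilde{\mathcal{H}}\otimes\mathcal{H}$) of a Hopf algebra $\tilde{\mathcal{H}}$ (which is part of the data) with comultiplication $\Delta(x)=x_{(1)}\otimes x_{(2)}$, counit $\varepsilon$ and invertible antipode $S$, and $\Lambda$ is a left $\tilde{\mathcal{H}}$-module algebra (action denoted $x\triangleright a$) such that (i) $\Lambda$ is a noetherian (commutative) integral domain; (ii) the action of $\tilde{\mathcal{H}}$ on $\Lambda$ extends to an action on the field of fractions $L=\mathrm{Frac}(\Lambda)$ (also denoted $\triangleright$); (iii) $\Lambda$ is faithful as a left module over the smash product $\Lambda\#\mathcal{H}$. The smash product $A\#\mathcal{H}$ (for $A=\Lambda$ or $L$) is the algebra containing $A$ and $\mathcal{H}$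 as subalgebras such that $A\otimes\mathcal{H}\to A\#\mathcal{H}$, $a\otimes x\mapsto ax$, is a vector space isomorphism and $xa=(x_{(1)}\triangleright a)x_{(2)}$ for $x\in\mathcal{H}$, $a\in A$. For $X\in L\#\tilde{\mathcal{H}}$, $\hat X$ denotes the corresponding linear endomorphism of $L$, determined by $\hat f(g)=fg$ for $f,g\in L$ and $\hat x(f)=x\triangleright f$ for $x\in\tilde{\mathcal{H}}$. An $\mathcal{H}$-Galois $\Lambda$-order is a subalgebra $F\subset L\#\mathcal{H}$ such that $\Lambda\subset F$, $LF=L\#\mathcal{H}$, and $\hat X(\Lambda)\subset\Lambda$ for all $X\in F$. For an algebra $A\in\{F,F^{\mathrm{op}}\}$ (both containing the commutative algebra $\Lambda$), a left $A$-module $V$ and a maximal ideal $\mathfrak{m}$ of $\Lambda$, put $V^{\mathfrak{m}}=\{v\in V\mid \mathfrak{m}^Nv=0 \text{ for } N\gg 0\}$. $V$ is a Harish-Chandra module (with respect to $\Lambda$) if $V=\bigoplus V^{\mathfrak{m}}$, the sum being over all maximal ideals $\mathfrak{m}$ of $\Lambda$ of finite codimension. $\mathrm{Irr}(A,\mathfrak{m})$ is the set of isomorphism classes of simple Harish-Chandra $A$-modules $V$ with $V^{\mathfrak{m}}\neq 0$. Stabilizer. Let $\mathfrak{m}$ be a maximal ideal of $\Lambda$. For a subcoalgebra $\mathcal{C}$ of $\tilde{\mathcal{H}}$, an element $R=\sum_i r_i\otimes s_i\in\Lambda\otimes\Lambda$ is a reductor for $\mathcal{C}$ mod $\mathfrak{m}$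 if (R1) the image of $R$ in $\Lambda\otimes\Lambda/(\Lambda\otimes\mathfrak{m}+\mathfrak{m}\otimes\Lambda)$ is invertible, and (R2) $\sum_i r_i\cdot(x\triangleright s_i)=0$ for all $x\in\mathcal{C}$. $\mathcal{C}$ is superfluous mod $\mathfrak{m}$ if for every finite-dimensional subcoalgebra $\mathcal{C}'$ of $\mathcal{C}$ there exists a reductor for $\mathcal{C}'$ mod $\mathfrak{m}$. $\mathcal{S}(\tilde{\mathcal{H}},\mathfrak{m})$ is the sum of all subcoalgebras of $\tilde{\mathcal{H}}$ that are superfluous mod $\mathfrak{m}$. For a left coideal $\mathcal{C}\subset\tilde{\mathcal{H}}$, $\mathcal{S}(\mathcal{C},\mathfrak{m})=\{x\in\mathcal{C}\mid\Delta(x)\in\mathcal{S}(\tilde{\mathcal{H}},\mathfrak{m})\otimes\mathcal{C}\}$. Finally $\mathrm{Stab}(\mathcal{H},\mathfrak{m})=\mathcal{H}/\mathcal{S}(\mathcal{H},\mathfrak{m})$. *)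

theory Defs
  imports "HOL-Computational_Algebra.Computational_Algebra"
begin

section \<open>Linear algebra and commutative algebra\<close>

text \<open>
  Throughout, a vector space (or algebra) over a field is a type together with a scalar
  multiplication, as in \<^locale>\<open>vector_space\<close>.
\<close>

definition finite_dim :: "('k::field \<Rightarrow> 'v::ab_group_add \<Rightarrow> 'v) \<Rightarrow> 'v set \<Rightarrow> bool" where
  "finite_dim s W \<longleftrightarrow> (\<exists>B. finite B \<and> W = module.span s B)"

text \<open>The quotient \<open>V / W\<close> is finite-dimensional: it is spanned by the classes of finitely many
  elements of \<open>V\<close>.\<close>

definition finite_dim_quotient ::
    "('k::field \<Rightarrow> 'v::ab_group_add \<Rightarrow> 'v) \<Rightarrow> 'v set \<Rightarrow> 'v set \<Rightarrow> bool" where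
  "finite_dim_quotient s V W \<longleftrightarrow>
     (\<exists>B\<subseteq>V. finite B \<and> (\<forall>v\<in>V. \<exists>u\<in>module.span s B. v - u \<in> W))"

text \<open>Ideals of a commutative ring are its submodules as a module over itself.\<close>

abbreviation ring_ideal :: "'a::comm_ring_1 set \<Rightarrow> bool" where
  "ring_ideal \<equiv> module.subspace (*)"

abbreviation ideal_generated :: "'a::comm_ring_1 set \<Rightarrow> 'a set" where
  "ideal_generated \<equiv> module.span (*)"

definition noetherian :: "'a::comm_ring_1 itself \<Rightarrow> bool" where
  "noetherian T \<longleftrightarrow>
     (\<forall>I::'a set. ring_ideal I \<longrightarrow> (\<exists>B. finite B \<and> I = ideal_generated B))"

definition maximal_ideal :: "'a::comm_ring_1 set \<Rightarrow> bool" where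
  "maximal_ideal m \<longleftrightarrow> ring_ideal m \<and> m \<noteq> UNIV \<and>
     (\<forall>J. ring_ideal J \<and> m \<subseteq> J \<longrightarrow> J = m \<or> J = UNIV)"

fun ideal_power :: "'a::comm_ring_1 set \<Rightarrow> nat \<Rightarrow> 'a set" where
  "ideal_power m 0 = UNIV"
| "ideal_power m (Suc n) = ideal_generated {a * b | a b. a \<in> ideal_power m n \<and> b \<in> m}"

locale algebra_over_field = vector_space s
  for s :: "'k::field \<Rightarrow> 'a::ring_1 \<Rightarrow> 'a" +
  assumes scale_mult_left: "s c x * y = s c (x * y)"
    and scale_mult_right: "x * s c y = s c (x * y)"

definition subalgebra :: "('k::field \<Rightarrow> 'a::ring_1 \<Rightarrow> 'a) \<Rightarrow> 'a set \<Rightarrow> bool" where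
  "subalgebra s A \<longleftrightarrow>
     module.subspace s A \<and> 1 \<in> A \<and> (\<forall>x\<in>A. \<forall>y\<in>A. x * y \<in> A)"

definition algebra_hom ::
    "('k::field \<Rightarrow> 'a::ring_1 \<Rightarrow> 'a) \<Rightarrow> ('k \<Rightarrow> 'b::ring_1 \<Rightarrow> 'b) \<Rightarrow> ('a \<Rightarrow> 'b) \<Rightarrow> bool" where
  "algebra_hom s1 s2 f \<longleftrightarrow>
     Vector_Spaces.linear s1 s2 f \<and> f 1 = 1 \<and> (\<forall>x y. f (x * y) = f x * f y)"

definition fract_scale :: "('k::field \<Rightarrow> 'l::idom \<Rightarrow> 'l) \<Rightarrow> 'k \<Rightarrow> 'l fract \<Rightarrow> 'l fract" where
  "fract_scale s c q = to_fract (s c 1) * q"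


section \<open>Tensor products\<close>

text \<open>
  A list \<open>[(a\<^sub>1, b\<^sub>1), \<dots>, (a\<^sub>n, b\<^sub>n)]\<close> stands for the tensor
  \<open>a\<^sub>1 \<otimes> b\<^sub>1 + \<dots> + a\<^sub>n \<otimes> b\<^sub>n\<close>. The relation below is equality of tensors: it is the
  least congruence on formal sums of pairs that makes \<open>(a, b) \<mapsto> a \<otimes> b\<close> bilinear, so its
  classes form the tensor product (additive inverses exist because \<open>(- a) \<otimes> b\<close> cancels
  \<open>a \<otimes> b\<close>). \<open>tensor3_eq\<close> does the same for threefold tensors.
\<close>

inductive tensor_eq ::
    "('k::field \<Rightarrow> 'a::ab_group_add \<Rightarrow> 'a) \<Rightarrow> ('k \<Rightarrow> 'b::ab_group_add \<Rightarrow> 'b) \<Rightarrow>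
     ('a \<times> 'b) list \<Rightarrow> ('a \<times> 'b) list \<Rightarrow> bool"
  for s1 s2 where
  refl: "tensor_eq s1 s2 xs xs"
| sym: "tensor_eq s1 s2 xs ys \<Longrightarrow> tensor_eq s1 s2 ys xs"
| trans: "tensor_eq s1 s2 xs ys \<Longrightarrow> tensor_eq s1 s2 ys zs \<Longrightarrow> tensor_eq s1 s2 xs zs"
| append: "tensor_eq s1 s2 xs xs' \<Longrightarrow> tensor_eq s1 s2 ys ys' \<Longrightarrow>
     tensor_eq s1 s2 (xs @ ys) (xs' @ ys')"
| commute: "tensor_eq s1 s2 (xs @ ys) (ys @ xs)"
| zero: "tensor_eq s1 s2 [(0, b)] []"
| add_left: "tensor_eq s1 s2 [(a + a', b)] [(a, b), (a', b)]"
| add_right: "tensor_eq s1 s2 [(a, b + b')] [(a, b), (a, b')]"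
| balanced: "tensor_eq s1 s2 [(s1 c a, b)] [(a, s2 c b)]"

inductive tensor3_eq ::
    "('k::field \<Rightarrow> 'a::ab_group_add \<Rightarrow> 'a) \<Rightarrow>
     ('a \<times> 'a \<times> 'a) list \<Rightarrow> ('a \<times> 'a \<times> 'a) list \<Rightarrow> bool"
  for s where
  refl: "tensor3_eq s xs xs"
| sym: "tensor3_eq s xs ys \<Longrightarrow> tensor3_eq s ys xs"
| trans: "tensor3_eq s xs ys \<Longrightarrow> tensor3_eq s ys zs \<Longrightarrow> tensor3_eq s xs zs"
| append: "tensor3_eq s xs xs' \<Longrightarrow> tensor3_eq s ys ys' \<Longrightarrow> tensor3_eq s (xs @ ys) (xs' @ ys')"
| commute: "tensor3_eq s (xs @ ys) (ys @ xs)"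
| zero: "tensor3_eq s [(0, b, c)] []"
| add1: "tensor3_eq s [(a + a', b, c)] [(a, b, c), (a', b, c)]"
| add2: "tensor3_eq s [(a, b + b', c)] [(a, b, c), (a, b', c)]"
| add3: "tensor3_eq s [(a, b, c + c')] [(a, b, c), (a, b, c')]"
| balanced12: "tensor3_eq s [(s r a, b, c)] [(a, s r b, c)]"
| balanced23: "tensor3_eq s [(a, s r b, c)] [(a, b, s r c)]"

definition tensor_mult ::
    "('a::ring_1 \<times> 'b::ring_1) list \<Rightarrow> ('a \<times> 'b) list \<Rightarrow> ('a \<times> 'b) list" where
  "tensor_mult xs ys = [(a * c, b * d). (a, b) \<leftarrow> xs, (c, d) \<leftarrow> ys]"

text \<open>Membership of a tensor in the subspace \<open>U \<otimes> W\<close>, for subspaces \<open>U\<close> and \<open>W\<close> of the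
  two factors.\<close>

definition in_tensor ::
    "('k::field \<Rightarrow> 'a::ab_group_add \<Rightarrow> 'a) \<Rightarrow> ('k \<Rightarrow> 'b::ab_group_add \<Rightarrow> 'b) \<Rightarrow>
     'a set \<Rightarrow> 'b set \<Rightarrow> ('a \<times> 'b) list \<Rightarrow> bool" where
  "in_tensor s1 s2 U W xs \<longleftrightarrow> (\<exists>ys. set ys \<subseteq> U \<times> W \<and> tensor_eq s1 s2 xs ys)"


section \<open>Hopf algebras and module algebras\<close>

text \<open>
  The comultiplication is given by a representative \<open>\<Delta> x\<close> of the tensor
  \<open>x\<^sub>(\<^sub>1\<^sub>) \<otimes> x\<^sub>(\<^sub>2\<^sub>)\<close>, so that sums over the list \<open>\<Delta> x\<close> are Sweedler sums. Only the tensor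
  is constrained, not the choice of the representative.
\<close>

locale hopf_algebra = algebra_over_field sH
  for sH :: "'k::field \<Rightarrow> 'h::ring_1 \<Rightarrow> 'h" +
  fixes \<Delta> :: "'h \<Rightarrow> ('h \<times> 'h) list"
    and \<epsilon> :: "'h \<Rightarrow> 'k"
    and S :: "'h \<Rightarrow> 'h"
  assumes comult_add: "tensor_eq sH sH (\<Delta> (x + y)) (\<Delta> x @ \<Delta> y)"
    and comult_scale: "tensor_eq sH sH (\<Delta> (sH c x)) [(sH c a, b). (a, b) \<leftarrow> \<Delta> x]"
    and comult_one: "tensor_eq sH sH (\<Delta> 1) [(1, 1)]"
    and comult_mult: "tensor_eq sH sH (\<Delta> (x * y)) (tensor_mult (\<Delta> x) (\<Delta> y))"
    and coassoc: "tensor3_eq sH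
          [(a1, a2, b). (a, b) \<leftarrow> \<Delta> x, (a1, a2) \<leftarrow> \<Delta> a]
          [(a, b1, b2). (a, b) \<leftarrow> \<Delta> x, (b1, b2) \<leftarrow> \<Delta> b]"
    and counit_hom: "algebra_hom sH (*) \<epsilon>"
    and counit_left: "(\<Sum>(a, b)\<leftarrow>\<Delta> x. sH (\<epsilon> a) b) = x"
    and counit_right: "(\<Sum>(a, b)\<leftarrow>\<Delta> x. sH (\<epsilon> b) a) = x"
    and antipode_linear: "Vector_Spaces.linear sH sH S"
    and antipode_left: "(\<Sum>(a, b)\<leftarrow>\<Delta> x. S a * b) = sH (\<epsilon> x) 1"
    and antipode_right: "(\<Sum>(a, b)\<leftarrow>\<Delta> x. a * S b) = sH (\<epsilon> x) 1"
    and antipode_bij: "bij S"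

definition subcoalgebra ::
    "('k::field \<Rightarrow> 'h::ring_1 \<Rightarrow> 'h) \<Rightarrow> ('h \<Rightarrow> ('h \<times> 'h) list) \<Rightarrow> 'h set \<Rightarrow> bool" where
  "subcoalgebra sH \<Delta> C \<longleftrightarrow>
     module.subspace sH C \<and> (\<forall>x\<in>C. in_tensor sH sH C C (\<Delta> x))"

definition left_coideal ::
    "('k::field \<Rightarrow> 'h::ring_1 \<Rightarrow> 'h) \<Rightarrow> ('h \<Rightarrow> ('h \<times> 'h) list) \<Rightarrow> 'h set \<Rightarrow> bool" where
  "left_coideal sH \<Delta> C \<longleftrightarrow>
     module.subspace sH C \<and> (\<forall>x\<in>C. in_tensor sH sH UNIV C (\<Delta> x))"

locale module_algebra =
  hopf_algebra sH \<Delta> \<epsilon> S + A: algebra_over_field sA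
  for sH :: "'k::field \<Rightarrow> 'h::ring_1 \<Rightarrow> 'h" and \<Delta> \<epsilon> S
    and sA :: "'k \<Rightarrow> 'a::ring_1 \<Rightarrow> 'a" +
  fixes act :: "'h \<Rightarrow> 'a \<Rightarrow> 'a"  (infixr \<open>\<triangleright>\<close> 75)
  assumes act_linear: "Vector_Spaces.linear sA sA (\<lambda>a. x \<triangleright> a)"
    and linear_act: "Vector_Spaces.linear sH sA (\<lambda>x. x \<triangleright> a)"
    and one_act: "1 \<triangleright> a = a"
    and mult_act: "(x * y) \<triangleright> a = x \<triangleright> y \<triangleright> a"
    and act_one: "x \<triangleright> 1 = sA (\<epsilon> x) 1"
    and act_mult: "x \<triangleright> (a * b) = (\<Sum>(x1, x2)\<leftarrow>\<Delta> x. (x1 \<triangleright> a) * (x2 \<triangleright> b))"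


section \<open>Hopf Galois order settings\<close>

text \<open>
  \<open>actL\<close> is the extension of the action to the fraction field. As a vector space the smash
  product of \<open>\<Lambda>\<close> and \<open>H\<close> is the tensor product, and its element \<open>a\<^sub>1x\<^sub>1 + \<dots> + a\<^sub>nx\<^sub>n\<close> sends
  \<open>b\<close> to \<open>a\<^sub>1(x\<^sub>1 \<triangleright> b) + \<dots> + a\<^sub>n(x\<^sub>n \<triangleright> b)\<close>; the last assumption says that this
  action on \<open>\<Lambda>\<close> is faithful. Since the base is a field, the tensor product of \<open>\<Lambda>\<close> and \<open>H\<close>
  embeds into that of \<open>\<Lambda>\<close> and the whole Hopf algebra, so that equality may be tested there.
\<close>

locale hopf_galois_order_setting =
  module_algebra sH \<Delta> \<epsilon> S s\<Lambda> act
  for sH :: "'k::field \<Rightarrow> 'h::ring_1 \<Rightarrow> 'h" and \<Delta> \<epsilon> S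
    and s\<Lambda> :: "'k \<Rightarrow> 'l::idom \<Rightarrow> 'l" and act +
  fixes actL :: "'h \<Rightarrow> 'l fract \<Rightarrow> 'l fract"
    and H :: "'h set"
  assumes subalgebra_H: "subalgebra sH H"
    and left_coideal_H: "left_coideal sH \<Delta> H"
    and noetherian: "noetherian TYPE('l)"
    and fract_module_algebra: "module_algebra sH \<Delta> \<epsilon> S (fract_scale s\<Lambda>) actL"
    and act_extends: "actL x (to_fract a) = to_fract (act x a)"
    and faithful: "set xs \<subseteq> UNIV \<times> H \<Longrightarrow> (\<And>b. (\<Sum>(a, x)\<leftarrow>xs. a * act x b) = 0) \<Longrightarrow>
      tensor_eq s\<Lambda> sH xs []"


section \<open>Smash products and Galois orders\<close>

text \<open>\<open>iA\<close> and \<open>iH\<close> embed the two factors. The assumptions on injectivity and surjectivity of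
  multiplication say that \<open>a \<otimes> x \<mapsto> ax\<close> is an isomorphism.\<close>

locale smash_product =
  module_algebra sH \<Delta> \<epsilon> S sA act + P: algebra_over_field sP
  for sH :: "'k::field \<Rightarrow> 'h::ring_1 \<Rightarrow> 'h" and \<Delta> \<epsilon> S
    and sA :: "'k \<Rightarrow> 'a::ring_1 \<Rightarrow> 'a" and act
    and sP :: "'k \<Rightarrow> 'p::ring_1 \<Rightarrow> 'p" +
  fixes iA :: "'a \<Rightarrow> 'p" and iH :: "'h \<Rightarrow> 'p"
  assumes hom_A: "algebra_hom sA sP iA" and inj_A: "inj iA"
    and hom_H: "algebra_hom sH sP iH" and inj_H: "inj iH"
    and mult_inj: "(\<Sum>(a, x)\<leftarrow>xs. iA a * iH x) = (\<Sum>(a, x)\<leftarrow>ys. iA a * iH x) \<Longrightarrow>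
      tensor_eq sA sH xs ys"
    and mult_surj: "\<exists>xs. X = (\<Sum>(a, x)\<leftarrow>xs. iA a * iH x)"
    and commutation: "iH x * iA a = (\<Sum>(x1, x2)\<leftarrow>\<Delta> x. iA (act x1 a) * iH x2)"

text \<open>The smash product with a left coideal subalgebra \<open>H\<close>, inside the full one.\<close>

definition smash_sub ::
    "('k::field \<Rightarrow> 'p::ring_1 \<Rightarrow> 'p) \<Rightarrow> ('a \<Rightarrow> 'p) \<Rightarrow> ('h \<Rightarrow> 'p) \<Rightarrow> 'h set \<Rightarrow> 'p set" where
  "smash_sub sP iA iH H = module.span sP {iA a * iH x | a x. x \<in> H}"

text \<open>The linear endomorphism given by \<open>X\<close>: if \<open>X = f\<^sub>1x\<^sub>1 + \<dots> + f\<^sub>nx\<^sub>n\<close> then it sends \<open>g\<close> to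
  \<open>f\<^sub>1(x\<^sub>1 \<triangleright> g) + \<dots> + f\<^sub>n(x\<^sub>n \<triangleright> g)\<close>.\<close>

definition hat :: "('h \<Rightarrow> 'a \<Rightarrow> 'a) \<Rightarrow> ('a::ring_1 \<Rightarrow> 'p::ring_1) \<Rightarrow> ('h \<Rightarrow> 'p) \<Rightarrow> 'p \<Rightarrow> 'a \<Rightarrow> 'a" where
  "hat act iA iH X g =
     (THE r. \<exists>xs. X = (\<Sum>(f, x)\<leftarrow>xs. iA f * iH x) \<and> r = (\<Sum>(f, x)\<leftarrow>xs. f * act x g))"

definition galois_order ::
    "('h \<Rightarrow> 'l::idom fract \<Rightarrow> 'l fract) \<Rightarrow> 'h set \<Rightarrow> ('k::field \<Rightarrow> 'p::ring_1 \<Rightarrow> 'p) \<Rightarrow>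
     ('l fract \<Rightarrow> 'p) \<Rightarrow> ('h \<Rightarrow> 'p) \<Rightarrow> 'p set \<Rightarrow> bool" where
  "galois_order actL H sP iL iH F \<longleftrightarrow>
     subalgebra sP F \<and> F \<subseteq> smash_sub sP iL iH H \<and>
     (\<forall>a. iL (to_fract a) \<in> F) \<and>
     module.span sP {iL f * X | f X. X \<in> F} = smash_sub sP iL iH H \<and>
     (\<forall>X\<in>F. \<forall>a. hat actL iL iH X (to_fract a) \<in> range to_fract)"


section \<open>Stabilizers\<close>

text \<open>The list \<open>Q\<close> in the second clause is an inverse of \<open>R\<close> modulo
  \<open>\<Lambda> \<otimes> m + m \<otimes> \<Lambda>\<close>.\<close>

definition reductor ::
    "('k::field \<Rightarrow> 'l::idom \<Rightarrow> 'l) \<Rightarrow> ('h \<Rightarrow> 'l \<Rightarrow> 'l) \<Rightarrow> 'l set \<Rightarrow> 'h set \<Rightarrow> ('l \<times> 'l) list \<Rightarrow> bool"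
where
  "reductor s\<Lambda> act m C R \<longleftrightarrow>
     (\<exists>Q Z. set Z \<subseteq> (UNIV \<times> m) \<union> (m \<times> UNIV) \<and>
        tensor_eq s\<Lambda> s\<Lambda> (tensor_mult R Q) ([(1, 1)] @ Z)) \<and>
     (\<forall>x\<in>C. (\<Sum>(r, s)\<leftarrow>R. r * act x s) = 0)"

definition superfluous ::
    "('k::field \<Rightarrow> 'h::ring_1 \<Rightarrow> 'h) \<Rightarrow> ('h \<Rightarrow> ('h \<times> 'h) list) \<Rightarrow>
     ('k \<Rightarrow> 'l::idom \<Rightarrow> 'l) \<Rightarrow> ('h \<Rightarrow> 'l \<Rightarrow> 'l) \<Rightarrow> 'l set \<Rightarrow> 'h set \<Rightarrow> bool" where
  "superfluous sH \<Delta> s\<Lambda> act m C \<longleftrightarrow>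
     (\<forall>C'\<subseteq>C. subcoalgebra sH \<Delta> C' \<and> finite_dim sH C' \<longrightarrow> (\<exists>R. reductor s\<Lambda> act m C' R))"

definition superfluous_sum ::
    "('k::field \<Rightarrow> 'h::ring_1 \<Rightarrow> 'h) \<Rightarrow> ('h \<Rightarrow> ('h \<times> 'h) list) \<Rightarrow>
     ('k \<Rightarrow> 'l::idom \<Rightarrow> 'l) \<Rightarrow> ('h \<Rightarrow> 'l \<Rightarrow> 'l) \<Rightarrow> 'l set \<Rightarrow> 'h set" where
  "superfluous_sum sH \<Delta> s\<Lambda> act m =
     module.span sH (\<Union>{C. subcoalgebra sH \<Delta> C \<and> superfluous sH \<Delta> s\<Lambda> act m C})"

text \<open>The subspace \<open>S(C, m)\<close> of a left coideal \<open>C\<close>; the stabilizer of \<open>H\<close> is the quotient of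
  \<open>H\<close> by it.\<close>

definition superfluous_part ::
    "('k::field \<Rightarrow> 'h::ring_1 \<Rightarrow> 'h) \<Rightarrow> ('h \<Rightarrow> ('h \<times> 'h) list) \<Rightarrow>
     ('k \<Rightarrow> 'l::idom \<Rightarrow> 'l) \<Rightarrow> ('h \<Rightarrow> 'l \<Rightarrow> 'l) \<Rightarrow> 'h set \<Rightarrow> 'l set \<Rightarrow> 'h set" where
  "superfluous_part sH \<Delta> s\<Lambda> act C m =
     {x \<in> C. in_tensor sH sH (superfluous_sum sH \<Delta> s\<Lambda> act m) C (\<Delta> x)}"

definition finite_dim_stabilizer ::
    "('k::field \<Rightarrow> 'h::ring_1 \<Rightarrow> 'h) \<Rightarrow> ('h \<Rightarrow> ('h \<times> 'h) list) \<Rightarrow>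
     ('k \<Rightarrow> 'l::idom \<Rightarrow> 'l) \<Rightarrow> ('h \<Rightarrow> 'l \<Rightarrow> 'l) \<Rightarrow> 'h set \<Rightarrow> 'l set \<Rightarrow> bool" where
  "finite_dim_stabilizer sH \<Delta> s\<Lambda> act H m \<longleftrightarrow>
     finite_dim_quotient sH H (superfluous_part sH \<Delta> s\<Lambda> act H m)"


section \<open>Harish-Chandra modules\<close>

text \<open>
  A module is a pair of a carrier \<open>V\<close>, which is a subspace of an ambient vector space
  \<open>'v\<close>, and an action on it; values of the action outside of the algebra and of \<open>V\<close> are
  irrelevant. The ambient space only serves as a universe: a module with carrier a set of elements
  of some type \<open>'w\<close> is isomorphic to one inside the space of functions from \<open>'w\<close> to
  the field. The algebra is a subset \<open>A\<close> of a ring with multiplication \<open>mul\<close>, which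
  is \<open>(*)\<close> or, for the opposite algebra, \<open>\<lambda>a b. b * a\<close>; \<open>j\<close> embeds
  \<open>\<Lambda>\<close> into \<open>A\<close>.
\<close>

type_synonym ('p, 'v) rep = "'v set \<times> ('p \<Rightarrow> 'v \<Rightarrow> 'v)"

definition left_module ::
    "('k::field \<Rightarrow> 'p::ring_1 \<Rightarrow> 'p) \<Rightarrow> 'p set \<Rightarrow> ('p \<Rightarrow> 'p \<Rightarrow> 'p) \<Rightarrow>
     ('k \<Rightarrow> 'v::ab_group_add \<Rightarrow> 'v) \<Rightarrow> ('p, 'v) rep \<Rightarrow> bool" where
  "left_module sP A mul sV M \<longleftrightarrow> (case M of (V, \<rho>) \<Rightarrow>
     module.subspace sV V \<and>
     (\<forall>a\<in>A. \<forall>v\<in>V. \<rho> a v \<in> V) \<and>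
     (\<forall>a\<in>A. \<forall>v\<in>V. \<forall>w\<in>V. \<rho> a (v + w) = \<rho> a v + \<rho> a w) \<and>
     (\<forall>a\<in>A. \<forall>b\<in>A. \<forall>v\<in>V. \<rho> (a + b) v = \<rho> a v + \<rho> b v) \<and>
     (\<forall>c. \<forall>a\<in>A. \<forall>v\<in>V. \<rho> (sP c a) v = sV c (\<rho> a v) \<and> \<rho> a (sV c v) = sV c (\<rho> a v)) \<and>
     (\<forall>a\<in>A. \<forall>b\<in>A. \<forall>v\<in>V. \<rho> (mul a b) v = \<rho> a (\<rho> b v)) \<and>
     (\<forall>v\<in>V. \<rho> 1 v = v))"

definition simple_module ::
    "('k::field \<Rightarrow> 'p::ring_1 \<Rightarrow> 'p) \<Rightarrow> 'p set \<Rightarrow> ('p \<Rightarrow> 'p \<Rightarrow> 'p) \<Rightarrow>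
     ('k \<Rightarrow> 'v::ab_group_add \<Rightarrow> 'v) \<Rightarrow> ('p, 'v) rep \<Rightarrow> bool" where
  "simple_module sP A mul sV M \<longleftrightarrow> left_module sP A mul sV M \<and> fst M \<noteq> {0} \<and>
     (\<forall>W\<subseteq>fst M. left_module sP A mul sV (W, snd M) \<longrightarrow> W = {0} \<or> W = fst M)"

definition module_iso :: "'p set \<Rightarrow> ('p, 'v::ab_group_add) rep \<Rightarrow> ('p, 'v) rep \<Rightarrow> bool" where
  "module_iso A M M' \<longleftrightarrow> (\<exists>\<phi>. bij_betw \<phi> (fst M) (fst M') \<and>
     (\<forall>v\<in>fst M. \<forall>w\<in>fst M. \<phi> (v + w) = \<phi> v + \<phi> w) \<and>
     (\<forall>a\<in>A. \<forall>v\<in>fst M. \<phi> (snd M a v) = snd M' a (\<phi> v)))"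

definition weight_space ::
    "('l::comm_ring_1 \<Rightarrow> 'p) \<Rightarrow> ('p, 'v::ab_group_add) rep \<Rightarrow> 'l set \<Rightarrow> 'v set" where
  "weight_space j M m =
     {v \<in> fst M. \<exists>N. \<forall>n\<ge>N. \<forall>a\<in>ideal_power m n. snd M (j a) v = 0}"

definition cofinite_maximal_ideals :: "('k::field \<Rightarrow> 'l::comm_ring_1 \<Rightarrow> 'l) \<Rightarrow> 'l set set" where
  "cofinite_maximal_ideals s\<Lambda> = {n. maximal_ideal n \<and> finite_dim_quotient s\<Lambda> UNIV n}"

text \<open>The two clauses say that the carrier is the direct sum of the generalized weight spaces.\<close>

definition harish_chandra ::
    "('k::field \<Rightarrow> 'l::comm_ring_1 \<Rightarrow> 'l) \<Rightarrow> ('l \<Rightarrow> 'p) \<Rightarrow>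
     ('k \<Rightarrow> 'v::ab_group_add \<Rightarrow> 'v) \<Rightarrow> ('p, 'v) rep \<Rightarrow> bool" where
  "harish_chandra s\<Lambda> j sV M \<longleftrightarrow>
     fst M = module.span sV (\<Union>n\<in>cofinite_maximal_ideals s\<Lambda>. weight_space j M n) \<and>
     (\<forall>I w. finite I \<and> I \<subseteq> cofinite_maximal_ideals s\<Lambda> \<and>
        (\<forall>n\<in>I. w n \<in> weight_space j M n) \<and> (\<Sum>n\<in>I. w n) = 0 \<longrightarrow> (\<forall>n\<in>I. w n = 0))"

definition simple_hc_modules ::
    "('k::field \<Rightarrow> 'l::comm_ring_1 \<Rightarrow> 'l) \<Rightarrow> ('l \<Rightarrow> 'p) \<Rightarrow>
     ('k \<Rightarrow> 'p::ring_1 \<Rightarrow> 'p) \<Rightarrow> 'p set \<Rightarrow> ('p \<Rightarrow> 'p \<Rightarrow> 'p) \<Rightarrow>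
     ('k \<Rightarrow> 'v::ab_group_add \<Rightarrow> 'v) \<Rightarrow> 'l set \<Rightarrow> ('p, 'v) rep set" where
  "simple_hc_modules s\<Lambda> j sP A mul sV m =
     {M. simple_module sP A mul sV M \<and> harish_chandra s\<Lambda> j sV M \<and> weight_space j M m \<noteq> {0}}"

definition Irr ::
    "('k::field \<Rightarrow> 'l::comm_ring_1 \<Rightarrow> 'l) \<Rightarrow> ('l \<Rightarrow> 'p) \<Rightarrow>
     ('k \<Rightarrow> 'p::ring_1 \<Rightarrow> 'p) \<Rightarrow> 'p set \<Rightarrow> ('p \<Rightarrow> 'p \<Rightarrow> 'p) \<Rightarrow>
     ('k \<Rightarrow> 'v::ab_group_add \<Rightarrow> 'v) \<Rightarrow> 'l set \<Rightarrow> ('p, 'v) rep set set" where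
  "Irr s\<Lambda> j sP A mul sV m =
     (let X = simple_hc_modules s\<Lambda> j sP A mul sV m
      in X // {(M, M'). M \<in> X \<and> M' \<in> X \<and> module_iso A M M'})"

end

theory Submission
  imports Defs
begin

text \<open>
  Write \<open>R \<cdot> X = \<Sum> r\<^sub>i X s\<^sub>i\<close> for the action of \<open>R = \<Sum> r\<^sub>i \<otimes> s\<^sub>i\<close> on the \<open>\<Lambda>\<close>-bimodule
  \<open>F\<close>. A reductor annihilates the part of \<open>X\<close> supported on superfluous elements, so, the stabilizer
  being finite-dimensional, there is a fixed finite subset \<open>E\<close> of \<open>H\<close> such that every
  \<open>X \<in> F\<close> has a multiple \<open>R \<cdot> X\<close> in \<open>F\<^sub>E = F \<inter> LE\<close>, with \<open>R\<close> invertible modulo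
  \<open>\<Lambda> \<otimes> m + m \<otimes> \<Lambda>\<close>. Faithfulness embeds \<open>F\<^sub>E\<close> into a power of the noetherian ring \<open>\<Lambda>\<close> (evaluate
  at finitely many points), so \<open>F\<^sub>E\<close> is finitely generated as a left \<open>\<Lambda>\<close>-module.

  Let \<open>p\<close> be the projection of a simple Harish-Chandra module onto its component at \<open>m\<close> and
  \<open>v\<close> a vector there with \<open>mv = 0\<close>. On \<open>X \<mapsto> p(Xv)\<close> a high power of
  \<open>\<Lambda> \<otimes> m + m \<otimes> \<Lambda>\<close> vanishes, so a Neumann series inverts \<open>R\<close> and \<open>p(Fv) = p(F\<^sub>E v)\<close>, which
  is finite-dimensional. For pairwise non-isomorphic simple modules the density theorem and Nakayama's lemma
  turn the same computation into linearly independent elements of \<open>F\<^sub>E / mF\<^sub>E\<close>, whose dimension is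
  finite and does not depend on the modules.
\<close>

section \<open>Tensors as lists\<close>

text \<open>Neither \<open>R\<close> nor \<open>E\<close> behaves as well as one would like.
  Reductors are granted only to finite-dimensional subcoalgebras, so \<open>R\<close> has to depend
  on \<open>X\<close>, and the local finiteness of coalgebras is what produces one around a given
  element. The space \<open>LE\<close> need not be closed under right multiplication by \<Lambda>,
  although the Neumann series applies further elements of \<Lambda> \<otimes> \<Lambda> to
  \<open>R \<cdot> X\<close>; therefore the reduction is proved for every multiple of
  \<open>R \<cdot> X\<close> at once.

  The opposite algebra exchanges the two sides on which \<Lambda> acts. The ideal \<Lambda>
  \<otimes> m + m \<otimes> \<Lambda> is symmetric, so the vanishing argument is the same. Left
  generators of \<open>F\<^sub>E\<close> still suffice: in the opposite case their coefficients act
  first, on \<open>v\<close>, whose orbit under \<Lambda> is finite-dimensional, and coefficients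
  from \<open>m\<close> give zero.

  The number of classes is bounded by the number of generators of \<open>F\<^sub>E\<close> times the
  size of a finite set spanning \<Lambda> modulo \<open>m\<close>. Nakayama's lemma supplies, in
  each component at \<open>m\<close>, a vector that survives when coefficients are reduced modulo
  \<open>m\<close>.\<close>

lemma tensor_eq_sum:
  fixes \<beta> :: "'a::ab_group_add \<Rightarrow> 'b::ab_group_add \<Rightarrow> 'c::ab_group_add"
  assumes "tensor_eq s1 s2 xs ys"
    and add_l: "\<And>a a' b. \<beta> (a + a') b = \<beta> a b + \<beta> a' b"
    and add_r: "\<And>a b b'. \<beta> a (b + b') = \<beta> a b + \<beta> a b'"
    and bal: "\<And>c a b. \<beta> (s1 c a) b = \<beta> a (s2 c b)"
  shows "(\<Sum>(a, b)\<leftarrow>xs. \<beta> a b) = (\<Sum>(a, b)\<leftarrow>ys. \<beta> a b)"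
proof -
  have z: "\<beta> 0 b = 0" for b
    using add_l[of 0 0 b] by simp
  show ?thesis
    using assms(1) by induction (auto simp: add_l add_r bal z)
qed

text \<open>As for twofold tensors, this is the universal property: each generator of the relation
  is respected by a balanced additive map. The target is just an abelian group, so the same lemma
  serves maps into \<Lambda>, \<open>L\<close> and the smash product.\<close>

lemma tensor3_eq_sum:
  fixes \<beta> :: "'a::ab_group_add \<Rightarrow> 'a \<Rightarrow> 'a \<Rightarrow> 'c::ab_group_add"
  assumes "tensor3_eq s xs ys"
    and add_1: "\<And>a a' b c. \<beta> (a + a') b c = \<beta> a b c + \<beta> a' b c"
    and add_2: "\<And>a b b' c. \<beta> a (b + b') c = \<beta> a b c + \<beta> a b' c"
    and add_3: "\<And>a b c c'. \<beta> a b (c + c') = \<beta> a b c + \<beta> a b c'"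
    and bal12: "\<And>r a b c. \<beta> (s r a) b c = \<beta> a (s r b) c"
    and bal23: "\<And>r a b c. \<beta> a (s r b) c = \<beta> a b (s r c)"
  shows "(\<Sum>(a, b, c)\<leftarrow>xs. \<beta> a b c) = (\<Sum>(a, b, c)\<leftarrow>ys. \<beta> a b c)"
proof -
  have z: "\<beta> 0 b c = 0" for b c
    using add_1[of 0 0 b c] by simp
  show ?thesis
    using assms(1) by induction (auto simp: add_1 add_2 add_3 bal12 bal23[symmetric] z)
qed

lemma sum_list_concat_map:
  "(\<Sum>y\<leftarrow>concat (map f xs). g y) = (\<Sum>x\<leftarrow>xs. \<Sum>y\<leftarrow>f x. (g y :: 'b::comm_monoid_add))"
  by (induction xs) auto

lemma vector_space_field: "vector_space ((*) :: 'k::field \<Rightarrow> 'k \<Rightarrow> 'k)"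
  by unfold_locales (simp_all add: distrib_left distrib_right)

context
  fixes s1 :: "'k::field \<Rightarrow> 'a::ab_group_add \<Rightarrow> 'a" and s2 :: "'k \<Rightarrow> 'b::ab_group_add \<Rightarrow> 'b"
  assumes vs1: "vector_space s1" and vs2: "vector_space s2"
begin

interpretation V1: vector_space s1 by (rule vs1)
interpretation V2: vector_space s2 by (rule vs2)

lemma tensor_eq_zero_right: "tensor_eq s1 s2 [(a, 0)] []"
proof -
  have "tensor_eq s1 s2 [(a, 0)] [(0, 0)]"
    using tensor_eq.sym[OF tensor_eq.balanced[of s1 s2 0 a 0]] by simp
  then show ?thesis
    using tensor_eq.zero by (rule tensor_eq.trans)
qed

lemma tensor_eq_sum_left:
  "tensor_eq s1 s2 [(\<Sum>e\<leftarrow>es. f e, b)] (map (\<lambda>e. (f e, b)) es)"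
proof (induction es)
  case Nil
  show ?case by (simp add: tensor_eq.zero)
next
  case (Cons e es)
  show ?case
    using tensor_eq.append[OF tensor_eq.refl[of s1 s2 "[(f e, b)]"] Cons.IH]
      tensor_eq.trans[OF tensor_eq.add_left[of s1 s2 "f e" "\<Sum>e\<leftarrow>es. f e" b]]
    by simp
qed

lemma tensor_eq_map:
  assumes "\<And>e. e \<in> set es \<Longrightarrow> tensor_eq s1 s2 [f e] [g e]"
  shows "tensor_eq s1 s2 (map f es) (map g es)"
  using assms
proof (induction es)
  case Nil
  show ?case by (simp add: tensor_eq.refl)
next
  case (Cons e es)
  have "tensor_eq s1 s2 ([f e] @ map f es) ([g e] @ map g es)"
    using Cons by (intro tensor_eq.append) auto
  then show ?case by simp
qed

lemma tensor_eq_merge: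
  "tensor_eq s1 s2 (map (\<lambda>e. (e, g e)) es @ map (\<lambda>e. (e, h e)) es) (map (\<lambda>e. (e, g e + h e)) es)"
proof (induction es)
  case Nil
  show ?case by (simp add: tensor_eq.refl)
next
  case (Cons e es)
  let ?G = "map (\<lambda>e. (e, g e)) es" and ?H = "map (\<lambda>e. (e, h e)) es"
  have "tensor_eq s1 s2 ([(e, g e)] @ (?G @ [(e, h e)]) @ ?H) ([(e, g e)] @ ([(e, h e)] @ ?G) @ ?H)"
    by (intro tensor_eq.append tensor_eq.refl tensor_eq.commute)
  moreover have "tensor_eq s1 s2 (([(e, g e)] @ [(e, h e)]) @ (?G @ ?H))
      ([(e, g e + h e)] @ map (\<lambda>e. (e, g e + h e)) es)"
    using tensor_eq.sym[OF tensor_eq.add_right[of s1 s2 e "g e" "h e"]] Cons.IH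
    by (intro tensor_eq.append) simp_all
  ultimately show ?case
    using tensor_eq.trans by fastforce
qed

lemma tensor_eq_swap:
  "tensor_eq s1 s2 xs ys \<Longrightarrow> tensor_eq s2 s1 (map prod.swap xs) (map prod.swap ys)"
proof (induction rule: tensor_eq.induct)
  case (zero b)
  have "tensor_eq s2 s1 [(b, 0)] [(0, 0)]"
    using tensor_eq.sym[OF tensor_eq.balanced[of s2 s1 0 b 0]] by simp
  then have "tensor_eq s2 s1 [(b, 0)] []"
    using tensor_eq.zero by (rule tensor_eq.trans)
  then show ?case by simp
next
  case (trans xs ys zs)
  show ?case by (rule tensor_eq.trans[OF trans.IH])
next
  case (balanced c a b)
  show ?case using tensor_eq.sym[OF tensor_eq.balanced] by simp
qed (simp_all add: tensor_eq.refl tensor_eq.sym tensor_eq.append tensor_eq.commute tensor_eq.add_left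
    tensor_eq.add_right)

text \<open>Each first component is expanded in \<open>es\<close>, its coefficients are moved across
  by \<open>balanced\<close>, and terms with equal first component are merged.\<close>

lemma tensor_eq_basis:
  assumes "fst ` set xs \<subseteq> V1.span (set es)" "distinct es"
  shows "\<exists>g. tensor_eq s1 s2 xs (map (\<lambda>e. (e, g e)) es)"
  using assms(1)
proof (induction xs)
  case Nil
  have "tensor_eq s1 s2 (map (\<lambda>e. (e, 0)) es) []"
  proof (induction es)
    case (Cons e es)
    then show ?case
      using tensor_eq.append[OF tensor_eq_zero_right[of e] Cons.IH] by simp
  qed (simp add: tensor_eq.refl)
  then show ?case by (intro exI[of _ "\<lambda>_. 0"]) (rule tensor_eq.sym)
next
  case (Cons x xs)
  obtain a b where x: "x = (a, b)" by fastforce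
  obtain g where g: "tensor_eq s1 s2 xs (map (\<lambda>e. (e, g e)) es)"
    using Cons by auto
  have "a \<in> V1.span (set es)" using Cons.prems x by simp
  then obtain c where c: "a = (\<Sum>e\<in>set es. s1 (c e) e)"
    by (auto simp: V1.span_finite)
  then have a: "a = (\<Sum>e\<leftarrow>es. s1 (c e) e)"
    using assms(2) by (simp add: sum_list_distinct_conv_sum_set)
  have "tensor_eq s1 s2 [(a, b)] (map (\<lambda>e. (s1 (c e) e, b)) es)"
    unfolding a by (rule tensor_eq_sum_left)
  moreover have "tensor_eq s1 s2 (map (\<lambda>e. (s1 (c e) e, b)) es) (map (\<lambda>e. (e, s2 (c e) b)) es)"
    by (intro tensor_eq_map tensor_eq.balanced)
  ultimately have "tensor_eq s1 s2 ([(a, b)] @ xs) (map (\<lambda>e. (e, s2 (c e) b)) es @ map (\<lambda>e. (e, g e)) es)"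
    using g by (intro tensor_eq.append) (rule tensor_eq.trans)
  then show ?case
    using tensor_eq.trans[OF _ tensor_eq_merge[of "\<lambda>e. s2 (c e) b" es g]] x
    by (intro exI[of _ "\<lambda>e. s2 (c e) b + g e"]) simp
qed

text \<open>A maximal independent subset of the first components serves as \<open>es\<close>.
  Choosing it among the components that already occur lets a property shared by all of them survive
  the rewriting.\<close>

lemma tensor_firsts_basis:
  fixes xs :: "('a \<times> 'b) list"
  obtains es g where "distinct es" "V1.independent (set es)" "set es \<subseteq> fst ` set xs"
    "tensor_eq s1 s2 xs (map (\<lambda>e. (e, g e)) es)"
proof -
  obtain B where B: "B \<subseteq> fst ` set xs" "V1.independent B" "fst ` set xs \<subseteq> V1.span B"
    using V1.maximal_independent_subset by blast
  then obtain es where es: "set es = B" "distinct es"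
    using finite_distinct_list[of B] finite_subset[OF B(1)] by auto
  then obtain g where "tensor_eq s1 s2 xs (map (\<lambda>e. (e, g e)) es)"
    using tensor_eq_basis[of xs es] B(3) by auto
  then show ?thesis
    using es B by (intro that) simp_all
qed

lemma dual_functional:
  assumes "V1.independent (set es)" "e \<in> set es"
  obtains \<phi> where "Vector_Spaces.linear s1 (*) \<phi>" "\<And>e'. e' \<in> set es \<Longrightarrow> \<phi> e' = (if e' = e then 1 else (0::'k))"
proof -
  interpret vector_space_pair s1 "(*) :: 'k \<Rightarrow> 'k \<Rightarrow> 'k"
    using vs1 vector_space_field by (simp add: vector_space_pair_def)
  show ?thesis
    using linear_independent_extend[OF assms(1), of "\<lambda>e'. if e' = e then 1 else 0"] that by blast
qed

text \<open>The functional dual to \<open>e\<close> reads off the coefficient \<open>g e\<close> of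
  the normal form, so the hypothesis puts every \<open>g e\<close> into \<open>W\<close>.\<close>

lemma tensor_seconds_in:
  assumes W: "V2.subspace W"
    and fW: "\<And>\<phi>. Vector_Spaces.linear s1 ((*) :: 'k \<Rightarrow> 'k \<Rightarrow> 'k) \<phi> \<Longrightarrow> (\<Sum>(a, b)\<leftarrow>xs. s2 (\<phi> a) b) \<in> W"
  obtains ys where "tensor_eq s1 s2 xs ys" "set ys \<subseteq> fst ` set xs \<times> W"
proof -
  obtain es g where es: "distinct es" "V1.independent (set es)" "set es \<subseteq> fst ` set xs"
    and eq: "tensor_eq s1 s2 xs (map (\<lambda>e. (e, g e)) es)"
    by (rule tensor_firsts_basis)
  have "g e \<in> W" if e: "e \<in> set es" for e
  proof -
    obtain \<phi> where \<phi>: "Vector_Spaces.linear s1 (*) \<phi>"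
      "\<And>e'. e' \<in> set es \<Longrightarrow> \<phi> e' = (if e' = e then 1 else (0::'k))"
      using dual_functional[OF es(2) e] by blast
    interpret \<phi>: Vector_Spaces.linear s1 "(*)" \<phi> by (rule \<phi>(1))
    have "(\<Sum>(a, b)\<leftarrow>xs. s2 (\<phi> a) b) = (\<Sum>(a, b)\<leftarrow>map (\<lambda>e. (e, g e)) es. s2 (\<phi> a) b)"
      by (rule tensor_eq_sum[OF eq])
        (auto simp: \<phi>.add \<phi>.scale V2.scale_left_distrib V2.scale_right_distrib mult.commute)
    also have "\<dots> = (\<Sum>e'\<leftarrow>es. if e' = e then g e' else 0)"
      using \<phi>(2) by (auto simp: o_def intro!: arg_cong[of _ _ sum_list])
    also have "\<dots> = g e"
      using es(1) e by (simp add: sum_list_distinct_conv_sum_set)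
    finally show ?thesis using fW[OF \<phi>(1)] by simp
  qed
  then have "set (map (\<lambda>e. (e, g e)) es) \<subseteq> fst ` set xs \<times> W"
    using es(3) by auto
  with eq show ?thesis by (rule that)
qed

end

text \<open>This is (U \<otimes> V) \<inter> (V \<otimes> W) = U \<otimes> W, tested by functionals.
  Normalising the swapped tensor puts the first components into \<open>U\<close>; the second pass
  selects its first components among those and so keeps \<open>U\<close> while it forces
  \<open>W\<close>.\<close>

lemma in_tensor_functionals:
  fixes s :: "'k::field \<Rightarrow> 'a::ab_group_add \<Rightarrow> 'a"
  assumes vs: "vector_space s" and U: "module.subspace s U" and W: "module.subspace s W"
    and fW: "\<And>\<phi>. Vector_Spaces.linear s ((*) :: 'k \<Rightarrow> 'k \<Rightarrow> 'k) \<phi> \<Longrightarrow> (\<Sum>(a, b)\<leftarrow>xs. s (\<phi> a) b) \<in> W"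
    and fU: "\<And>\<phi>. Vector_Spaces.linear s ((*) :: 'k \<Rightarrow> 'k \<Rightarrow> 'k) \<phi> \<Longrightarrow> (\<Sum>(a, b)\<leftarrow>xs. s (\<phi> b) a) \<in> U"
  shows "in_tensor s s U W xs"
proof -
  interpret vector_space s by (rule vs)
  have "(\<Sum>(a, b)\<leftarrow>map prod.swap xs. s (\<phi> a) b) \<in> U" if "Vector_Spaces.linear s (*) \<phi>" for \<phi>
    using fU[OF that] by (simp add: o_def split_def)
  then obtain zs where zs: "tensor_eq s s (map prod.swap xs) zs" "set zs \<subseteq> fst ` set (map prod.swap xs) \<times> U"
    by (rule tensor_seconds_in[OF vs vs U])
  define ys where "ys = map prod.swap zs"
  have eq: "tensor_eq s s xs ys"
    using tensor_eq_swap[OF vs vs zs(1)] by (simp add: ys_def o_def)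
  have "(\<Sum>(a, b)\<leftarrow>ys. s (\<phi> a) b) \<in> W" if "Vector_Spaces.linear s (*) \<phi>" for \<phi>
  proof -
    interpret \<phi>: Vector_Spaces.linear s "(*)" \<phi> by (rule that)
    have "(\<Sum>(a, b)\<leftarrow>xs. s (\<phi> a) b) = (\<Sum>(a, b)\<leftarrow>ys. s (\<phi> a) b)"
      by (rule tensor_eq_sum[OF eq])
        (auto simp: \<phi>.add \<phi>.scale scale_left_distrib scale_right_distrib mult.commute)
    then show ?thesis using fW[OF that] by simp
  qed
  then obtain ws where ws: "tensor_eq s s ys ws" "set ws \<subseteq> fst ` set ys \<times> W"
    by (rule tensor_seconds_in[OF vs vs W])
  have "fst ` set ys \<subseteq> U"
    using zs(2) by (auto simp: ys_def)
  then show ?thesis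
    unfolding in_tensor_def using ws tensor_eq.trans[OF eq ws(1)] by blast
qed


section \<open>Local finiteness of coalgebras\<close>

lemma additive_sum_list:
  fixes f :: "'a::ab_group_add \<Rightarrow> 'b::ab_group_add"
  assumes add: "\<And>x y. f (x + y) = f x + f y"
  shows "f (\<Sum>x\<leftarrow>xs. g x) = (\<Sum>x\<leftarrow>xs. f (g x))"
proof -
  have "f 0 = 0" using add[of 0 0] by simp
  then show ?thesis by (induction xs) (auto simp: add)
qed

lemma (in vector_space) finite_dim_subset:
  assumes "subspace U" "U \<subseteq> span B" "finite B"
  shows "finite_dim scale U"
proof -
  obtain C where C: "C \<subseteq> U" "independent C" "U \<subseteq> span C"
    using maximal_independent_subset by blast
  then have "finite C"
    using independent_span_bound[OF assms(3), of C] assms(2) by auto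
  moreover have "U = span C"
    using C assms(1) by (simp add: span_minimal subset_antisym)
  ultimately show ?thesis
    unfolding finite_dim_def by blast
qed

text \<open>Stated for an indexed family because injectivity of \<open>y\<close> is part of the
  conclusion drawn from \<open>indep\<close>: two indices with equal values would satisfy the
  relation with coefficients 1 and -1.\<close>

lemma (in vector_space) card_le_card_spanning:
  assumes "finite J" "finite G" "\<And>i. i \<in> J \<Longrightarrow> y i \<in> span G"
    and indep: "\<And>c i. (\<Sum>i\<in>J. scale (c i) (y i)) = 0 \<Longrightarrow> i \<in> J \<Longrightarrow> c i = 0"
  shows "card J \<le> card G"
proof -
  have "inj_on y J"
  proof (rule inj_onI, rule ccontr)
    fix a b assume *: "a \<in> J" "b \<in> J" "y a = y b" "a \<noteq> b"
    let ?c = "\<lambda>i. if i = a then 1 else if i = b then - 1 else 0"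
    have "(\<Sum>i\<in>J. scale (?c i) (y i)) = (\<Sum>i\<in>{a, b}. scale (?c i) (y i))"
      by (rule sum.mono_neutral_right) (use * assms(1) in auto)
    also have "\<dots> = 0" using * by simp
    finally show False using indep[of ?c a] * by simp
  qed
  moreover have "independent (y ` J)"
  proof
    assume "dependent (y ` J)"
    then obtain u v where u: "(\<Sum>v\<in>y ` J. scale (u v) v) = 0" "v \<in> y ` J" "u v \<noteq> 0"
      using dependent_finite[of "y ` J"] assms(1) by auto
    then have "(\<Sum>i\<in>J. scale (u (y i)) (y i)) = 0"
      using sum.reindex[OF \<open>inj_on y J\<close>, of "\<lambda>v. scale (u v) v"] by simp
    then show False using indep[of "\<lambda>i. u (y i)"] u(2,3) by auto
  qed
  ultimately show ?thesis
    using independent_span_bound[OF assms(2), of "y ` J"] assms(3) by (auto simp: card_image)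
qed

section \<open>The actions of the dual algebra on a Hopf algebra\<close>

context hopf_algebra
begin

definition functional :: "('h \<Rightarrow> 'k) \<Rightarrow> bool" where
  "functional \<phi> \<longleftrightarrow> Vector_Spaces.linear sH (*) \<phi>"

text \<open>\<open>hit_left\<close> and \<open>hit_right\<close> are the two harpoon actions that
  make \<open>'h\<close> a bimodule over its dual algebra.\<close>

definition hit_left :: "('h \<Rightarrow> 'k) \<Rightarrow> 'h \<Rightarrow> 'h" where
  "hit_left \<phi> x = (\<Sum>(a, b)\<leftarrow>\<Delta> x. sH (\<phi> a) b)"

definition hit_right :: "('h \<Rightarrow> 'k) \<Rightarrow> 'h \<Rightarrow> 'h" where
  "hit_right \<phi> x = (\<Sum>(a, b)\<leftarrow>\<Delta> x. sH (\<phi> b) a)"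

lemma functional_add: "functional \<phi> \<Longrightarrow> \<phi> (x + y) = \<phi> x + \<phi> y"
  and functional_scale: "functional \<phi> \<Longrightarrow> \<phi> (sH c x) = c * \<phi> x"
  by (auto simp: functional_def Vector_Spaces.linear_iff)

lemma functionalI:
  assumes "\<And>x y. \<phi> (x + y) = \<phi> x + \<phi> y" "\<And>c x. \<phi> (sH c x) = c * \<phi> x"
  shows "functional \<phi>"
  unfolding functional_def Vector_Spaces.linear_iff
  using assms vector_space_field vector_space_axioms by blast

lemma functional_counit: "functional \<epsilon>"
  using counit_hom by (simp add: functional_def algebra_hom_def)

text \<open>\<open>\<Delta>\<close> returns a chosen list and is additive only up to equality of
  tensors, so its linearity becomes usable once a balanced map has been applied.\<close>

lemma comult_sum_add:
  fixes \<beta> :: "'h \<Rightarrow> 'h \<Rightarrow> 'c::ab_group_add"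
  assumes "\<And>a a' b. \<beta> (a + a') b = \<beta> a b + \<beta> a' b" "\<And>a b b'. \<beta> a (b + b') = \<beta> a b + \<beta> a b'"
    "\<And>c a b. \<beta> (sH c a) b = \<beta> a (sH c b)"
  shows "(\<Sum>(a, b)\<leftarrow>\<Delta> (x + y). \<beta> a b) = (\<Sum>(a, b)\<leftarrow>\<Delta> x. \<beta> a b) + (\<Sum>(a, b)\<leftarrow>\<Delta> y. \<beta> a b)"
  using tensor_eq_sum[OF comult_add, of \<beta> x y] assms by simp

lemma comult_sum_scale:
  fixes \<beta> :: "'h \<Rightarrow> 'h \<Rightarrow> 'c::ab_group_add"
  assumes "\<And>a a' b. \<beta> (a + a') b = \<beta> a b + \<beta> a' b" "\<And>a b b'. \<beta> a (b + b') = \<beta> a b + \<beta> a b'"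
    "\<And>c a b. \<beta> (sH c a) b = \<beta> a (sH c b)"
  shows "(\<Sum>(a, b)\<leftarrow>\<Delta> (sH c x). \<beta> a b) = (\<Sum>(a, b)\<leftarrow>\<Delta> x. \<beta> (sH c a) b)"
  using tensor_eq_sum[OF comult_scale, of \<beta> c x] assms by (simp add: o_def split_def)

lemma sH_sum_list: "sH c (\<Sum>x\<leftarrow>xs. g x) = (\<Sum>x\<leftarrow>xs. sH c (g x))"
  by (rule additive_sum_list) (rule scale_right_distrib)

lemma
  assumes "functional \<phi>"
  shows hit_left_add: "hit_left \<phi> (x + y) = hit_left \<phi> x + hit_left \<phi> y"
    and hit_left_scale: "hit_left \<phi> (sH c x) = sH c (hit_left \<phi> x)"
    and hit_right_add: "hit_right \<phi> (x + y) = hit_right \<phi> x + hit_right \<phi> y"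
    and hit_right_scale: "hit_right \<phi> (sH c x) = sH c (hit_right \<phi> x)"
proof -
  note [simp] = functional_add[OF assms] functional_scale[OF assms]
    scale_left_distrib scale_right_distrib
  show "hit_left \<phi> (x + y) = hit_left \<phi> x + hit_left \<phi> y"
    and "hit_right \<phi> (x + y) = hit_right \<phi> x + hit_right \<phi> y"
    unfolding hit_left_def hit_right_def by (rule comult_sum_add; simp add: mult.commute)+
  have "hit_left \<phi> (sH c x) = (\<Sum>(a, b)\<leftarrow>\<Delta> x. sH (\<phi> (sH c a)) b)"
    unfolding hit_left_def by (rule comult_sum_scale) (simp_all add: mult.commute)
  then show "hit_left \<phi> (sH c x) = sH c (hit_left \<phi> x)"
    by (simp add: hit_left_def sH_sum_list split_def)
  have "hit_right \<phi> (sH c x) = (\<Sum>(a, b)\<leftarrow>\<Delta> x. sH (\<phi> b) (sH c a))"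
    unfolding hit_right_def by (rule comult_sum_scale) (simp_all add: mult.commute)
  then show "hit_right \<phi> (sH c x) = sH c (hit_right \<phi> x)"
    by (simp add: hit_right_def sH_sum_list split_def mult.commute)
qed

lemma coassoc_sum:
  fixes \<beta> :: "'h \<Rightarrow> 'h \<Rightarrow> 'h \<Rightarrow> 'c::ab_group_add"
  assumes "\<And>a a' b c. \<beta> (a + a') b c = \<beta> a b c + \<beta> a' b c"
    and "\<And>a b b' c. \<beta> a (b + b') c = \<beta> a b c + \<beta> a b' c"
    and "\<And>a b c c'. \<beta> a b (c + c') = \<beta> a b c + \<beta> a b c'"
    and "\<And>r a b c. \<beta> (sH r a) b c = \<beta> a (sH r b) c"
    and "\<And>r a b c. \<beta> a (sH r b) c = \<beta> a b (sH r c)"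
  shows "(\<Sum>(a, b)\<leftarrow>\<Delta> x. \<Sum>(a1, a2)\<leftarrow>\<Delta> a. \<beta> a1 a2 b) = (\<Sum>(a, b)\<leftarrow>\<Delta> x. \<Sum>(b1, b2)\<leftarrow>\<Delta> b. \<beta> a b1 b2)"
  using tensor3_eq_sum[OF coassoc, of \<beta> x] assms
  by (simp add: sum_list_concat_map split_def o_def)

lemma hit_sum:
  assumes "functional \<phi>"
  shows "hit_left \<phi> (\<Sum>(a, b)\<leftarrow>xs. sH (c a b) (d a b)) = (\<Sum>(a, b)\<leftarrow>xs. sH (c a b) (hit_left \<phi> (d a b)))"
    "hit_right \<phi> (\<Sum>(a, b)\<leftarrow>xs. sH (c a b) (d a b)) = (\<Sum>(a, b)\<leftarrow>xs. sH (c a b) (hit_right \<phi> (d a b)))"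
  using hit_left_add[OF assms] hit_right_add[OF assms]
  by (simp_all add: additive_sum_list hit_left_scale[OF assms] hit_right_scale[OF assms] split_def)

text \<open>The two actions contract the outer factors of the threefold coproduct. What remains is a
  combination of finitely many \<open>a2\<close>, in which only the coefficients depend on \<phi>
  and \<psi>; this later bounds the dimension.\<close>

lemma hit_left_right:
  "hit_left \<phi> (hit_right \<psi> x) = (\<Sum>(a, b)\<leftarrow>\<Delta> x. \<Sum>(a1, a2)\<leftarrow>\<Delta> a. sH (\<phi> a1 * \<psi> b) a2)"
  if "functional \<phi>"
  unfolding hit_right_def hit_sum[OF that]
  by (simp add: hit_left_def sH_sum_list split_def mult.commute)

lemma hit_commute:
  assumes "functional \<phi>" "functional \<psi>"
  shows "hit_left \<phi> (hit_right \<psi> x) = hit_right \<psi> (hit_left \<phi> x)"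
proof -
  note [simp] = functional_add[OF assms(1)] functional_scale[OF assms(1)]
    functional_add[OF assms(2)] functional_scale[OF assms(2)]
    scale_left_distrib scale_right_distrib distrib_left distrib_right mult_ac
  have "hit_right \<psi> (hit_left \<phi> x) = (\<Sum>(a, b)\<leftarrow>\<Delta> x. \<Sum>(b1, b2)\<leftarrow>\<Delta> b. sH (\<phi> a * \<psi> b2) b1)"
    unfolding hit_left_def hit_sum[OF assms(2)]
    by (simp add: hit_right_def sH_sum_list split_def)
  also have "\<dots> = (\<Sum>(a, b)\<leftarrow>\<Delta> x. \<Sum>(a1, a2)\<leftarrow>\<Delta> a. sH (\<phi> a1 * \<psi> b) a2)"
    by (rule coassoc_sum[symmetric]) simp_all
  finally show ?thesis
    using hit_left_right[OF assms(1)] by simp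
qed

text \<open>By coassociativity a repeated contraction is one contraction by a convolution product:
  \<psi> * \<phi> for the left action and \<phi> * \<psi> for the right one.\<close>

lemma hit_hit:
  assumes "functional \<phi>" "functional \<psi>"
  shows "\<exists>\<chi>. functional \<chi> \<and> (\<forall>x. hit_left \<phi> (hit_left \<psi> x) = hit_left \<chi> x)"
    "\<exists>\<chi>. functional \<chi> \<and> (\<forall>x. hit_right \<phi> (hit_right \<psi> x) = hit_right \<chi> x)"
proof -
  note [simp] = functional_add[OF assms(1)] functional_scale[OF assms(1)]
    functional_add[OF assms(2)] functional_scale[OF assms(2)]
    scale_left_distrib scale_right_distrib distrib_left distrib_right mult_ac
  have sum_scale: "sH (\<Sum>y\<leftarrow>ys. f y) z = (\<Sum>y\<leftarrow>ys. sH (f y) z)" for f z and ys :: "('h \<times> 'h) list"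
    by (induction ys) auto
  have lin: "functional (\<lambda>a. \<Sum>(a1, a2)\<leftarrow>\<Delta> a. \<phi>' a1 * \<psi>' a2)"
    if "functional \<phi>'" "functional \<psi>'" for \<phi>' \<psi>'
  proof (rule functionalI)
    note [simp] = functional_add[OF that(1)] functional_scale[OF that(1)]
      functional_add[OF that(2)] functional_scale[OF that(2)]
    show "(\<Sum>(a1, a2)\<leftarrow>\<Delta> (x + y). \<phi>' a1 * \<psi>' a2) =
        (\<Sum>(a1, a2)\<leftarrow>\<Delta> x. \<phi>' a1 * \<psi>' a2) + (\<Sum>(a1, a2)\<leftarrow>\<Delta> y. \<phi>' a1 * \<psi>' a2)" for x y
      by (rule comult_sum_add) simp_all
    have "(\<Sum>(a1, a2)\<leftarrow>\<Delta> (sH c x). \<phi>' a1 * \<psi>' a2) = (\<Sum>(a1, a2)\<leftarrow>\<Delta> x. \<phi>' (sH c a1) * \<psi>' a2)" for c x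
      by (rule comult_sum_scale) simp_all
    then show "(\<Sum>(a1, a2)\<leftarrow>\<Delta> (sH c x). \<phi>' a1 * \<psi>' a2) = c * (\<Sum>(a1, a2)\<leftarrow>\<Delta> x. \<phi>' a1 * \<psi>' a2)" for c x
      by (simp add: sum_list_const_mult[symmetric] split_def mult.assoc)
  qed
  have "hit_left \<phi> (hit_left \<psi> x) = hit_left (\<lambda>a. \<Sum>(a1, a2)\<leftarrow>\<Delta> a. \<psi> a1 * \<phi> a2) x" for x
  proof -
    have "hit_left \<phi> (hit_left \<psi> x) = (\<Sum>(a, b)\<leftarrow>\<Delta> x. \<Sum>(b1, b2)\<leftarrow>\<Delta> b. sH (\<psi> a * \<phi> b1) b2)"
      unfolding hit_left_def[of \<psi>] hit_sum[OF assms(1)]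
      by (simp add: hit_left_def sH_sum_list split_def)
    also have "\<dots> = (\<Sum>(a, b)\<leftarrow>\<Delta> x. \<Sum>(a1, a2)\<leftarrow>\<Delta> a. sH (\<psi> a1 * \<phi> a2) b)"
      by (rule coassoc_sum[symmetric]) simp_all
    finally show ?thesis
      by (simp add: hit_left_def sum_scale split_def)
  qed
  with lin[OF assms(2,1)]
  show "\<exists>\<chi>. functional \<chi> \<and> (\<forall>x. hit_left \<phi> (hit_left \<psi> x) = hit_left \<chi> x)" by blast
  have "hit_right \<phi> (hit_right \<psi> x) = hit_right (\<lambda>a. \<Sum>(a1, a2)\<leftarrow>\<Delta> a. \<phi> a1 * \<psi> a2) x" for x
  proof -
    have "hit_right \<phi> (hit_right \<psi> x) = (\<Sum>(a, b)\<leftarrow>\<Delta> x. \<Sum>(a1, a2)\<leftarrow>\<Delta> a. sH (\<phi> a2 * \<psi> b) a1)"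
      unfolding hit_right_def[of \<psi>] hit_sum[OF assms(1)]
      by (simp add: hit_right_def sH_sum_list split_def)
    also have "\<dots> = (\<Sum>(a, b)\<leftarrow>\<Delta> x. \<Sum>(b1, b2)\<leftarrow>\<Delta> b. sH (\<phi> b1 * \<psi> b2) a)"
      by (rule coassoc_sum) simp_all
    finally show ?thesis
      by (simp add: hit_right_def sum_scale split_def)
  qed
  with lin[OF assms(1,2)]
  show "\<exists>\<chi>. functional \<chi> \<and> (\<forall>x. hit_right \<phi> (hit_right \<psi> x) = hit_right \<chi> x)" by blast
qed

lemma hit_counit: "hit_left \<epsilon> x = x" "hit_right \<epsilon> x = x"
  by (simp_all add: hit_left_def hit_right_def counit_left counit_right)

lemma subspace_sum_list:
  "subspace U \<Longrightarrow> (\<And>x. x \<in> set xs \<Longrightarrow> f x \<in> U) \<Longrightarrow> (\<Sum>x\<leftarrow>xs. f x) \<in> U"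
  by (induction xs) (auto simp: subspace_0 subspace_add)

lemma hit_in_tensor:
  assumes "functional \<phi>" "in_tensor sH sH U W (\<Delta> x)"
  shows "subspace W \<Longrightarrow> hit_left \<phi> x \<in> W" "subspace U \<Longrightarrow> hit_right \<phi> x \<in> U"
proof -
  note [simp] = functional_add[OF assms(1)] functional_scale[OF assms(1)]
    scale_left_distrib scale_right_distrib
  obtain ys where ys: "set ys \<subseteq> U \<times> W" "tensor_eq sH sH (\<Delta> x) ys"
    using assms(2) by (auto simp: in_tensor_def)
  have "hit_left \<phi> x = (\<Sum>(a, b)\<leftarrow>ys. sH (\<phi> a) b)"
    unfolding hit_left_def by (rule tensor_eq_sum[OF ys(2)]) (simp_all add: mult.commute)
  then show "subspace W \<Longrightarrow> hit_left \<phi> x \<in> W"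
    using ys(1) by (auto intro!: subspace_sum_list subspace_scale)
  have "hit_right \<phi> x = (\<Sum>(a, b)\<leftarrow>ys. sH (\<phi> b) a)"
    unfolding hit_right_def by (rule tensor_eq_sum[OF ys(2)]) (simp_all add: mult.commute)
  then show "subspace U \<Longrightarrow> hit_right \<phi> x \<in> U"
    using ys(1) by (auto intro!: subspace_sum_list subspace_scale)
qed

theorem coalgebra_locally_finite:
  assumes C: "subcoalgebra sH \<Delta> C" and x: "x \<in> C"
  obtains D where "D \<subseteq> C" "x \<in> D" "subcoalgebra sH \<Delta> D" "finite_dim sH D"
proof -
  define G where "G = {hit_left \<phi> (hit_right \<psi> x) | \<phi> \<psi>. functional \<phi> \<and> functional \<psi>}"
  \<comment> \<open>\<open>span G\<close> is closed under both actions of the dual, hence a subcoalgebra.\<close>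
  have subC: "subspace C" and inC: "\<And>y. y \<in> C \<Longrightarrow> in_tensor sH sH C C (\<Delta> y)"
    using C by (auto simp: subcoalgebra_def)
  have "G \<subseteq> C"
    by (auto simp: G_def intro!: hit_in_tensor(1)[OF _ inC subC] hit_in_tensor(2)[OF _ inC subC] x)
  then have "span G \<subseteq> C"
    using subC by (rule span_minimal)
  moreover have "x \<in> span G"
  proof (rule span_base)
    have "hit_left \<epsilon> (hit_right \<epsilon> x) \<in> G"
      using functional_counit unfolding G_def by blast
    then show "x \<in> G" by (simp add: hit_counit)
  qed
  moreover have "subcoalgebra sH \<Delta> (span G)"
    unfolding subcoalgebra_def
  proof (intro conjI ballI)
    have closed: "hit_left \<phi> y \<in> span G \<and> hit_right \<phi> y \<in> span G"
      if \<phi>: "functional \<phi>" and y: "y \<in> span G" for \<phi> y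
      using y
    proof (induction rule: span_induct_alt)
      case base
      have "hit_left \<phi> 0 = 0" "hit_right \<phi> 0 = 0"
        using hit_left_add[OF \<phi>, of 0 0] hit_right_add[OF \<phi>, of 0 0] by simp_all
      then show ?case by (simp add: span_zero)
    next
      case (step c g y)
      obtain \<phi>1 \<psi>1 where g: "g = hit_left \<phi>1 (hit_right \<psi>1 x)" "functional \<phi>1" "functional \<psi>1"
        using step by (auto simp: G_def)
      obtain \<chi> where "functional \<chi>" "hit_left \<phi> g = hit_left \<chi> (hit_right \<psi>1 x)"
        using hit_hit(1)[OF \<phi> g(2)] g(1) by auto
      then have 1: "hit_left \<phi> g \<in> span G"
        using g by (auto simp: G_def intro!: span_base)
      \<comment> \<open>The two actions commute, so the new right contraction can be moved inside
        and merged with \<open>\<psi>1\<close>.\<close>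
      obtain \<chi> where "functional \<chi>" "hit_right \<phi> g = hit_left \<phi>1 (hit_right \<chi> x)"
        using hit_hit(2)[OF \<phi> g(3)] g(1) hit_commute[OF g(2) \<phi>, symmetric] by auto
      then have 2: "hit_right \<phi> g \<in> span G"
        using g by (auto simp: G_def intro!: span_base)
      show ?case
        using 1 2 step.IH hit_left_add[OF \<phi>] hit_left_scale[OF \<phi>] hit_right_add[OF \<phi>] hit_right_scale[OF \<phi>]
        by (simp add: span_add span_scale)
    qed
    fix y assume "y \<in> span G"
    then show "in_tensor sH sH (span G) (span G) (\<Delta> y)"
      using closed vector_space_axioms
      by (intro in_tensor_functionals) (auto simp: functional_def hit_left_def hit_right_def)
  qed simp
  moreover have "finite_dim sH (span G)"
  proof (rule finite_dim_subset)
    let ?B = "\<Union>(a, b)\<in>set (\<Delta> x). snd ` set (\<Delta> a)"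
    show "finite ?B" by auto
    have "hit_left \<phi> (hit_right \<psi> x) \<in> span ?B" if "functional \<phi>" for \<phi> \<psi>
      unfolding hit_left_right[OF that] split_def
      by (intro subspace_sum_list subspace_span span_scale span_base) force
    then have "G \<subseteq> span ?B"
      by (auto simp: G_def)
    then show "span G \<subseteq> span ?B"
      by (simp add: span_minimal)
  qed simp
  ultimately show ?thesis using that by blast
qed

end


section \<open>Reductors acting on the smash product\<close>

lemma sum_list_sum_list_swap:
  "(\<Sum>x\<leftarrow>xs. \<Sum>y\<leftarrow>ys. f x y) = (\<Sum>y\<leftarrow>ys. \<Sum>x\<leftarrow>xs. (f x y :: 'a::comm_monoid_add))"
  by (induction xs) (auto simp: sum_list_addf)

lemma sum_list_product:
  "(\<Sum>x\<leftarrow>xs. f x) * (\<Sum>y\<leftarrow>ys. g y) = (\<Sum>x\<leftarrow>xs. \<Sum>y\<leftarrow>ys. f x * (g y :: 'a::semiring_0))"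
  by (induction xs) (simp_all add: distrib_right sum_list_const_mult)

lemma sum_list_all_0: "(\<And>x. x \<in> set xs \<Longrightarrow> f x = 0) \<Longrightarrow> (\<Sum>x\<leftarrow>xs. f x) = (0 :: 'a::comm_monoid_add)"
  by (induction xs) simp_all

text \<open>The quantity whose vanishing on a subcoalgebra is condition (R2) for a reductor.\<close>

definition reduce :: "('h \<Rightarrow> 'l \<Rightarrow> 'l) \<Rightarrow> ('l \<times> 'l) list \<Rightarrow> 'h \<Rightarrow> 'l::ring_1" where
  "reduce act R x = (\<Sum>(r, s)\<leftarrow>R. r * act x s)"

definition biact :: "('l \<Rightarrow> 'p) \<Rightarrow> ('l \<times> 'l) list \<Rightarrow> 'p \<Rightarrow> 'p::ring_1" where
  "biact j R X = (\<Sum>(r, s)\<leftarrow>R. j r * X * j s)"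

lemma (in hopf_galois_order_setting) reduce_add: "reduce act R (x + y) = reduce act R x + reduce act R y"
  and reduce_scale: "reduce act R (sH c x) = s\<Lambda> c (reduce act R x)"
proof -
  have *: "act (x + y) a = act x a + act y a" "act (sH c x) a = s\<Lambda> c (act x a)" for x y c a
    using linear_act[of a] by (auto simp: Vector_Spaces.linear_iff)
  show "reduce act R (x + y) = reduce act R x + reduce act R y"
    by (simp add: reduce_def * distrib_left sum_list_addf split_def)
  show "reduce act R (sH c x) = s\<Lambda> c (reduce act R x)"
    by (simp add: reduce_def * A.scale_mult_right split_def additive_sum_list[of "s\<Lambda> c"] A.scale_right_distrib)
qed

text \<open>Because \<Lambda> is a commutative module algebra, \<open>R\<close> \<mapsto>
  \<open>reduce act R\<close> turns products into convolution products. Hence a product of reductors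
  kills every subcoalgebra that one of its factors kills, provided that \<open>ys\<close> has its
  entries in that subcoalgebra; this is why an arbitrary representative of the coproduct is
  allowed.\<close>

lemma (in hopf_galois_order_setting) reduce_tensor_mult:
  assumes "tensor_eq sH sH (\<Delta> x) ys"
  shows "reduce act (tensor_mult R R') x = (\<Sum>(x1, x2)\<leftarrow>ys. reduce act R x1 * reduce act R' x2)"
proof -
  have "reduce act (tensor_mult R R') x =
      (\<Sum>(r, s)\<leftarrow>R. \<Sum>(r', s')\<leftarrow>R'. \<Sum>(x1, x2)\<leftarrow>\<Delta> x. r * r' * (act x1 s * act x2 s'))"
    by (simp add: reduce_def tensor_mult_def sum_list_concat_map act_mult split_def o_def
        sum_list_const_mult)
  also have "\<dots> = (\<Sum>(x1, x2)\<leftarrow>\<Delta> x. \<Sum>(r, s)\<leftarrow>R. \<Sum>(r', s')\<leftarrow>R'. r * r' * (act x1 s * act x2 s'))"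
    unfolding split_def
    by (subst sum_list_sum_list_swap, subst sum_list_sum_list_swap) (simp add: sum_list_sum_list_swap[of _ "\<Delta> x"])
  also have "\<dots> = (\<Sum>(x1, x2)\<leftarrow>\<Delta> x. reduce act R x1 * reduce act R' x2)"
    by (simp add: reduce_def split_def sum_list_product mult_ac)
  also have "\<dots> = (\<Sum>(x1, x2)\<leftarrow>ys. reduce act R x1 * reduce act R' x2)"
    by (rule tensor_eq_sum[OF assms])
      (simp_all add: reduce_add reduce_scale A.scale_mult_left A.scale_mult_right distrib_left distrib_right)
  finally show ?thesis .
qed

locale galois_setting =
  hopf_galois_order_setting sH \<Delta> \<epsilon> S s\<Lambda> act actL H +
  SP: smash_product sH \<Delta> \<epsilon> S "fract_scale s\<Lambda>" actL sP iL iH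
  for sH :: "'k::field \<Rightarrow> 'h::ring_1 \<Rightarrow> 'h" and \<Delta> \<epsilon> S
    and s\<Lambda> :: "'k \<Rightarrow> 'l::idom \<Rightarrow> 'l" and act actL H
    and sP :: "'k \<Rightarrow> 'p::ring_1 \<Rightarrow> 'p" and iL iH +
  fixes m :: "'l set"
  assumes max_m: "maximal_ideal m" and fin_m: "finite_dim_quotient s\<Lambda> UNIV m"
    and fin_stab: "finite_dim_stabilizer sH \<Delta> s\<Lambda> act H m"
begin

definition j :: "'l \<Rightarrow> 'p" where "j a = iL (to_fract a)"

lemma iL_add: "iL (f + g) = iL f + iL g"
  and iL_mult: "iL (f * g) = iL f * iL g"
  and iL_1: "iL 1 = 1"
  and iL_scale: "iL (fract_scale s\<Lambda> c f) = sP c (iL f)"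
  and iH_add: "iH (x + y) = iH x + iH y"
  and iH_scale: "iH (sH c x) = sP c (iH x)"
  using SP.hom_A SP.hom_H by (auto simp: algebra_hom_def Vector_Spaces.linear_iff)

lemma iL_0: "iL 0 = 0"
  using iL_add[of 0 0] by simp

lemma j_add: "j (a + b) = j a + j b"
  and j_mult: "j (a * b) = j a * j b"
  and j_1: "j 1 = 1"
  and j_0: "j 0 = 0"
  by (simp_all add: j_def iL_add iL_mult iL_1 iL_0)

lemma j_commute: "j a * j b = j b * j a"
  by (metis j_mult mult.commute)

lemma j_scale: "j (s\<Lambda> c a) = sP c (j a)"
proof -
  have "to_fract (s\<Lambda> c a) = fract_scale s\<Lambda> c (to_fract a)"
    by (simp add: fract_scale_def A.scale_mult_left flip: to_fract_mult)
  then show ?thesis by (simp add: j_def iL_scale)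
qed

lemma actL_add: "actL (x + y) f = actL x f + actL y f"
  and actL_scale: "actL (sH c x) f = fract_scale s\<Lambda> c (actL x f)"
  using SP.linear_act[of f] by (auto simp: Vector_Spaces.linear_iff)

lemma biact_add: "biact j R (X + Y) = biact j R X + biact j R Y"
  by (simp add: biact_def algebra_simps sum_list_addf split_def)

lemma biact_sum_list: "biact j R (\<Sum>x\<leftarrow>xs. g x) = (\<Sum>x\<leftarrow>xs. biact j R (g x))"
  by (rule additive_sum_list) (rule biact_add)

lemma biact_append: "biact j (R @ Q) X = biact j R X + biact j Q X"
  by (simp add: biact_def)

lemma biact_one: "biact j [(1, 1)] X = X"
  by (simp add: biact_def j_1)

lemma biact_tensor_mult: "biact j (tensor_mult R Q) X = biact j R (biact j Q X)"
proof -
  have "biact j (tensor_mult R Q) X = (\<Sum>(r, s)\<leftarrow>R. \<Sum>(r', s')\<leftarrow>Q. j (r * r') * X * j (s' * s))"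
    by (simp add: biact_def tensor_mult_def sum_list_concat_map split_def o_def mult.commute)
  also have "\<dots> = biact j R (biact j Q X)"
    by (simp add: biact_def split_def j_mult mult.assoc flip: sum_list_const_mult sum_list_mult_const)
  finally show ?thesis .
qed

lemma biact_commute: "biact j R (biact j Q X) = biact j Q (biact j R X)"
proof -
  have "j r * (j r' * X * j s') * j s = j r' * (j r * X * j s) * j s'" for r r' s s'
    by (metis j_commute mult.assoc)
  then have "(\<Sum>(r, s)\<leftarrow>R. \<Sum>(r', s')\<leftarrow>Q. j r * (j r' * X * j s') * j s)
      = (\<Sum>(r', s')\<leftarrow>Q. \<Sum>(r, s)\<leftarrow>R. j r' * (j r * X * j s) * j s')"
    unfolding split_def by (subst sum_list_sum_list_swap) simp
  then show ?thesis
    by (simp add: biact_def split_def flip: sum_list_const_mult sum_list_mult_const)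
qed

lemma biact_tensor_eq: "tensor_eq s\<Lambda> s\<Lambda> R Q \<Longrightarrow> biact j R X = biact j Q X"
  unfolding biact_def
  by (rule tensor_eq_sum[of s\<Lambda> s\<Lambda>])
    (simp_all add: j_add j_scale distrib_left distrib_right SP.P.scale_mult_left SP.P.scale_mult_right)

text \<open>Invertibility of \<open>R\<close> modulo \<open>\<Lambda> \<otimes> m + m \<otimes> \<Lambda>\<close>, expressed through the action on the
  bimodule \<open>'p\<close>.\<close>

definition invertible_mod :: "('l \<times> 'l) list \<Rightarrow> bool" where
  "invertible_mod R \<longleftrightarrow> (\<exists>Q Z. set Z \<subseteq> (UNIV \<times> m) \<union> (m \<times> UNIV) \<and>
     (\<forall>X. biact j R (biact j Q X) = X + biact j Z X))"

lemma ideal_m: "ring_ideal m"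
  using max_m by (simp add: maximal_ideal_def)

interpretation L: module "(*) :: 'l \<Rightarrow> 'l \<Rightarrow> 'l"
  by unfold_locales (auto simp: algebra_simps)

lemma m_mult: "a \<in> m \<Longrightarrow> b * a \<in> m" "a \<in> m \<Longrightarrow> a * b \<in> m"
  using L.subspace_scale[OF ideal_m, of a b] by (simp_all add: mult.commute)

lemma invertible_mod_tensor_mult:
  assumes "invertible_mod R" "invertible_mod R'"
  shows "invertible_mod (tensor_mult R R')"
proof -
  obtain Q Z where Z: "set Z \<subseteq> (UNIV \<times> m) \<union> (m \<times> UNIV)"
    and Q: "\<And>X. biact j R (biact j Q X) = X + biact j Z X"
    using assms(1) by (auto simp: invertible_mod_def)
  obtain Q' Z' where Z': "set Z' \<subseteq> (UNIV \<times> m) \<union> (m \<times> UNIV)"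
    and Q': "\<And>X. biact j R' (biact j Q' X) = X + biact j Z' X"
    using assms(2) by (auto simp: invertible_mod_def)
  \<comment> \<open>From (1 + Z)(1 + Z') = 1 + (Z + Z' + ZZ').\<close>
  let ?Z = "Z @ Z' @ tensor_mult Z Z'"
  have "biact j (tensor_mult R R') (biact j (tensor_mult Q' Q) X) = X + biact j ?Z X" for X
  proof -
    have "biact j (tensor_mult R R') (biact j (tensor_mult Q' Q) X)
        = biact j R (biact j R' (biact j Q' (biact j Q X)))"
      by (simp add: biact_tensor_mult)
    also have "\<dots> = biact j R (biact j Q X) + biact j Z' (biact j R (biact j Q X))"
      by (simp add: Q' biact_add biact_commute[of R])
    also have "\<dots> = X + biact j ?Z X"
      by (simp add: Q biact_add biact_append biact_tensor_mult biact_commute[of Z] algebra_simps)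
    finally show ?thesis .
  qed
  moreover have "set ?Z \<subseteq> (UNIV \<times> m) \<union> (m \<times> UNIV)"
    using Z Z' by (auto simp: tensor_mult_def m_mult)
  ultimately show ?thesis
    unfolding invertible_mod_def by blast
qed

lemma reductor_invertible: "reductor s\<Lambda> act m C R \<Longrightarrow> invertible_mod R"
proof -
  assume "reductor s\<Lambda> act m C R"
  then obtain Q Z where "set Z \<subseteq> (UNIV \<times> m) \<union> (m \<times> UNIV)"
    and "tensor_eq s\<Lambda> s\<Lambda> (tensor_mult R Q) ([(1, 1)] @ Z)"
    unfolding reductor_def by blast
  then show ?thesis
    unfolding invertible_mod_def
    by (metis biact_tensor_eq biact_tensor_mult biact_append biact_one)
qed

text \<open>Every \<open>x\<close> lies in a finite-dimensional subcoalgebra that has a reductor,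
  and the product of these finitely many reductors kills all of \<open>T\<close> while staying
  invertible modulo the ideal.\<close>

lemma common_reductor_superfluous:
  assumes "finite T" "\<And>x. x \<in> T \<Longrightarrow> \<exists>C. subcoalgebra sH \<Delta> C \<and> superfluous sH \<Delta> s\<Lambda> act m C \<and> x \<in> C"
  shows "\<exists>R. invertible_mod R \<and> (\<forall>x\<in>T. reduce act R x = 0)"
proof -
  have "\<exists>D. subcoalgebra sH \<Delta> D \<and> x \<in> D \<and> (\<exists>R. reductor s\<Lambda> act m D R)" if x: "x \<in> T" for x
  proof -
    obtain C where C: "subcoalgebra sH \<Delta> C" "superfluous sH \<Delta> s\<Lambda> act m C" "x \<in> C"
      using assms(2)[OF x] by blast
    then obtain D where "D \<subseteq> C" "x \<in> D" "subcoalgebra sH \<Delta> D" "finite_dim sH D"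
      using coalgebra_locally_finite by blast
    then show ?thesis using C(2) by (auto simp: superfluous_def)
  qed
  then obtain D where D: "\<And>x. x \<in> T \<Longrightarrow> subcoalgebra sH \<Delta> (D x) \<and> x \<in> D x \<and> (\<exists>R. reductor s\<Lambda> act m (D x) R)"
    by metis
  \<comment> \<open>The induction needs the whole subcoalgebra \<open>D x\<close> to be killed and
    not just \<open>x\<close>, since the convolution formula involves the factors of the
    coproduct.\<close>
  have "\<exists>R. invertible_mod R \<and> (\<forall>x\<in>T'. \<forall>y\<in>D x. reduce act R y = 0)" if "finite T'" "T' \<subseteq> T" for T'
    using that
  proof (induction T')
    case empty
    have "invertible_mod [(1, 1)]"
      unfolding invertible_mod_def by (intro exI[of _ "[(1, 1)]"] exI[of _ "[]"]) (simp add: biact_one biact_def[of _ "[]"])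
    then show ?case by auto
  next
    case (insert x T')
    then obtain R where R: "invertible_mod R" "\<And>x y. x \<in> T' \<Longrightarrow> y \<in> D x \<Longrightarrow> reduce act R y = 0"
      by auto
    obtain R' where R': "reductor s\<Lambda> act m (D x) R'"
      using D insert.prems by auto
    have R0: "reduce act R' y = 0" if "y \<in> D x" for y
      using R' that by (simp add: reductor_def reduce_def)
    have "reduce act (tensor_mult R R') y = 0" if z: "z \<in> insert x T'" and y: "y \<in> D z" for y z
    proof -
      have "subcoalgebra sH \<Delta> (D z)" using D z insert.prems by auto
      then obtain ys where ys: "set ys \<subseteq> D z \<times> D z" "tensor_eq sH sH (\<Delta> y) ys"
        using y by (auto simp: subcoalgebra_def in_tensor_def)
      \<comment> \<open>The old factor \<open>R\<close> kills \<open>x1\<close> if \<open>z\<close>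
        was treated before; the new factor \<open>R'\<close> kills \<open>x2\<close> if
        \<open>z\<close> is the new element.\<close>
      have "reduce act R x1 * reduce act R' x2 = 0" if "(x1, x2) \<in> set ys" for x1 x2
        using that ys(1) z R(2)[of z x1] R0[of x2] by auto
      then show ?thesis
        unfolding reduce_tensor_mult[OF ys(2)] by (intro sum_list_all_0) auto
    qed
    then show ?case
      using invertible_mod_tensor_mult[OF R(1) reductor_invertible[OF R']] by blast
  qed
  from this[OF assms(1)] D show ?thesis by blast
qed

lemma reduce_0: "reduce act R 0 = 0"
  by (metis add.right_neutral add_left_imp_eq reduce_add)

lemma common_reductor:
  assumes "finite T" "T \<subseteq> superfluous_sum sH \<Delta> s\<Lambda> act m"
  obtains R where "invertible_mod R" "\<And>x. x \<in> T \<Longrightarrow> reduce act R x = 0"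
proof -
  define U where "U = \<Union>{C. subcoalgebra sH \<Delta> C \<and> superfluous sH \<Delta> s\<Lambda> act m C}"
  have "\<exists>B. finite B \<and> B \<subseteq> U \<and> x \<in> span B" if "x \<in> T" for x
  proof -
    have "x \<in> span U"
      using that assms(2) by (auto simp: superfluous_sum_def U_def)
    then obtain t r where "finite t" "t \<subseteq> U" "x = (\<Sum>a\<in>t. sH (r a) a)"
      by (auto simp: span_explicit)
    moreover have "(\<Sum>a\<in>t. sH (r a) a) \<in> span t"
      by (intro span_sum span_scale span_base)
    ultimately show ?thesis by blast
  qed
  then obtain B where B: "\<And>x. x \<in> T \<Longrightarrow> finite (B x) \<and> B x \<subseteq> U \<and> x \<in> span (B x)"
    by metis
  have "\<exists>R. invertible_mod R \<and> (\<forall>x\<in>\<Union>(B ` T). reduce act R x = 0)"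
    by (rule common_reductor_superfluous) (use B assms(1) in \<open>auto simp: U_def\<close>)
  then obtain R where R: "invertible_mod R" "\<And>x y. x \<in> T \<Longrightarrow> y \<in> B x \<Longrightarrow> reduce act R y = 0"
    by auto
  have "reduce act R x = 0" if x: "x \<in> T" for x
  proof -
    have "x \<in> span (B x)" using B x by blast
    then show ?thesis
      by (induction rule: span_induct_alt) (auto simp: reduce_0 reduce_add reduce_scale R(2)[OF x])
  qed
  with R(1) show ?thesis by (rule that)
qed

lemma biact_smash:
  assumes "tensor_eq sH sH (\<Delta> h) ys"
  shows "biact j R (iL f * iH h) = (\<Sum>(h1, h2)\<leftarrow>ys. iL (f * to_fract (reduce act R h1)) * iH h2)"
proof -
  have comm: "iH h * iL g = (\<Sum>(h1, h2)\<leftarrow>ys. iL (actL h1 g) * iH h2)" for g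
  proof -
    have "(\<Sum>(h1, h2)\<leftarrow>\<Delta> h. iL (actL h1 g) * iH h2) = (\<Sum>(h1, h2)\<leftarrow>ys. iL (actL h1 g) * iH h2)"
      by (rule tensor_eq_sum[OF assms])
        (simp_all add: actL_add actL_scale iL_add iH_add iL_scale iH_scale distrib_left distrib_right
          SP.P.scale_mult_left SP.P.scale_mult_right)
    then show ?thesis by (simp add: SP.commutation)
  qed
  have "j r * (iL f * iH h) * j s = (\<Sum>(h1, h2)\<leftarrow>ys. iL (f * to_fract (r * act h1 s)) * iH h2)" for r s
  proof -
    have "j r * (iL f * iH h) * j s = iL (f * to_fract r) * (iH h * iL (to_fract s))"
      by (simp add: j_def mult.assoc iL_mult[symmetric] mult.left_commute) (simp add: mult.assoc[symmetric] iL_mult[symmetric] mult.commute)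
    also have "\<dots> = (\<Sum>(h1, h2)\<leftarrow>ys. iL (f * to_fract (r * act h1 s)) * iH h2)"
      by (simp add: comm sum_list_const_mult[symmetric] split_def iL_mult act_extends mult.assoc)
    finally show ?thesis .
  qed
  then have "biact j R (iL f * iH h) = (\<Sum>(h1, h2)\<leftarrow>ys. \<Sum>(r, s)\<leftarrow>R. iL (f * to_fract (r * act h1 s)) * iH h2)"
    by (simp add: biact_def split_def sum_list_sum_list_swap[of _ R])
  also have "\<dots> = (\<Sum>(h1, h2)\<leftarrow>ys. iL (f * to_fract (reduce act R h1)) * iH h2)"
  proof -
    have "(\<Sum>(r, s)\<leftarrow>R. iL (f * to_fract (r * act h1 s)) * iH h2) = iL (f * to_fract (reduce act R h1)) * iH h2" for h1 h2
      unfolding reduce_def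
      by (induction R) (auto simp: distrib_left distrib_right iL_add iL_0)
    then show ?thesis by simp
  qed
  finally show ?thesis .
qed

section \<open>Left L-spans and the reduction to finitely many elements of H\<close>

definition Lspan :: "'h set \<Rightarrow> 'p set" where
  "Lspan E = {X. \<exists>f. X = (\<Sum>e\<in>E. iL (f e) * iH e)}"

lemma Lspan_0: "0 \<in> Lspan E"
  by (auto simp: Lspan_def iL_0 intro!: exI[of _ "\<lambda>_. 0"])

lemma Lspan_add: "X \<in> Lspan E \<Longrightarrow> Y \<in> Lspan E \<Longrightarrow> X + Y \<in> Lspan E"
proof -
  assume "X \<in> Lspan E" "Y \<in> Lspan E"
  then obtain f g where "X = (\<Sum>e\<in>E. iL (f e) * iH e)" "Y = (\<Sum>e\<in>E. iL (g e) * iH e)"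
    by (auto simp: Lspan_def)
  then have "X + Y = (\<Sum>e\<in>E. iL (f e + g e) * iH e)"
    by (simp add: iL_add distrib_right sum.distrib)
  then show ?thesis unfolding Lspan_def by (intro CollectI exI[of _ "\<lambda>e. f e + g e"])
qed

lemma Lspan_scale: "X \<in> Lspan E \<Longrightarrow> iL g * X \<in> Lspan E"
proof -
  assume "X \<in> Lspan E"
  then obtain f where "X = (\<Sum>e\<in>E. iL (f e) * iH e)"
    by (auto simp: Lspan_def)
  then have "iL g * X = (\<Sum>e\<in>E. iL (g * f e) * iH e)"
    by (simp add: iL_mult sum_distrib_left mult.assoc)
  then show ?thesis unfolding Lspan_def by (intro CollectI exI[of _ "\<lambda>e. g * f e"])
qed

lemma Lspan_base: "finite E \<Longrightarrow> e \<in> E \<Longrightarrow> iL f * iH e \<in> Lspan E"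
proof -
  assume "finite E" "e \<in> E"
  have "(\<Sum>e'\<in>E. iL (if e' = e then f else 0) * iH e') = (\<Sum>e'\<in>E. if e' = e then iL f * iH e else 0)"
    by (rule sum.cong) (auto simp: iL_0)
  also have "\<dots> = iL f * iH e" using \<open>finite E\<close> \<open>e \<in> E\<close> by simp
  finally show ?thesis
    unfolding Lspan_def by (intro CollectI exI[of _ "\<lambda>e'. if e' = e then f else 0"]) simp
qed

lemma Lspan_sum_list: "(\<And>x. x \<in> set xs \<Longrightarrow> g x \<in> Lspan E) \<Longrightarrow> (\<Sum>x\<leftarrow>xs. g x) \<in> Lspan E"
  by (induction xs) (auto simp: Lspan_0 Lspan_add)

lemma smash_sub_sum_list:
  assumes "X \<in> smash_sub sP iL iH H"
  obtains xs where "set xs \<subseteq> UNIV \<times> H" "X = (\<Sum>(f, h)\<leftarrow>xs. iL f * iH h)"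
proof -
  have "\<exists>xs. set xs \<subseteq> UNIV \<times> H \<and> X = (\<Sum>(f, h)\<leftarrow>xs. iL f * iH h)"
    using assms unfolding smash_sub_def
  proof (induction rule: SP.P.span_induct_alt)
    case base
    show ?case by (intro exI[of _ "[]"]) simp
  next
    case (step c y Y)
    then obtain a x xs where *: "y = iL a * iH x" "x \<in> H" "set xs \<subseteq> UNIV \<times> H" "Y = (\<Sum>(f, h)\<leftarrow>xs. iL f * iH h)"
      by auto
    then show ?case
      by (intro exI[of _ "(fract_scale s\<Lambda> c a, x) # xs"]) (simp add: iL_scale SP.P.scale_mult_left)
  qed
  then show ?thesis using that by blast
qed

lemma iH_0: "iH 0 = 0"
  using iH_add[of 0 0] by simp

lemma reduction_to_finite:
  obtains E where "finite E" "E \<subseteq> H"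
    "\<And>X. X \<in> smash_sub sP iL iH H \<Longrightarrow> \<exists>R. invertible_mod R \<and> (\<forall>T. biact j T (biact j R X) \<in> Lspan E)"
proof -
  let ?S = "superfluous_part sH \<Delta> s\<Lambda> act H m"
  obtain B where B: "B \<subseteq> H" "finite B" "\<And>h. h \<in> H \<Longrightarrow> \<exists>u\<in>span B. h - u \<in> ?S"
    using fin_stab unfolding finite_dim_stabilizer_def finite_dim_quotient_def by blast
  have "\<exists>ys. set ys \<subseteq> UNIV \<times> H \<and> tensor_eq sH sH (\<Delta> b) ys" if "b \<in> B" for b
    using that B(1) left_coideal_H by (auto simp: left_coideal_def in_tensor_def)
  then obtain ys where ys: "\<And>b. b \<in> B \<Longrightarrow> set (ys b) \<subseteq> UNIV \<times> H \<and> tensor_eq sH sH (\<Delta> b) (ys b)"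
    by metis
  \<comment> \<open>The second factors of fixed coproducts of the elements of \<open>B\<close>. They
    are chosen before \<open>X\<close>, and the coideal property places them in
    \<open>H\<close>.\<close>
  define E where "E = (\<Union>b\<in>B. snd ` set (ys b))"
  have fin: "finite E" using B(2) by (simp add: E_def)
  have "\<exists>R. invertible_mod R \<and> (\<forall>T. biact j T (biact j R X) \<in> Lspan E)" if X: "X \<in> smash_sub sP iL iH H" for X
  proof -
    obtain xs where xs: "set xs \<subseteq> UNIV \<times> H" "X = (\<Sum>(f, h)\<leftarrow>xs. iL f * iH h)"
      using smash_sub_sum_list[OF X] .
    obtain u where u: "\<And>h. h \<in> H \<Longrightarrow> u h \<in> span B \<and> h - u h \<in> ?S"
      using B(3) by metis
    have "\<exists>zs. set zs \<subseteq> superfluous_sum sH \<Delta> s\<Lambda> act m \<times> H \<and> tensor_eq sH sH (\<Delta> (h - u h)) zs" if "h \<in> H" for h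
      using u[OF that] by (auto simp: superfluous_part_def in_tensor_def)
    then obtain zs where zs: "\<And>h. h \<in> H \<Longrightarrow>
        set (zs h) \<subseteq> superfluous_sum sH \<Delta> s\<Lambda> act m \<times> H \<and> tensor_eq sH sH (\<Delta> (h - u h)) (zs h)"
      by metis
    let ?T = "\<Union>(f, h)\<in>set xs. fst ` set (zs h)"
    have "?T \<subseteq> superfluous_sum sH \<Delta> s\<Lambda> act m"
      using xs(1) zs by fastforce
    then obtain R where R: "invertible_mod R" "\<And>x. x \<in> ?T \<Longrightarrow> reduce act R x = 0"
    proof (rule common_reductor[rotated])
      show "finite ?T" by (auto split: prod.split)
    qed blast
    have "biact j T (biact j R (iL f * iH h)) \<in> Lspan E" if fh: "(f, h) \<in> set xs" for f h T
    proof -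
      have h: "h \<in> H" using fh xs(1) by auto
      have "biact j R (iL f * iH (h - u h)) = 0"
      proof -
        have "iL (f * to_fract (reduce act R h1)) * iH h2 = 0" if "(h1, h2) \<in> set (zs h)" for h1 h2
        proof -
          have "h1 \<in> ?T" using that fh by force
          then show ?thesis by (simp add: R(2) iL_0)
        qed
        then show ?thesis
          using zs[OF h] by (auto simp: biact_smash intro!: sum_list_all_0)
      qed
      then have "biact j R (iL f * iH h) = biact j R (iL f * iH (u h))"
        using biact_add[of R "iL f * iH (h - u h)" "iL f * iH (u h)"] iH_add[of "h - u h" "u h"]
        by (simp add: distrib_left[symmetric])
      moreover have "biact j R' (iL f * iH v) \<in> Lspan E" if "v \<in> span B" for R' v
        using that
      proof (induction rule: span_induct_alt)
        case base
        show ?case by (simp add: iH_0 biact_def Lspan_0 split_def)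
      next
        case (step c b v)
        have "biact j R' (iL (fract_scale s\<Lambda> c f) * iH b) \<in> Lspan E"
        proof -
          have "iL (fract_scale s\<Lambda> c f * to_fract (reduce act R' h1)) * iH h2 \<in> Lspan E"
            if "(h1, h2) \<in> set (ys b)" for h1 h2
            using that step.hyps fin by (intro Lspan_base) (auto simp: E_def intro!: bexI[of _ b] rev_image_eqI)
          then show ?thesis
            using ys[OF step.hyps] by (auto simp: biact_smash intro!: Lspan_sum_list)
        qed
        moreover have "iL f * iH (sH c b + v) = iL (fract_scale s\<Lambda> c f) * iH b + iL f * iH v"
          by (simp add: iH_add iH_scale iL_scale distrib_left SP.P.scale_mult_left SP.P.scale_mult_right)
        ultimately show ?case
          using step.IH by (simp add: biact_add Lspan_add)
      qed
      ultimately show ?thesis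
        using u[OF h] by (simp flip: biact_tensor_mult)
    qed
    then have "biact j T (biact j R X) \<in> Lspan E" for T
      unfolding xs(2) by (auto simp: biact_sum_list intro!: Lspan_sum_list)
    with R(1) show ?thesis by blast
  qed
  moreover have "E \<subseteq> H" using ys by (fastforce simp: E_def)
  ultimately show ?thesis using fin by (intro that) auto
qed

end


section \<open>Finite generation\<close>

text \<open>Adding points cuts out a decreasing chain of subspaces of coefficient vectors, which
  becomes stationary by dimension. The induction makes this concrete: each new index costs at most
  one new point.\<close>

lemma finite_determining_set:
  fixes g :: "'e \<Rightarrow> 't \<Rightarrow> 'f::field"
  assumes "finite E"
  shows "\<exists>A. finite A \<and> (\<forall>f. (\<forall>a\<in>A. (\<Sum>e\<in>E. f e * g e a) = 0) \<longrightarrow> (\<forall>a. (\<Sum>e\<in>E. f e * g e a) = 0))"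
  using assms
proof (induction E)
  case empty
  show ?case by auto
next
  case (insert e0 E)
  let ?s = "\<lambda>f a. \<Sum>e\<in>insert e0 E. f e * g e a"
  obtain A where A: "finite A"
    and IH: "\<And>f a. (\<And>a. a \<in> A \<Longrightarrow> (\<Sum>e\<in>E. f e * g e a) = 0) \<Longrightarrow> (\<Sum>e\<in>E. f e * g e a) = 0"
    using insert.IH by metis
  have IH0: "?s f a = 0" if "f e0 = 0" "\<And>a. a \<in> A \<Longrightarrow> ?s f a = 0" for f a
    using IH[of f a] that insert.hyps by simp
  show ?case
  proof (cases "\<exists>f a0. (\<forall>a\<in>A. ?s f a = 0) \<and> ?s f a0 \<noteq> 0")
    case False
    with A show ?thesis by blast
  next
    case True
    then obtain f0 a0 where f0: "\<And>a. a \<in> A \<Longrightarrow> ?s f0 a = 0" "?s f0 a0 \<noteq> 0" by blast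
    then have ne: "f0 e0 \<noteq> 0" using IH0 by blast
    have "?s f a = 0" if f: "\<And>a. a \<in> insert a0 A \<Longrightarrow> ?s f a = 0" for f a
    proof -
      \<comment> \<open>Chosen to cancel the coefficient at \<open>e0\<close>, so that
        \<open>IH0\<close> applies to f - c f0. Evaluating at \<open>a0\<close>, where
        \<open>f\<close> vanishes and \<open>f0\<close> does not, then forces c = 0.\<close>
      define c where "c = f e0 / f0 e0"
      have lin: "?s (\<lambda>e. f e - c * f0 e) b = ?s f b - c * ?s f0 b" for b
        by (simp add: sum_subtractf[symmetric] sum_distrib_left algebra_simps del: sum.insert)
      have z: "?s (\<lambda>e. f e - c * f0 e) b = 0" for b
      proof (rule IH0)
        show "f e0 - c * f0 e0 = 0" using ne by (simp add: c_def)
        show "?s (\<lambda>e. f e - c * f0 e) a = 0" if "a \<in> A" for a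
          unfolding lin using that f[of a] f0(1)[of a] by simp
      qed
      have "c * ?s f0 a0 = 0" using z[of a0] f[of a0] unfolding lin by simp
      then have "c = 0" using f0(2) by simp
      then show ?thesis using z[of a] unfolding lin by simp
    qed
    with A show ?thesis by (intro exI[of _ "insert a0 A"]) (metis finite_insert)
  qed
qed

lemma common_denominator:
  fixes f :: "'e \<Rightarrow> 'l::idom fract"
  assumes "finite E"
  shows "\<exists>d a. d \<noteq> 0 \<and> (\<forall>e\<in>E. to_fract d * f e = to_fract (a e))"
  using assms
proof (induction E)
  case empty
  show ?case by (intro exI[of _ 1]) simp
next
  case (insert e0 E)
  then obtain d a where d: "d \<noteq> 0" "\<And>e. e \<in> E \<Longrightarrow> to_fract d * f e = to_fract (a e)" by blast
  obtain p q where pq: "f e0 = Fract p q" "q \<noteq> 0" by (cases "f e0") auto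
  have "to_fract q * f e0 = to_fract p"
    using pq by (simp add: to_fract_def eq_fract)
  then have *: "to_fract (d * q) * f e0 = to_fract (d * p)"
    by (simp add: mult.assoc)
  have **: "to_fract (d * q) * f e = to_fract (q * a e)" if "e \<in> E" for e
    using d(2)[OF that] by (simp add: mult.commute mult.left_commute)
  show ?case
    using * ** d(1) pq(2) insert.hyps
    by (intro exI[of _ "d * q"] exI[of _ "\<lambda>e. if e = e0 then d * p else q * a e"]) auto
qed

text \<open>The evaluations map \<open>M\<close> to a finite power of the ring, and generators of
  the image are found one coordinate at a time: lift generators of the ideal of values at
  \<open>a0\<close>, then continue with the kernel of that evaluation. Linearity is assumed on
  \<open>M\<close> only, to suit evaluations that take values in \<Lambda> by the order condition on
  \<open>F\<close>.\<close>

lemma (in module) noetherian_finite_separation: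
  assumes noeth: "noetherian TYPE('a)" and "finite A" "subspace M"
    and "\<And>a x y. x \<in> M \<Longrightarrow> y \<in> M \<Longrightarrow> ev a (x + y) = ev a x + ev a y"
    and "\<And>a c x. x \<in> M \<Longrightarrow> ev a (scale c x) = c * ev a x"
  shows "\<exists>G. finite G \<and> G \<subseteq> M \<and> (\<forall>x\<in>M. \<exists>y\<in>span G. \<forall>a\<in>A. ev a x = ev a y)"
  using assms(2-)
proof (induction A arbitrary: M)
  case empty
  then show ?case by (intro exI[of _ "{}"]) auto
next
  case (insert a0 A)
  interpret R: module "(*) :: 'a \<Rightarrow> 'a \<Rightarrow> 'a"
    by unfold_locales (simp_all add: distrib_left distrib_right mult.assoc)
  note M = insert.prems(1) and add = insert.prems(2) and scale = insert.prems(3)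
  have ev0: "ev a 0 = 0" for a
    using scale[of 0 a 0] M by (simp add: subspace_0)
  have ideal: "ring_ideal (ev a0 ` M)"
  proof (rule R.subspaceI)
    show "0 \<in> ev a0 ` M" using ev0 M by (force simp: subspace_0)
    fix x y assume "x \<in> ev a0 ` M" "y \<in> ev a0 ` M"
    then obtain x' y' where *: "x = ev a0 x'" "y = ev a0 y'" "x' \<in> M" "y' \<in> M" by blast
    then have "x + y = ev a0 (x' + y')" by (simp add: add)
    then show "x + y \<in> ev a0 ` M" using * M by (simp add: subspace_add)
  next
    fix c x assume "x \<in> ev a0 ` M"
    then obtain x' where *: "x = ev a0 x'" "x' \<in> M" by blast
    then have "c * x = ev a0 (c *s x')" by (simp add: scale)
    then show "c * x \<in> ev a0 ` M" using * M by (simp add: subspace_scale)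
  qed
  obtain B where B: "finite B" "ev a0 ` M = R.span B"
    using noeth[unfolded noetherian_def, rule_format, OF ideal] by auto
  have "\<forall>b\<in>B. \<exists>g. g \<in> M \<and> ev a0 g = b"
  proof
    fix b assume "b \<in> B"
    then have "b \<in> ev a0 ` M" unfolding B(2) by (rule R.span_base)
    then show "\<exists>g. g \<in> M \<and> ev a0 g = b" by blast
  qed
  then obtain g where g: "\<And>b. b \<in> B \<Longrightarrow> g b \<in> M \<and> ev a0 (g b) = b" by metis
  define M' where "M' = {x \<in> M. ev a0 x = 0}"
  have M': "subspace M'"
    using M by (auto simp: M'_def ev0 subspace_0 subspace_add subspace_scale add scale intro!: subspaceI)
  have "\<exists>G. finite G \<and> G \<subseteq> M' \<and> (\<forall>x\<in>M'. \<exists>y\<in>span G. \<forall>a\<in>A. ev a x = ev a y)"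
    by (rule insert.IH[OF M']) (auto simp: M'_def add scale)
  then obtain G' where G': "finite G'" "G' \<subseteq> M'" "\<And>x. x \<in> M' \<Longrightarrow> \<exists>y\<in>span G'. \<forall>a\<in>A. ev a x = ev a y"
    by blast
  have "\<exists>y\<in>span (g ` B \<union> G'). \<forall>a\<in>insert a0 A. ev a x = ev a y" if x: "x \<in> M" for x
  proof -
    have "ev a0 x \<in> R.span B" using x B(2) by blast
    then obtain c where c: "ev a0 x = (\<Sum>b\<in>B. c b * b)"
      using B(1) by (auto simp: R.span_finite)
    have part: "(\<Sum>b\<in>C. c b *s g b) \<in> M \<and> ev a0 (\<Sum>b\<in>C. c b *s g b) = (\<Sum>b\<in>C. c b * b)"
      if "finite C" "C \<subseteq> B" for C
      using that by (induction C) (use g M in \<open>auto simp: ev0 subspace_0 subspace_add subspace_scale add scale\<close>)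
    define y1 where "y1 = (\<Sum>b\<in>B. c b *s g b)"
    have y1: "y1 \<in> M" "ev a0 y1 = ev a0 x"
      using part[of B] B(1) c by (auto simp: y1_def)
    have neg: "ev a (- y1) = - ev a y1" "ev a (x - y1) = ev a x - ev a y1" for a
      using scale[OF y1(1), of a "- 1"] add[OF x, of "- y1" a] M y1(1) by (simp_all add: subspace_neg)
    have "x - y1 \<in> M'"
      using x y1 M by (simp add: M'_def subspace_diff neg)
    then obtain y2 where y2: "y2 \<in> span G'" "\<And>a. a \<in> A \<Longrightarrow> ev a (x - y1) = ev a y2"
      using G'(3) by blast
    have y2M: "y2 \<in> M'" using y2(1) G'(2) M' span_minimal by blast
    have "y1 + y2 \<in> span (g ` B \<union> G')"
      unfolding y1_def by (intro span_add span_sum span_scale)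
        (use y2(1) span_mono[of G' "g ` B \<union> G'"] in \<open>auto intro: span_base\<close>)
    moreover have "ev a x = ev a (y1 + y2)" if "a \<in> insert a0 A" for a
      using that y2(2)[of a] y2M y1 neg by (auto simp: add M'_def diff_eq_eq add.commute)
    ultimately show ?thesis by blast
  qed
  moreover have "g ` B \<union> G' \<subseteq> M" using g G'(2) by (auto simp: M'_def)
  ultimately show ?case using B(1) G'(1) by (intro exI[of _ "g ` B \<union> G'"]) auto
qed

section \<open>Endomorphisms of L and faithfulness\<close>

context galois_setting
begin

text \<open>Well-definedness of the description in \<open>hat\<close>: by \<open>mult_inj\<close>
  two expressions of \<open>X\<close> are equal as tensors, and the sum on the right is
  balanced.\<close>

lemma hat_eq:
  assumes "X = (\<Sum>(f, h)\<leftarrow>xs. iL f * iH h)"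
  shows "hat actL iL iH X g = (\<Sum>(f, h)\<leftarrow>xs. f * actL h g)"
  unfolding hat_def
proof (rule the_equality)
  show "\<exists>ys. X = (\<Sum>(f, x)\<leftarrow>ys. iL f * iH x) \<and> (\<Sum>(f, h)\<leftarrow>xs. f * actL h g) = (\<Sum>(f, x)\<leftarrow>ys. f * actL x g)"
    using assms by blast
  fix r assume "\<exists>ys. X = (\<Sum>(f, x)\<leftarrow>ys. iL f * iH x) \<and> r = (\<Sum>(f, x)\<leftarrow>ys. f * actL x g)"
  then obtain ys where ys: "X = (\<Sum>(f, x)\<leftarrow>ys. iL f * iH x)" "r = (\<Sum>(f, x)\<leftarrow>ys. f * actL x g)"
    by blast
  have "tensor_eq (fract_scale s\<Lambda>) sH ys xs"
    using ys(1) assms by (intro SP.mult_inj) simp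
  then show "r = (\<Sum>(f, h)\<leftarrow>xs. f * actL h g)"
    unfolding ys(2)
    by (rule tensor_eq_sum) (simp_all add: distrib_left distrib_right actL_add actL_scale fract_scale_def mult_ac)
qed

lemma hat_Lspan:
  assumes "finite E"
  shows "hat actL iL iH (\<Sum>e\<in>E. iL (f e) * iH e) g = (\<Sum>e\<in>E. f e * actL e g)"
proof -
  obtain es where es: "set es = E" "distinct es"
    using finite_distinct_list[OF assms] by blast
  have "hat actL iL iH (\<Sum>e\<in>E. iL (f e) * iH e) g = (\<Sum>(f, h)\<leftarrow>map (\<lambda>e. (f e, e)) es. f * actL h g)"
    by (rule hat_eq) (use es in \<open>simp add: o_def sum_list_distinct_conv_sum_set\<close>)
  then show ?thesis using es by (simp add: o_def sum_list_distinct_conv_sum_set)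
qed

text \<open>Finitely many points decide whether the endomorphism vanishes on all of \<Lambda>, and
  then faithfulness applies. As \<open>faithful\<close> speaks about coefficients in \<Lambda>,
  denominators are cleared before and divided out afterwards.\<close>

lemma separating_set:
  assumes "finite E" "E \<subseteq> H"
  obtains A where "finite A"
    "\<And>X. X \<in> Lspan E \<Longrightarrow> (\<And>a. a \<in> A \<Longrightarrow> hat actL iL iH X (to_fract a) = 0) \<Longrightarrow> X = 0"
proof -
  obtain A where A: "finite A"
    "\<And>f a. (\<And>a. a \<in> A \<Longrightarrow> (\<Sum>e\<in>E. f e * actL e (to_fract a)) = 0) \<Longrightarrow> (\<Sum>e\<in>E. f e * actL e (to_fract a)) = 0"
    using finite_determining_set[OF assms(1), of "\<lambda>e a. actL e (to_fract a)"] by metis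
  have "X = 0" if X: "X \<in> Lspan E" and z: "\<And>a. a \<in> A \<Longrightarrow> hat actL iL iH X (to_fract a) = 0" for X
  proof -
    obtain f where f: "X = (\<Sum>e\<in>E. iL (f e) * iH e)" using X by (auto simp: Lspan_def)
    have zero: "(\<Sum>e\<in>E. f e * actL e (to_fract b)) = 0" for b
      by (rule A(2)) (use z in \<open>simp add: f hat_Lspan[OF assms(1)]\<close>)
    obtain d a where d: "d \<noteq> 0" "\<And>e. e \<in> E \<Longrightarrow> to_fract d * f e = to_fract (a e)"
      using common_denominator[OF assms(1), of f] by blast
    obtain es where es: "set es = E" "distinct es"
      using finite_distinct_list[OF assms(1)] by blast
    have "tensor_eq s\<Lambda> sH (map (\<lambda>e. (a e, e)) es) []"
    proof (rule faithful)
      show "set (map (\<lambda>e. (a e, e)) es) \<subseteq> UNIV \<times> H" using es assms(2) by auto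
      fix b
      have "to_fract (\<Sum>e\<in>E. a e * act e b) = (\<Sum>e\<in>E. to_fract d * f e * actL e (to_fract b))"
        by (simp add: act_extends d(2))
      also have "\<dots> = to_fract d * (\<Sum>e\<in>E. f e * actL e (to_fract b))"
        by (simp add: sum_distrib_left mult.assoc)
      finally have "to_fract (\<Sum>e\<in>E. a e * act e b) = 0" by (simp only: zero mult_zero_right)
      then have "(\<Sum>e\<in>E. a e * act e b) = 0" by (simp only: to_fract_eq_0_iff)
      then show "(\<Sum>(a, x)\<leftarrow>map (\<lambda>e. (a e, e)) es. a * act x b) = 0"
        using es by (simp add: o_def sum_list_distinct_conv_sum_set)
    qed
    then have "(\<Sum>(a, h)\<leftarrow>map (\<lambda>e. (a e, e)) es. j a * iH h) = (\<Sum>(a, h)\<leftarrow>[]. j a * iH h)"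
      by (rule tensor_eq_sum)
        (simp_all add: distrib_left distrib_right j_add iH_add j_scale iH_scale SP.P.scale_mult_left SP.P.scale_mult_right)
    then have "(\<Sum>e\<in>E. j (a e) * iH e) = 0"
      using es by (simp add: o_def sum_list_distinct_conv_sum_set)
    moreover have "iL (to_fract d) * X = (\<Sum>e\<in>E. j (a e) * iH e)"
      unfolding f by (simp add: sum_distrib_left j_def d(2)[symmetric] iL_mult mult.assoc)
    ultimately have "iL (inverse (to_fract d)) * (iL (to_fract d) * X) = 0" by simp
    then show ?thesis
      using d(1) by (simp add: mult.assoc[symmetric] iL_mult[symmetric] iL_1)
  qed
  with A(1) show ?thesis by (rule that)
qed

end

locale galois_order_in_setting = galois_setting +
  fixes F
  assumes order_F: "galois_order actL H sP iL iH F"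
begin

interpretation J: module "\<lambda>a X. j a * X"
  by unfold_locales (simp_all add: distrib_left distrib_right j_add j_mult j_1 mult.assoc)

lemma subalgebra_F: "subalgebra sP F"
  and F_sub: "F \<subseteq> smash_sub sP iL iH H"
  and j_F: "j a \<in> F"
  and hat_F: "X \<in> F \<Longrightarrow> hat actL iL iH X (to_fract a) \<in> range to_fract"
  using order_F by (auto simp: galois_order_def j_def)

lemma F_subspace: "SP.P.subspace F"
  and F_1: "1 \<in> F"
  and F_mult: "X \<in> F \<Longrightarrow> Y \<in> F \<Longrightarrow> X * Y \<in> F"
  using subalgebra_F by (auto simp: subalgebra_def)

lemmas F_add = SP.P.subspace_add[OF F_subspace]
  and F_0 = SP.P.subspace_0[OF F_subspace]
  and F_scale = SP.P.subspace_scale[OF F_subspace]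
  and F_diff = SP.P.subspace_diff[OF F_subspace]

lemma biact_F: "X \<in> F \<Longrightarrow> biact j R X \<in> F"
  unfolding biact_def by (induction R) (auto simp: F_0 intro!: F_add F_mult j_F)

lemma finitely_generated_part:
  assumes "finite E" "E \<subseteq> H"
  obtains G where "finite G" "G \<subseteq> F \<inter> Lspan E"
    "\<And>X. X \<in> F \<inter> Lspan E \<Longrightarrow> \<exists>c. X = (\<Sum>g\<in>G. j (c g) * g)"
proof -
  let ?M = "F \<inter> Lspan E"
  obtain A where A: "finite A"
    "\<And>X. X \<in> Lspan E \<Longrightarrow> (\<And>a. a \<in> A \<Longrightarrow> hat actL iL iH X (to_fract a) = 0) \<Longrightarrow> X = 0"
    using separating_set[OF assms] by blast
  \<comment> \<open>The order condition puts this value into \<Lambda>; working there instead of in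
    \<open>L\<close> is what brings the noetherian hypothesis to bear.\<close>
  define ev where "ev a X = (THE l. to_fract l = hat actL iL iH X (to_fract a))" for a X
  have ev: "to_fract (ev a X) = hat actL iL iH X (to_fract a)" if XF: "X \<in> F" for a X
  proof -
    obtain l where "to_fract l = hat actL iL iH X (to_fract a)"
      using hat_F[OF XF, of a] by force
    then show ?thesis unfolding ev_def by (rule theI) (metis \<open>to_fract l = _\<close> to_fract_eq_iff)
  qed
  have hat_add: "hat actL iL iH (X + Y) g = hat actL iL iH X g + hat actL iL iH Y g"
    if XY: "X \<in> Lspan E" "Y \<in> Lspan E" for X Y g
  proof -
    obtain f f' where f: "X = (\<Sum>e\<in>E. iL (f e) * iH e)" "Y = (\<Sum>e\<in>E. iL (f' e) * iH e)"
      using XY by (auto simp: Lspan_def)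
    then have "X + Y = (\<Sum>e\<in>E. iL (f e + f' e) * iH e)"
      by (simp add: iL_add distrib_right sum.distrib)
    then show ?thesis
      using f by (simp add: hat_Lspan[OF assms(1)] distrib_right sum.distrib)
  qed
  have hat_scale: "hat actL iL iH (j a * X) g = to_fract a * hat actL iL iH X g"
    if XE: "X \<in> Lspan E" for X a g
  proof -
    obtain f where f: "X = (\<Sum>e\<in>E. iL (f e) * iH e)"
      using XE by (auto simp: Lspan_def)
    then have "j a * X = (\<Sum>e\<in>E. iL (to_fract a * f e) * iH e)"
      by (simp add: iL_mult j_def sum_distrib_left mult.assoc)
    then show ?thesis
      using f by (simp only: hat_Lspan[OF assms(1)]) (simp add: sum_distrib_left mult.assoc)
  qed
  have M: "J.subspace ?M"
    using Lspan_scale[of _ E "to_fract _"]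
    by (intro J.subspaceI) (auto simp: Lspan_0 Lspan_add F_0 j_F j_def[symmetric] intro!: F_add F_mult)
  have ev_add: "ev a (X + Y) = ev a X + ev a Y" if "X \<in> ?M" "Y \<in> ?M" for a X Y
  proof -
    have "to_fract (ev a (X + Y)) = to_fract (ev a X + ev a Y)"
      using that by (simp add: ev F_add hat_add)
    then show ?thesis by (simp only: to_fract_eq_iff)
  qed
  have ev_scale: "ev a (j c * X) = c * ev a X" if "X \<in> ?M" for a c X
  proof -
    have "to_fract (ev a (j c * X)) = to_fract (c * ev a X)"
      using that by (simp add: ev F_mult j_F hat_scale)
    then show ?thesis by (simp only: to_fract_eq_iff)
  qed
  have "\<exists>G. finite G \<and> G \<subseteq> ?M \<and> (\<forall>X\<in>?M. \<exists>Y\<in>J.span G. \<forall>a\<in>A. ev a X = ev a Y)"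
    by (rule J.noetherian_finite_separation[OF noetherian A(1) M, of ev]) (auto simp: ev_add ev_scale)
  then obtain G where G: "finite G" "G \<subseteq> ?M" "\<And>X. X \<in> ?M \<Longrightarrow> \<exists>Y\<in>J.span G. \<forall>a\<in>A. ev a X = ev a Y"
    by blast
  have "\<exists>c. X = (\<Sum>g\<in>G. j (c g) * g)" if X: "X \<in> ?M" for X
  proof -
    obtain Y where Y: "Y \<in> J.span G" "\<And>a. a \<in> A \<Longrightarrow> ev a X = ev a Y" using G(3)[OF X] by blast
    have YM: "Y \<in> ?M" using Y(1) G(2) M J.span_minimal by blast
    \<comment> \<open>Agreement on \<open>A\<close> means equality inside \<open>Lspan E\<close>, so
      \<open>X\<close> itself, and not only its tuple of values, is generated by
      \<open>G\<close>.\<close>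
    have "X - Y = 0"
    proof (rule A(2))
      show D: "X - Y \<in> Lspan E" using J.subspace_diff[OF M X YM] by blast
      fix a assume "a \<in> A"
      then have "hat actL iL iH X (to_fract a) = hat actL iL iH Y (to_fract a)"
        using Y(2) X YM by (metis ev IntD1)
      then show "hat actL iL iH (X - Y) (to_fract a) = 0"
        using hat_add[OF D, of Y "to_fract a"] YM by simp
    qed
    then have "X \<in> J.span G" using Y(1) by simp
    then show ?thesis using G(1) by (auto simp: J.span_finite)
  qed
  with G(1,2) show ?thesis by (rule that)
qed

end


section \<open>Powers of the maximal ideal\<close>

fun tensor_power :: "('a::ring_1 \<times> 'b::ring_1) list \<Rightarrow> nat \<Rightarrow> ('a \<times> 'b) list" where
  "tensor_power Z 0 = [(1, 1)]"
| "tensor_power Z (Suc n) = tensor_mult Z (tensor_power Z n)"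

context galois_setting
begin

interpretation L: module "(*) :: 'l \<Rightarrow> 'l \<Rightarrow> 'l"
  by unfold_locales (simp_all add: distrib_left distrib_right mult.assoc)

lemma ideal_power_ideal: "ring_ideal (ideal_power m k)"
  by (cases k) simp_all

lemma ideal_power_mult: "a \<in> ideal_power m k \<Longrightarrow> b * a \<in> ideal_power m k"
  "a \<in> ideal_power m k \<Longrightarrow> a * b \<in> ideal_power m k"
  using L.subspace_scale[OF ideal_power_ideal, of a k b] by (simp_all add: mult.commute)

lemma ideal_power_SucI: "a \<in> ideal_power m k \<Longrightarrow> b \<in> m \<Longrightarrow> a * b \<in> ideal_power m (Suc k)"
  by (auto intro!: L.span_base)

lemma ideal_power_Suc_sub_m: "ideal_power m (Suc k) \<subseteq> m"
  unfolding ideal_power.simps by (rule L.span_minimal[OF _ ideal_m]) (auto simp: m_mult)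

lemma m_uminus: "a \<in> m \<Longrightarrow> - a \<in> m"
  using L.subspace_neg[OF ideal_m] .

text \<open>As \<Lambda> is noetherian, \<open>m\<close> has finitely many generators. If
  \<open>B\<close> spans \<Lambda> modulo the k-th power, the products of \<open>B\<close> with
  these generators span \<open>m\<close> modulo the next power: an error in a coefficient gains one
  factor from \<open>m\<close>.\<close>

lemma ideal_power_finite_codim:
  "\<exists>B. finite B \<and> (\<forall>a. \<exists>b\<in>A.span B. a - b \<in> ideal_power m k)"
proof (induction k)
  case 0
  show ?case by (intro exI[of _ "{}"]) simp
next
  case (Suc k)
  then obtain B where B: "finite B" "\<And>a. \<exists>b\<in>A.span B. a - b \<in> ideal_power m k" by blast
  obtain B1 where B1: "finite B1" "\<And>a. \<exists>b\<in>A.span B1. a - b \<in> m"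
    using fin_m by (auto simp: finite_dim_quotient_def)
  obtain G where G: "finite G" "m = L.span G"
    using noetherian ideal_m unfolding noetherian_def by blast
  let ?B = "B1 \<union> (\<lambda>(b, g). b * g) ` (B \<times> G)"
  have "\<exists>b\<in>A.span ?B. a - b \<in> ideal_power m (Suc k)" for a
  proof -
    obtain b where b: "b \<in> A.span B1" "a - b \<in> m" using B1(2) by blast
    then obtain c where c: "a - b = (\<Sum>g\<in>G. c g * g)"
      using G by (auto simp: L.span_finite)
    obtain d where d: "\<And>x. d x \<in> A.span B" "\<And>x. x - d x \<in> ideal_power m k"
      using B(2) by metis
    have "d (c g) * g \<in> A.span ?B" if "g \<in> G" for g
      using d(1)[of "c g"]
    proof (induction rule: A.span_induct_alt)
      case base
      show ?case by (simp add: A.span_zero)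
    next
      case (step r x y)
      have "x * g \<in> A.span ?B"
        using step.hyps that by (intro A.span_base) force
      then show ?case
        using step.IH by (simp add: distrib_right A.scale_mult_left A.span_add A.span_scale)
    qed
    then have "(\<Sum>g\<in>G. d (c g) * g) \<in> A.span ?B"
      by (intro A.span_sum)
    moreover have "b \<in> A.span ?B"
      using b(1) A.span_mono[of B1 ?B] by blast
    moreover have "a - (b + (\<Sum>g\<in>G. d (c g) * g)) = (\<Sum>g\<in>G. (c g - d (c g)) * g)"
      using c by (simp add: left_diff_distrib sum_subtractf diff_diff_eq[symmetric])
    moreover have "(\<Sum>g\<in>G. (c g - d (c g)) * g) \<in> ideal_power m (Suc k)"
      by (intro L.subspace_sum ideal_power_ideal ideal_power_SucI d(2)) (use G(2) in \<open>auto intro: L.span_base\<close>)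
    ultimately show ?thesis
      by (intro bexI[of _ "b + (\<Sum>g\<in>G. d (c g) * g)"]) (auto intro: A.span_add)
  qed
  moreover have "finite ?B" using B(1) B1(1) G(1) by simp
  ultimately show ?case by blast
qed

text \<open>Each of the n factors has a leg in \<open>m\<close> and is counted on that side.\<close>

lemma tensor_power_degree:
  assumes "set Z \<subseteq> (UNIV \<times> m) \<union> (m \<times> UNIV)" "(a, b) \<in> set (tensor_power Z n)"
  shows "\<exists>k l. k + l = n \<and> a \<in> ideal_power m k \<and> b \<in> ideal_power m l"
  using assms(2)
proof (induction n arbitrary: a b)
  case 0
  then show ?case by auto
next
  case (Suc n)
  then obtain z w a' b' where *: "(z, w) \<in> set Z" "(a', b') \<in> set (tensor_power Z n)" "a = z * a'" "b = w * b'"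
    by (auto simp: tensor_mult_def)
  obtain k l where kl: "k + l = n" "a' \<in> ideal_power m k" "b' \<in> ideal_power m l"
    using Suc.IH[OF *(2)] by blast
  consider "z \<in> m" | "w \<in> m" using *(1) assms(1) by auto
  then show ?case
  proof cases
    case 1
    have "a \<in> ideal_power m (Suc k)" "b \<in> ideal_power m l"
      unfolding *(3,4) using ideal_power_SucI[OF kl(2) 1] ideal_power_mult(1)[OF kl(3)]
      by (simp_all only: mult.commute[of z])
    then show ?thesis using kl(1) by (intro exI[of _ "Suc k"] exI[of _ l]) simp
  next
    case 2
    have "b \<in> ideal_power m (Suc l)" "a \<in> ideal_power m k"
      unfolding *(3,4) using ideal_power_SucI[OF kl(3) 2] ideal_power_mult(1)[OF kl(2)]
      by (simp_all only: mult.commute[of w])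
    then show ?thesis using kl(1) by (intro exI[of _ k] exI[of _ "Suc l"]) simp
  qed
qed

lemma biact_uminus: "biact j (map (\<lambda>(a, b). (- a, b)) Z) X = - biact j Z X"
proof -
  have "j (- a) = - j a" for a
    using j_add[of a "- a"] by (simp add: j_0 eq_neg_iff_add_eq_0 add.commute)
  then show ?thesis
    by (induction Z) (auto simp: biact_def)
qed

end

text \<open>\<open>G\<close> generates the left \<open>\<Lambda>\<close>-module \<open>F\<^sub>E\<close> of the introduction.\<close>

locale galois_order_core = galois_order_in_setting +
  fixes G
  assumes finite_G: "finite G" and G_F: "G \<subseteq> F"
    and core: "X \<in> F \<Longrightarrow> \<exists>R. invertible_mod R \<and> (\<forall>T. \<exists>c. biact j T (biact j R X) = (\<Sum>g\<in>G. j (c g) * g))"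
begin

text \<open>With RQ = 1 - Z this is the finite Neumann series: 1 - Z^n equals (1 + Z + ... +
  Z^(n-1)) Q R. The list \<open>Z\<close> is fixed before \<open>n\<close>, so the exponent can
  later be adapted to the modules.\<close>

lemma core_approximation:
  assumes X: "X \<in> F"
  obtains Z where "set Z \<subseteq> (UNIV \<times> m) \<union> (m \<times> UNIV)"
    "\<And>n. \<exists>c. X - (\<Sum>g\<in>G. j (c g) * g) = biact j (tensor_power Z n) X"
proof -
  obtain R where R: "invertible_mod R" "\<And>T. \<exists>c. biact j T (biact j R X) = (\<Sum>g\<in>G. j (c g) * g)"
    using core[OF X] by blast
  then obtain Q Z0 where Z0: "set Z0 \<subseteq> (UNIV \<times> m) \<union> (m \<times> UNIV)"
    and Q: "\<And>X. biact j R (biact j Q X) = X + biact j Z0 X"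
    unfolding invertible_mod_def by blast
  \<comment> \<open>The product RQ acts as 1 + Z0; the sign is changed to fit the geometric
    series.\<close>
  define Z where "Z = map (\<lambda>(a, b). (- a, b)) Z0"
  have Z: "set Z \<subseteq> (UNIV \<times> m) \<union> (m \<times> UNIV)"
    using Z0 by (auto simp: Z_def m_uminus)
  have RQ: "X - biact j Z X = biact j Q (biact j R X)" for X
    using Q[of X] by (simp add: Z_def biact_uminus biact_commute)
  have diff: "biact j T (X - Y) = biact j T X - biact j T Y" for T X Y
    using biact_add[of T "X - Y" Y] by (simp add: algebra_simps)
  have T: "\<exists>T. X - biact j (tensor_power Z n) X = biact j T (biact j R X)" for n
  proof (induction n)
    case 0
    show ?case by (intro exI[of _ "[]"]) (simp add: biact_one biact_def[of _ "[]"])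
  next
    case (Suc n)
    then obtain T where T: "X - biact j (tensor_power Z n) X = biact j T (biact j R X)" by blast
    have "X - biact j (tensor_power Z (Suc n)) X
        = (X - biact j (tensor_power Z n) X) + biact j (tensor_power Z n) (X - biact j Z X)"
      by (simp add: biact_tensor_mult diff biact_commute[of Z])
    also have "\<dots> = biact j (T @ tensor_mult (tensor_power Z n) Q) (biact j R X)"
      unfolding T RQ by (simp add: biact_append biact_tensor_mult)
    finally show ?case by blast
  qed
  have "\<exists>c. X - (\<Sum>g\<in>G. j (c g) * g) = biact j (tensor_power Z n) X" for n
  proof -
    obtain T c where "X - biact j (tensor_power Z n) X = biact j T (biact j R X)"
      and "biact j T (biact j R X) = (\<Sum>g\<in>G. j (c g) * g)"
      using T[of n] R(2) by blast
    then have "X = (\<Sum>g\<in>G. j (c g) * g) + biact j (tensor_power Z n) X"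
      by (simp only: diff_eq_eq)
    then have "X - (\<Sum>g\<in>G. j (c g) * g) = biact j (tensor_power Z n) X"
      by (simp only: diff_eq_eq add.commute)
    then show ?thesis by blast
  qed
  with Z show ?thesis by (rule that)
qed

end

lemma (in galois_order_in_setting) exists_core:
  obtains G where "galois_order_core sH \<Delta> \<epsilon> S s\<Lambda> act actL H sP iL iH m F G"
proof -
  obtain E where E: "finite E" "E \<subseteq> H"
    "\<And>X. X \<in> smash_sub sP iL iH H \<Longrightarrow> \<exists>R. invertible_mod R \<and> (\<forall>T. biact j T (biact j R X) \<in> Lspan E)"
    using reduction_to_finite by blast
  obtain G where G: "finite G" "G \<subseteq> F \<inter> Lspan E"
    "\<And>X. X \<in> F \<inter> Lspan E \<Longrightarrow> \<exists>c. X = (\<Sum>g\<in>G. j (c g) * g)"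
    using finitely_generated_part[OF E(1,2)] by blast
  have "\<exists>R. invertible_mod R \<and> (\<forall>T. \<exists>c. biact j T (biact j R X) = (\<Sum>g\<in>G. j (c g) * g))" if X: "X \<in> F" for X
  proof -
    obtain R where R: "invertible_mod R" "\<And>T. biact j T (biact j R X) \<in> Lspan E"
      using E(3) X F_sub by blast
    then show ?thesis using G(3) biact_F[OF biact_F[OF X]] by blast
  qed
  then have "galois_order_core sH \<Delta> \<epsilon> S s\<Lambda> act actL H sP iL iH m F G"
    using G(1,2) by unfold_locales auto
  then show ?thesis by (rule that)
qed


section \<open>Weight spaces and their projections\<close>

text \<open>The parameter \<open>mul\<close> is the product of the algebra or of its opposite, so
  that both halves of the theorem share one proof. Commutativity of \<Lambda> makes \<open>j\<close>
  multiplicative for either.\<close>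

locale galois_order_modules =
  galois_order_core sH \<Delta> \<epsilon> S s\<Lambda> act actL H sP iL iH m F G + V: vector_space sV
  for sH :: "'k::field \<Rightarrow> 'h::ring_1 \<Rightarrow> 'h" and \<Delta> \<epsilon> S
    and s\<Lambda> :: "'k \<Rightarrow> 'l::idom \<Rightarrow> 'l" and act actL H
    and sP :: "'k \<Rightarrow> 'p::ring_1 \<Rightarrow> 'p" and iL iH m F G
    and sV :: "'k \<Rightarrow> 'v::ab_group_add \<Rightarrow> 'v" +
  fixes mul :: "'p \<Rightarrow> 'p \<Rightarrow> 'p"
  assumes mul_cases: "mul = (\<lambda>a b. a * b) \<or> mul = (\<lambda>a b. b * a)"
begin

abbreviation is_module :: "('p, 'v) rep \<Rightarrow> bool" where
  "is_module \<equiv> left_module sP F mul sV"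

lemma mul_F: "X \<in> F \<Longrightarrow> Y \<in> F \<Longrightarrow> mul X Y \<in> F"
  using mul_cases F_mult by auto

lemma mul_j: "mul (j a) (j b) = j (a * b)"
  using mul_cases j_mult j_commute by metis

context
  fixes M :: "('p, 'v) rep"
  assumes M: "is_module M"
begin

lemma carrier_subspace: "V.subspace (fst M)"
  and act_closed: "X \<in> F \<Longrightarrow> v \<in> fst M \<Longrightarrow> snd M X v \<in> fst M"
  and act_add: "X \<in> F \<Longrightarrow> v \<in> fst M \<Longrightarrow> w \<in> fst M \<Longrightarrow> snd M X (v + w) = snd M X v + snd M X w"
  and act_add_alg: "X \<in> F \<Longrightarrow> Y \<in> F \<Longrightarrow> v \<in> fst M \<Longrightarrow> snd M (X + Y) v = snd M X v + snd M Y v"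
  and act_scale: "X \<in> F \<Longrightarrow> v \<in> fst M \<Longrightarrow> snd M X (sV c v) = sV c (snd M X v)"
  and act_scale_alg: "X \<in> F \<Longrightarrow> v \<in> fst M \<Longrightarrow> snd M (sP c X) v = sV c (snd M X v)"
  and act_mul: "X \<in> F \<Longrightarrow> Y \<in> F \<Longrightarrow> v \<in> fst M \<Longrightarrow> snd M (mul X Y) v = snd M X (snd M Y v)"
  and act_1: "v \<in> fst M \<Longrightarrow> snd M 1 v = v"
  using M by (auto simp: left_module_def split_beta)

lemma act_0: "X \<in> F \<Longrightarrow> snd M X 0 = 0"
  using act_scale[of X 0 0] carrier_subspace V.subspace_0 by auto

lemma act_0_alg: "v \<in> fst M \<Longrightarrow> snd M 0 v = 0"
  using act_scale_alg[of 0 v 0] F_0 by auto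

lemma act_sum_alg:
  assumes "v \<in> fst M" "\<And>x. x \<in> A \<Longrightarrow> f x \<in> F"
  shows "snd M (\<Sum>x\<in>A. f x) v = (\<Sum>x\<in>A. snd M (f x) v)"
proof (cases "finite A")
  case True
  then show ?thesis
    using assms(2)
  proof (induction A)
    case (insert x A)
    have "(\<Sum>x\<in>A. f x) \<in> F" by (rule SP.P.subspace_sum[OF F_subspace]) (use insert in auto)
    with insert show ?case by (simp add: act_add_alg assms(1))
  qed (simp add: act_0_alg assms(1))
qed (simp add: act_0_alg assms(1))

lemma act_sum_list_alg:
  assumes "v \<in> fst M" "\<And>x. x \<in> set xs \<Longrightarrow> f x \<in> F"
  shows "snd M (\<Sum>x\<leftarrow>xs. f x) v = (\<Sum>x\<leftarrow>xs. snd M (f x) v) \<and> (\<Sum>x\<leftarrow>xs. f x) \<in> F"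
  using assms(2) by (induction xs) (auto simp: act_0_alg act_add_alg assms(1) F_0 F_add)

lemma act_diff_alg: "X \<in> F \<Longrightarrow> Y \<in> F \<Longrightarrow> v \<in> fst M \<Longrightarrow> snd M (X - Y) v = snd M X v - snd M Y v"
  using act_add_alg[of "X - Y" Y v] F_diff by (simp add: algebra_simps)

lemma act_j_mult: "v \<in> fst M \<Longrightarrow> snd M (j (a * b)) v = snd M (j a) (snd M (j b) v)"
  using act_mul[of "j a" "j b" v] by (simp add: mul_j j_F)

lemma act_j_commute: "v \<in> fst M \<Longrightarrow> snd M (j a) (snd M (j b) v) = snd M (j b) (snd M (j a) v)"
  by (metis act_j_mult mult.commute)

text \<open>For the opposite product the outer factors change places: the one written on the left of
  \<open>X\<close> acts first.\<close>

lemma act_bimodule: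
  assumes "X \<in> F" "v \<in> fst M"
  shows "snd M (j a * X * j b) v = (if mul = (\<lambda>a b. a * b) then snd M (j a) (snd M X (snd M (j b) v))
     else snd M (j b) (snd M X (snd M (j a) v)))"
proof -
  have *: "snd M (mul (j c) (mul X (j d))) v = snd M (j c) (snd M X (snd M (j d) v))" for c d
    using assms by (simp add: act_mul mul_F j_F act_closed)
  show ?thesis
  proof (cases "mul = (\<lambda>a b. a * b)")
    case True
    then have eq: "j a * X * j b = mul (j a) (mul X (j b))" by (simp add: mult.assoc)
    show ?thesis unfolding if_P[OF True] eq by (rule *)
  next
    case False
    then have eq: "j a * X * j b = mul (j b) (mul X (j a))" using mul_cases by auto
    show ?thesis unfolding if_not_P[OF False] eq by (rule *)
  qed
qed

lemma act_j_mul_alg: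
  assumes "X \<in> F" "v \<in> fst M"
  shows "snd M (j a * X) v = (if mul = (\<lambda>a b. a * b) then snd M (j a) (snd M X v)
     else snd M X (snd M (j a) v))"
  using act_bimodule[OF assms, of a 1] assms by (simp add: j_1 act_1 act_closed j_F)

lemma act_span:
  assumes "X \<in> F" "D \<subseteq> fst M" "v \<in> V.span D"
  shows "v \<in> fst M" "snd M X v \<in> V.span (snd M X ` D)"
proof -
  have "v \<in> fst M \<and> snd M X v \<in> V.span (snd M X ` D)"
    using assms(3)
  proof (induction rule: V.span_induct_alt)
    case base
    show ?case by (simp add: act_0 assms(1) V.span_zero V.subspace_0[OF carrier_subspace])
  next
    case (step c x y)
    have xy: "sV c x \<in> fst M" "x \<in> fst M" "y \<in> fst M"
      using step assms(2) V.subspace_scale[OF carrier_subspace] by auto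
    then have "snd M X (sV c x + y) = sV c (snd M X x) + snd M X y"
      using assms(1) by (simp add: act_add act_scale)
    moreover have "sV c x + y \<in> fst M"
      using xy V.subspace_add[OF carrier_subspace] by blast
    ultimately show ?case
      using step by (auto intro!: V.span_add V.span_scale intro: V.span_base)
  qed
  then show "v \<in> fst M" "snd M X v \<in> V.span (snd M X ` D)" by blast+
qed

lemma weight_space_subset: "weight_space j M n \<subseteq> fst M"
  by (auto simp: weight_space_def)

lemma weight_space_subspace: "V.subspace (weight_space j M n)"
proof (rule V.subspaceI)
  show "0 \<in> weight_space j M n"
    using carrier_subspace by (simp add: weight_space_def V.subspace_0 act_0 j_F)
next
  fix v w assume "v \<in> weight_space j M n" "w \<in> weight_space j M n"
  then obtain N N' where *: "v \<in> fst M" "w \<in> fst M"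
    "\<And>k a. k \<ge> N \<Longrightarrow> a \<in> ideal_power n k \<Longrightarrow> snd M (j a) v = 0"
    "\<And>k a. k \<ge> N' \<Longrightarrow> a \<in> ideal_power n k \<Longrightarrow> snd M (j a) w = 0"
    unfolding weight_space_def by blast
  have "\<forall>k\<ge>max N N'. \<forall>a\<in>ideal_power n k. snd M (j a) (v + w) = 0"
    using * by (auto simp: act_add j_F)
  then show "v + w \<in> weight_space j M n"
    using *(1,2) V.subspace_add[OF carrier_subspace] unfolding weight_space_def by blast
next
  fix c v assume "v \<in> weight_space j M n"
  then obtain N where *: "v \<in> fst M" "\<And>k a. k \<ge> N \<Longrightarrow> a \<in> ideal_power n k \<Longrightarrow> snd M (j a) v = 0"
    unfolding weight_space_def by blast
  then have "\<forall>k\<ge>N. \<forall>a\<in>ideal_power n k. snd M (j a) (sV c v) = 0"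
    by (simp add: act_scale j_F)
  then show "sV c v \<in> weight_space j M n"
    using *(1) V.subspace_scale[OF carrier_subspace] unfolding weight_space_def by blast
qed

lemma act_weight_space:
  assumes "v \<in> weight_space j M n"
  shows "snd M (j a) v \<in> weight_space j M n"
proof -
  obtain N where N: "v \<in> fst M" "\<And>k b. k \<ge> N \<Longrightarrow> b \<in> ideal_power n k \<Longrightarrow> snd M (j b) v = 0"
    using assms unfolding weight_space_def by blast
  have "snd M (j b) (snd M (j a) v) = 0" if "k \<ge> N" "b \<in> ideal_power n k" for k b
    using act_j_commute[OF N(1), of b a] N(2)[OF that] by (simp add: act_0 j_F)
  then show ?thesis
    using N(1) unfolding weight_space_def by (auto simp: act_closed j_F)
qed

text \<open>Some m^N kills \<open>v\<close>, so the orbit is a quotient of the finite-dimensional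
  algebra \<Lambda> / m^N.\<close>

lemma weight_orbit_finite_dim:
  assumes "v \<in> weight_space j M m"
  obtains D where "finite D" "D \<subseteq> fst M" "\<And>a. snd M (j a) v \<in> V.span D"
proof -
  obtain N where N: "v \<in> fst M" "\<And>b. b \<in> ideal_power m N \<Longrightarrow> snd M (j b) v = 0"
    using assms unfolding weight_space_def by blast
  obtain B where B: "finite B" "\<And>a. \<exists>b\<in>A.span B. a - b \<in> ideal_power m N"
    using ideal_power_finite_codim[of N] by blast
  let ?D = "(\<lambda>b. snd M (j b) v) ` B"
  have "snd M (j a) v \<in> V.span ?D" for a
  proof -
    obtain b where b: "b \<in> A.span B" "a - b \<in> ideal_power m N" using B(2) by blast
    have "snd M (j b) v \<in> V.span ?D"
      using b(1)
    proof (induction rule: A.span_induct_alt)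
      case base
      show ?case by (simp add: j_0 act_0_alg N(1) V.span_zero)
    next
      case (step c x y)
      have "snd M (j (s\<Lambda> c x + y)) v = sV c (snd M (j x) v) + snd M (j y) v"
        using N(1) by (simp add: j_add j_scale act_add_alg act_scale_alg j_F F_scale)
      then show ?case
        using step by (auto intro!: V.span_add V.span_scale intro: V.span_base)
    qed
    moreover have "snd M (j a) v = snd M (j b) v"
      using N(2)[OF b(2)] act_add_alg[of "j (a - b)" "j b" v] N(1) j_add[of "a - b" b] by (simp add: j_F)
    ultimately show ?thesis by simp
  qed
  then show ?thesis
    using B(1) N(1) by (intro that[of ?D]) (auto simp: act_closed j_F)
qed

end

text \<open>Requiring \<open>w\<close> to vanish outside \<open>I\<close> makes the family unique as
  a function, as the description in \<open>proj\<close> demands, although \<open>I\<close> itself is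
  not unique.\<close>

definition decomposes :: "('p, 'v) rep \<Rightarrow> 'v \<Rightarrow> ('l set \<Rightarrow> 'v) \<Rightarrow> bool" where
  "decomposes M v w \<longleftrightarrow> (\<exists>I. finite I \<and> I \<subseteq> cofinite_maximal_ideals s\<Lambda> \<and>
     (\<forall>n\<in>I. w n \<in> weight_space j M n) \<and> (\<forall>n. n \<notin> I \<longrightarrow> w n = 0) \<and> v = (\<Sum>n\<in>I. w n))"

definition proj :: "('p, 'v) rep \<Rightarrow> 'v \<Rightarrow> 'v" where
  "proj M v = (THE w. decomposes M v w) m"

lemma m_cofinite: "m \<in> cofinite_maximal_ideals s\<Lambda>"
  using max_m fin_m by (simp add: cofinite_maximal_ideals_def)

context
  fixes M :: "('p, 'v) rep"
  assumes M: "is_module M" and hc: "harish_chandra s\<Lambda> j sV M"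
begin

lemmas ws_sub = weight_space_subspace[OF M]

lemma decomposes_common:
  assumes "decomposes M v w" "decomposes M v' w'"
  obtains I where "finite I" "I \<subseteq> cofinite_maximal_ideals s\<Lambda>"
    "\<And>n. w n \<in> weight_space j M n" "\<And>n. w' n \<in> weight_space j M n"
    "\<And>n. n \<notin> I \<Longrightarrow> w n = 0" "\<And>n. n \<notin> I \<Longrightarrow> w' n = 0" "v = (\<Sum>n\<in>I. w n)" "v' = (\<Sum>n\<in>I. w' n)"
proof -
  obtain I where I: "finite I" "I \<subseteq> cofinite_maximal_ideals s\<Lambda>" "\<forall>n\<in>I. w n \<in> weight_space j M n"
    "\<forall>n. n \<notin> I \<longrightarrow> w n = 0" "v = (\<Sum>n\<in>I. w n)"
    using assms(1) unfolding decomposes_def by blast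
  obtain I' where I': "finite I'" "I' \<subseteq> cofinite_maximal_ideals s\<Lambda>" "\<forall>n\<in>I'. w' n \<in> weight_space j M n"
    "\<forall>n. n \<notin> I' \<longrightarrow> w' n = 0" "v' = (\<Sum>n\<in>I'. w' n)"
    using assms(2) unfolding decomposes_def by blast
  show ?thesis
  proof (rule that[of "I \<union> I'"])
    show "w n \<in> weight_space j M n" "w' n \<in> weight_space j M n" for n
      using I(3,4) I'(3,4) V.subspace_0[OF ws_sub] by metis+
    show "v = (\<Sum>n\<in>I \<union> I'. w n)" "v' = (\<Sum>n\<in>I \<union> I'. w' n)"
      unfolding I(5) I'(5) by (rule sum.mono_neutral_left; use I I' in auto)+
  qed (use I I' in auto)
qed

lemma decomposes_unique:
  assumes "decomposes M v w" "decomposes M v w'"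
  shows "w = w'"
proof -
  obtain I where I: "finite I" "I \<subseteq> cofinite_maximal_ideals s\<Lambda>"
    "\<And>n. w n \<in> weight_space j M n" "\<And>n. w' n \<in> weight_space j M n"
    "\<And>n. n \<notin> I \<Longrightarrow> w n = 0" "\<And>n. n \<notin> I \<Longrightarrow> w' n = 0" "v = (\<Sum>n\<in>I. w n)" "v = (\<Sum>n\<in>I. w' n)"
    using decomposes_common[OF assms] by blast
  have "(\<Sum>n\<in>I. w n - w' n) = 0"
    unfolding sum_subtractf I(7)[symmetric] I(8)[symmetric] by simp
  moreover have "\<forall>n\<in>I. w n - w' n \<in> weight_space j M n"
    using I(3,4) V.subspace_diff[OF ws_sub] by blast
  ultimately have "\<forall>n\<in>I. w n - w' n = 0"
    using hc[unfolded harish_chandra_def, THEN conjunct2, rule_format, of I "\<lambda>n. w n - w' n"] I(1,2)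
    by blast
  then show ?thesis using I(5,6) by (metis eq_iff_diff_eq_0 ext)
qed

lemma decomposes_add:
  assumes "decomposes M v w" "decomposes M v' w'"
  shows "decomposes M (v + v') (\<lambda>n. w n + w' n)"
proof -
  obtain I where "finite I" "I \<subseteq> cofinite_maximal_ideals s\<Lambda>"
    "\<And>n. w n \<in> weight_space j M n" "\<And>n. w' n \<in> weight_space j M n"
    "\<And>n. n \<notin> I \<Longrightarrow> w n = 0" "\<And>n. n \<notin> I \<Longrightarrow> w' n = 0" "v = (\<Sum>n\<in>I. w n)" "v' = (\<Sum>n\<in>I. w' n)"
    using decomposes_common[OF assms] by blast
  then show ?thesis
    unfolding decomposes_def
    by (intro exI[of _ I]) (simp add: sum.distrib V.subspace_add[OF ws_sub])
qed

text \<open>Additivity is available on the carrier only, because nothing is known about an action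
  outside of it; for this reason the induction also keeps the partial sums inside the
  carrier.\<close>

lemma decomposes_map:
  assumes "decomposes M v w"
    and f: "\<And>n x. x \<in> weight_space j M n \<Longrightarrow> f x \<in> weight_space j M n"
    and add: "\<And>x y. x \<in> fst M \<Longrightarrow> y \<in> fst M \<Longrightarrow> f (x + y) = f x + f y" and f0: "f 0 = 0"
  shows "decomposes M (f v) (\<lambda>n. f (w n))"
proof -
  obtain I where I: "finite I" "I \<subseteq> cofinite_maximal_ideals s\<Lambda>" "\<forall>n\<in>I. w n \<in> weight_space j M n"
    "\<forall>n. n \<notin> I \<longrightarrow> w n = 0" "v = (\<Sum>n\<in>I. w n)"
    using assms(1) unfolding decomposes_def by blast
  have "f (\<Sum>n\<in>I'. w n) = (\<Sum>n\<in>I'. f (w n)) \<and> (\<Sum>n\<in>I'. w n) \<in> fst M" if "finite I'" "I' \<subseteq> I" for I'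
    using that
  proof (induction I')
    case empty
    show ?case using f0 V.subspace_0[OF carrier_subspace[OF M]] by simp
  next
    case (insert n I')
    then have "w n \<in> fst M" using I(3) weight_space_subset[OF M] by blast
    with insert show ?case using V.subspace_add[OF carrier_subspace[OF M]] by (simp add: add)
  qed
  from this[OF I(1)] show ?thesis
    unfolding decomposes_def using I f f0 by (intro exI[of _ I]) auto
qed

lemma decomposes_single:
  assumes "n \<in> cofinite_maximal_ideals s\<Lambda>" "v \<in> weight_space j M n"
  shows "decomposes M v (\<lambda>n'. if n' = n then v else 0)"
  unfolding decomposes_def using assms by (intro exI[of _ "{n}"]) auto

lemma decomposes_exists:
  assumes "v \<in> fst M"
  shows "\<exists>w. decomposes M v w"
proof -
  have "v \<in> V.span (\<Union>n\<in>cofinite_maximal_ideals s\<Lambda>. weight_space j M n)"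
    using assms hc unfolding harish_chandra_def by blast
  then show ?thesis
  proof (induction rule: V.span_induct_alt)
    case base
    show ?case
      unfolding decomposes_def by (intro exI[of _ "\<lambda>_. 0"] exI[of _ "{}"]) simp
  next
    case (step c x y)
    then obtain n w where *: "n \<in> cofinite_maximal_ideals s\<Lambda>" "x \<in> weight_space j M n" "decomposes M y w" by blast
    have "sV c x \<in> weight_space j M n" using V.subspace_scale[OF ws_sub] *(2) by blast
    from decomposes_add[OF decomposes_single[OF *(1) this] *(3)] show ?case by blast
  qed
qed

lemma proj_eq: "decomposes M v w \<Longrightarrow> proj M v = w m"
  unfolding proj_def using decomposes_unique by (metis the_equality)

lemma proj_in:
  assumes "v \<in> fst M"
  shows "proj M v \<in> weight_space j M m"
proof -
  obtain w where w: "decomposes M v w" using decomposes_exists[OF assms] by blast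
  then have "w m \<in> weight_space j M m"
    using V.subspace_0[OF ws_sub] unfolding decomposes_def by metis
  then show ?thesis using proj_eq[OF w] by simp
qed

lemma proj_carrier: "v \<in> fst M \<Longrightarrow> proj M v \<in> fst M"
  using proj_in weight_space_subset[OF M] by blast

lemma proj_add:
  assumes "v \<in> fst M" "v' \<in> fst M"
  shows "proj M (v + v') = proj M v + proj M v'"
proof -
  obtain w w' where w: "decomposes M v w" "decomposes M v' w'"
    using decomposes_exists assms by blast
  show ?thesis using proj_eq[OF decomposes_add[OF w]] proj_eq[OF w(1)] proj_eq[OF w(2)] by simp
qed

lemma proj_map:
  assumes "v \<in> fst M" "\<And>n x. x \<in> weight_space j M n \<Longrightarrow> f x \<in> weight_space j M n"
    and "\<And>x y. x \<in> fst M \<Longrightarrow> y \<in> fst M \<Longrightarrow> f (x + y) = f x + f y" and "f 0 = 0"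
  shows "proj M (f v) = f (proj M v)"
proof -
  obtain w where w: "decomposes M v w" using decomposes_exists[OF assms(1)] by blast
  show ?thesis using proj_eq[OF decomposes_map[OF w assms(2-4)]] proj_eq[OF w] by simp
qed

lemma proj_scale: "v \<in> fst M \<Longrightarrow> proj M (sV c v) = sV c (proj M v)"
  by (rule proj_map) (auto simp: V.subspace_scale[OF ws_sub] V.scale_right_distrib)

lemma proj_act: "v \<in> fst M \<Longrightarrow> proj M (snd M (j a) v) = snd M (j a) (proj M v)"
  by (rule proj_map) (auto simp: act_weight_space[OF M] act_add[OF M] act_0[OF M] j_F)

lemma proj_id: "v \<in> weight_space j M m \<Longrightarrow> proj M v = v"
  using proj_eq[OF decomposes_single[OF m_cofinite]] by simp

lemma proj_0: "proj M 0 = 0"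
  by (rule proj_id) (rule V.subspace_0[OF ws_sub])

lemma proj_sum:
  assumes "\<And>x. x \<in> A \<Longrightarrow> f x \<in> fst M"
  shows "proj M (\<Sum>x\<in>A. f x) = (\<Sum>x\<in>A. proj M (f x))"
proof (cases "finite A")
  case True
  then show ?thesis
    using assms
  proof (induction A)
    case (insert x A)
    have "(\<Sum>x\<in>A. f x) \<in> fst M" by (rule V.subspace_sum[OF carrier_subspace[OF M]]) (use insert in auto)
    with insert show ?case by (simp add: proj_add)
  qed (simp add: proj_0)
qed (simp add: proj_0)

lemma proj_sum_list:
  assumes "\<And>x. x \<in> set xs \<Longrightarrow> f x \<in> fst M \<and> proj M (f x) = 0"
  shows "proj M (\<Sum>x\<leftarrow>xs. f x) = 0 \<and> (\<Sum>x\<leftarrow>xs. f x) \<in> fst M"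
  using assms
  by (induction xs) (auto simp: proj_0 proj_add V.subspace_0[OF carrier_subspace[OF M]] V.subspace_add[OF carrier_subspace[OF M]])

lemma proj_span:
  assumes "D \<subseteq> fst M" "v \<in> V.span D"
  shows "proj M v \<in> V.span (proj M ` D)"
proof -
  have "v \<in> fst M \<and> proj M v \<in> V.span (proj M ` D)"
    using assms(2)
  proof (induction rule: V.span_induct_alt)
    case base
    show ?case by (simp add: proj_0 V.span_zero V.subspace_0[OF carrier_subspace[OF M]])
  next
    case (step c x y)
    have xy: "sV c x \<in> fst M" "x \<in> fst M" "y \<in> fst M"
      using step assms(1) V.subspace_scale[OF carrier_subspace[OF M]] by auto
    then have "proj M (sV c x + y) = sV c (proj M x) + proj M y"
      by (simp add: proj_add proj_scale)
    moreover have "sV c x + y \<in> fst M"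
      using xy V.subspace_add[OF carrier_subspace[OF M]] by blast
    ultimately show ?case
      using step by (auto intro!: V.span_add V.span_scale intro: V.span_base)
  qed
  then show ?thesis by blast
qed

end

end


section \<open>Vectors annihilated by the maximal ideal\<close>

lemma (in module) span_subset_zero: "S \<subseteq> {0} \<Longrightarrow> x \<in> span S \<Longrightarrow> x = 0"
  using span_minimal[of S "{0}"] by auto

context galois_order_modules
begin

text \<open>The socle of the component at \<open>m\<close>, viewed as a \<Lambda>-module.\<close>

definition socle :: "('p, 'v) rep \<Rightarrow> 'v set" where
  "socle M = {v \<in> weight_space j M m. \<forall>a\<in>m. snd M (j a) v = 0}"

text \<open>Taken with respect to \<open>mul\<close>, hence a right ideal of \<open>F\<close> in the
  opposite case.\<close>

definition is_left_ideal :: "'p set \<Rightarrow> bool" where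
  "is_left_ideal K \<longleftrightarrow> K \<subseteq> F \<and> 0 \<in> K \<and> (\<forall>X\<in>K. \<forall>Y\<in>K. X + Y \<in> K) \<and> (\<forall>c. \<forall>X\<in>K. sP c X \<in> K) \<and>
     (\<forall>A\<in>F. \<forall>X\<in>K. mul A X \<in> K)"

lemma socle_carrier: "v \<in> socle M \<Longrightarrow> v \<in> fst M"
  by (simp add: socle_def weight_space_def)

text \<open>If m^(k+1) is the least power that kills \<open>v0\<close>, every vector of m^k v0 is
  killed by \<open>m\<close>, and one of them is nonzero. The least exponent is positive since m^0
  contains 1.\<close>

lemma socle_nonzero:
  assumes M: "is_module M" and ne: "weight_space j M m \<noteq> {0}"
  shows "\<exists>v\<in>socle M. v \<noteq> 0"
proof -
  obtain v0 where v0: "v0 \<in> weight_space j M m" "v0 \<noteq> 0"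
    using ne V.subspace_0[OF weight_space_subspace[OF M]] by blast
  then have v0M: "v0 \<in> fst M" using weight_space_subset[OF M] by blast
  let ?P = "\<lambda>k. \<forall>a\<in>ideal_power m k. snd M (j a) v0 = 0"
  obtain N where "?P N" using v0(1) unfolding weight_space_def by blast
  then have P: "?P (LEAST k. ?P k)" by (rule LeastI)
  have "\<not> ?P 0"
    using v0(2) act_1[OF M v0M] by (auto intro!: exI[of _ 1] simp: j_1)
  then obtain k where k: "(LEAST k. ?P k) = Suc k" using P by (cases "LEAST k. ?P k") auto
  then have "\<not> ?P k" using not_less_Least[of k ?P] by simp
  then obtain a where a: "a \<in> ideal_power m k" "snd M (j a) v0 \<noteq> 0" by blast
  have "snd M (j b) (snd M (j a) v0) = 0" if "b \<in> m" for b
  proof -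
    have "a * b \<in> ideal_power m (Suc k)" by (rule ideal_power_SucI[OF a(1) that])
    then have "snd M (j (b * a)) v0 = 0" using P unfolding k by (metis mult.commute)
    then show ?thesis using act_j_mult[OF M v0M] by simp
  qed
  then have "snd M (j a) v0 \<in> socle M"
    using act_weight_space[OF M v0(1)] by (simp add: socle_def)
  with a(2) show ?thesis by blast
qed

context
  fixes M :: "('p, 'v) rep"
  assumes M: "is_module M" and hc: "harish_chandra s\<Lambda> j sV M"
begin

text \<open>Entries of the n-th power lie in m^k \<otimes> m^l with k + l = n. If the factor that
  acts first has positive degree, it kills \<open>v\<close>. Otherwise the other factor has degree n
  and kills the projection of X\<Lambda>v, which is finite-dimensional inside the component at
  \<open>m\<close>. So \<open>K\<close> depends on \<open>M\<close>, \<open>v\<close> and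
  \<open>X\<close>, but not on \<open>Z\<close>.\<close>

lemma proj_tail:
  assumes v: "v \<in> socle M" and X: "X \<in> F"
  obtains K where "\<And>n Z. n \<ge> K \<Longrightarrow> set Z \<subseteq> (UNIV \<times> m) \<union> (m \<times> UNIV) \<Longrightarrow>
    proj M (snd M (biact j (tensor_power Z n) X) v) = 0"
proof -
  have vM: "v \<in> fst M" and vw: "v \<in> weight_space j M m" and mv: "\<And>a. a \<in> m \<Longrightarrow> snd M (j a) v = 0"
    using v socle_carrier by (auto simp: socle_def)
  obtain D where D: "finite D" "D \<subseteq> fst M" "\<And>a. snd M (j a) v \<in> V.span D"
    using weight_orbit_finite_dim[OF M vw] by blast
  have "\<exists>N. \<forall>n\<ge>N. \<forall>a\<in>ideal_power m n. snd M (j a) (proj M (snd M X d)) = 0" if "d \<in> D" for d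
    using proj_in[OF M hc act_closed[OF M X]] D(2) that unfolding weight_space_def by blast
  then obtain N where N: "\<And>d n a. d \<in> D \<Longrightarrow> n \<ge> N d \<Longrightarrow> a \<in> ideal_power m n \<Longrightarrow>
      snd M (j a) (proj M (snd M X d)) = 0"
    by metis
  \<comment> \<open>Each \<open>d\<close> has its own exponent; the sum dominates all of
    them.\<close>
  define K where "K = Suc (\<Sum>d\<in>D. N d)"
  have kill: "snd M (j a) (proj M (snd M X w)) = 0" if n: "n \<ge> K" "a \<in> ideal_power m n" and w: "w \<in> V.span D" for a w n
  proof -
    have "proj M (snd M X w) \<in> V.span (proj M ` (snd M X ` D))"
      using act_span(2)[OF M X D(2) w] act_closed[OF M X] D(2)
      by (intro proj_span[OF M hc]) auto
    moreover have "proj M ` (snd M X ` D) \<subseteq> fst M"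
      using act_closed[OF M X] D(2) proj_carrier[OF M hc] by blast
    ultimately have "snd M (j a) (proj M (snd M X w)) \<in> V.span (snd M (j a) ` proj M ` snd M X ` D)"
      by (intro act_span(2)[OF M j_F])
    moreover have "snd M (j a) ` proj M ` snd M X ` D \<subseteq> {0}"
    proof -
      have "N d \<le> n" if "d \<in> D" for d
        using member_le_sum[of d D N] that D(1) n(1) by (simp add: K_def)
      then show ?thesis using N n(2) by blast
    qed
    ultimately show ?thesis
      using V.span_subset_zero by blast
  qed
  have zero: "proj M (snd M (j a) (snd M X (snd M (j b) v))) = 0"
    if ab: "a \<in> ideal_power m k" "b \<in> ideal_power m l" "k + l \<ge> K" for a b k l
  proof (cases l)
    case 0
    then have "snd M (j a) (proj M (snd M X (snd M (j b) v))) = 0"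
      using ab by (intro kill[of k] D(3)) auto
    then show ?thesis using proj_act[OF M hc] act_closed[OF M] X vM j_F by metis
  next
    case (Suc l')
    then have "b \<in> m" using ab(2) ideal_power_Suc_sub_m by blast
    then show ?thesis using mv act_0[OF M] X j_F proj_0[OF M hc] by metis
  qed
  have "proj M (snd M (biact j (tensor_power Z n) X) v) = 0"
    if n: "n \<ge> K" and Z: "set Z \<subseteq> (UNIV \<times> m) \<union> (m \<times> UNIV)" for n Z
  proof -
    have term0: "snd M (j a * X * j b) v \<in> fst M \<and> proj M (snd M (j a * X * j b) v) = 0"
      if ab: "(a, b) \<in> set (tensor_power Z n)" for a b
    proof -
      obtain k l where kl: "k + l = n" "a \<in> ideal_power m k" "b \<in> ideal_power m l"
        using tensor_power_degree[OF Z ab] by blast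
      \<comment> \<open>Both orders of \<open>zero\<close> are supplied, because for the opposite
        product \<open>a\<close> acts first and \<open>b\<close> last.\<close>
      have "proj M (snd M (j a * X * j b) v) = 0"
        unfolding act_bimodule[OF M X vM] using zero[OF kl(2,3)] zero[OF kl(3,2)] kl(1) n by auto
      moreover have "snd M (j a * X * j b) v \<in> fst M"
        by (intro act_closed[OF M] F_mult j_F X vM)
      ultimately show ?thesis by blast
    qed
    have "snd M (biact j (tensor_power Z n) X) v = (\<Sum>x\<leftarrow>tensor_power Z n. snd M (j (fst x) * X * j (snd x)) v)"
      unfolding biact_def split_def
      by (rule act_sum_list_alg[OF M vM, THEN conjunct1]) (intro F_mult j_F X)
    moreover have "proj M (\<Sum>x\<leftarrow>tensor_power Z n. snd M (j (fst x) * X * j (snd x)) v) = 0"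
      by (rule proj_sum_list[OF M hc, THEN conjunct1]) (use term0 in auto)
    ultimately show ?thesis by simp
  qed
  then show ?thesis by (rule that)
qed

text \<open>In \<open>F\<close> the coefficient acts last and commutes with the projection p, so the
  value stays in the \<Lambda>-orbit of p(gv). In the opposite algebra it acts first, so the value
  lies in p(g\<Lambda>v). Both spaces are finite-dimensional.\<close>

lemma core_weight_bound:
  assumes v: "v \<in> socle M"
  obtains D where "finite D" "\<And>c. proj M (snd M (\<Sum>g\<in>G. j (c g) * g) v) \<in> V.span D"
proof -
  have vM: "v \<in> fst M" and vw: "v \<in> weight_space j M m"
    using v socle_carrier by (auto simp: socle_def)
  have "\<exists>D. finite D \<and> (\<forall>a. proj M (snd M (j a * g) v) \<in> V.span D)" if g: "g \<in> F" for g
  proof (cases "mul = (\<lambda>a b. a * b)")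
    case True
    have pw: "proj M (snd M g v) \<in> weight_space j M m"
      by (intro proj_in[OF M hc] act_closed[OF M] g vM)
    have "\<exists>D. finite D \<and> (\<forall>a. snd M (j a) (proj M (snd M g v)) \<in> V.span D)"
      by (rule weight_orbit_finite_dim[OF M pw]) blast
    then show ?thesis
      using act_j_mul_alg[OF M g vM] True proj_act[OF M hc act_closed[OF M g vM]] by auto
  next
    case False
    obtain D where D: "finite D" "D \<subseteq> fst M" "\<And>a. snd M (j a) v \<in> V.span D"
      using weight_orbit_finite_dim[OF M vw] by blast
    have "proj M (snd M g (snd M (j a) v)) \<in> V.span (proj M ` snd M g ` D)" for a
      using act_span(2)[OF M g D(2,3)] act_closed[OF M g] D(2)
      by (intro proj_span[OF M hc]) auto
    then show ?thesis
      using act_j_mul_alg[OF M g vM] False D(1) by (intro exI[of _ "proj M ` snd M g ` D"]) auto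
  qed
  then obtain D where D: "\<And>g. g \<in> F \<Longrightarrow> finite (D g) \<and> (\<forall>a. proj M (snd M (j a * g) v) \<in> V.span (D g))"
    by metis
  have "proj M (snd M (\<Sum>g\<in>G. j (c g) * g) v) \<in> V.span (\<Union>g\<in>G. D g)" for c
  proof -
    have gF: "j (c g) * g \<in> F" if "g \<in> G" for g
      using G_F that by (intro F_mult j_F) auto
    have "proj M (snd M (\<Sum>g\<in>G. j (c g) * g) v) = (\<Sum>g\<in>G. proj M (snd M (j (c g) * g) v))"
      using gF act_closed[OF M _ vM] by (simp add: act_sum_alg[OF M vM] proj_sum[OF M hc])
    also have "\<dots> \<in> V.span (\<Union>g\<in>G. D g)"
    proof (rule V.span_sum)
      fix g assume g: "g \<in> G"
      then have "proj M (snd M (j (c g) * g) v) \<in> V.span (D g)" using D G_F by blast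
      then show "proj M (snd M (j (c g) * g) v) \<in> V.span (\<Union>g\<in>G. D g)"
        using V.span_mono[of "D g" "\<Union>g\<in>G. D g"] g by blast
    qed
    finally show ?thesis .
  qed
  moreover have "finite (\<Union>g\<in>G. D g)" using finite_G D G_F by blast
  ultimately show ?thesis using that by blast
qed

definition max_weight_space :: "'v set" where
  "max_weight_space = V.span {snd M (j a) w | a w. a \<in> m \<and> w \<in> weight_space j M m}"

text \<open>If the component W at \<open>m\<close> satisfied W = mW, it would satisfy W = m^k W for
  all k. But W is spanned by finitely many vectors, each killed by a power of \<open>m\<close>, so a
  single power kills W.\<close>

lemma nakayama:
  assumes fin: "finite_dim sV (weight_space j M m)" and ne: "weight_space j M m \<noteq> {0}"
  shows "\<exists>u\<in>weight_space j M m. u \<notin> max_weight_space"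
proof (rule ccontr)
  let ?W = "weight_space j M m"
  let ?S = "\<lambda>k. {snd M (j a) w | a w. a \<in> ideal_power m k \<and> w \<in> ?W}"
  assume "\<not> ?thesis"
  then have sub: "?W \<subseteq> max_weight_space" by blast
  have WM: "?W \<subseteq> fst M" by (rule weight_space_subset[OF M])
  have pow: "?W \<subseteq> V.span (?S k)" for k
  proof (induction k)
    case 0
    have "w \<in> ?S 0" if "w \<in> ?W" for w
      using that act_1[OF M] WM by (auto intro!: exI[of _ 1] exI[of _ w] simp: j_1)
    then show ?case using V.span_superset by blast
  next
    case (Suc k)
    have "?S k \<subseteq> V.span (?S (Suc k))"
    proof clarify
      fix a w assume a: "a \<in> ideal_power m k" and w: "w \<in> ?W"
      let ?T = "{snd M (j a) w | a w. a \<in> m \<and> w \<in> ?W}"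
      have TM: "?T \<subseteq> fst M" using WM act_closed[OF M j_F] by blast
      have "w \<in> V.span ?T" using w sub unfolding max_weight_space_def by blast
      then have "snd M (j a) w \<in> V.span (snd M (j a) ` ?T)"
        by (rule act_span(2)[OF M j_F TM])
      moreover have "snd M (j a) ` ?T \<subseteq> ?S (Suc k)"
      proof clarify
        fix b w' assume "b \<in> m" "w' \<in> ?W"
        then show "\<exists>a' w. snd M (j a) (snd M (j b) w') = snd M (j a') w \<and> a' \<in> ideal_power m (Suc k) \<and> w \<in> ?W"
          using ideal_power_SucI[OF a] act_j_mult[OF M, of w'] WM by (intro exI[of _ "a * b"] exI[of _ w']) auto
      qed
      ultimately show "snd M (j a) w \<in> V.span (?S (Suc k))"
        using V.span_mono by blast
    qed
    then have "V.span (?S k) \<subseteq> V.span (?S (Suc k))"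
      by (rule V.span_minimal) simp
    with Suc show ?case by blast
  qed
  obtain D where D: "finite D" "?W = V.span D" using fin by (auto simp: finite_dim_def)
  have DW: "D \<subseteq> ?W" unfolding D(2) by (rule V.span_superset)
  then have "\<exists>N. \<forall>n\<ge>N. \<forall>a\<in>ideal_power m n. snd M (j a) d = 0" if "d \<in> D" for d
    using that unfolding weight_space_def by blast
  then obtain N where N: "\<And>d n a. d \<in> D \<Longrightarrow> n \<ge> N d \<Longrightarrow> a \<in> ideal_power m n \<Longrightarrow> snd M (j a) d = 0"
    by metis
  have "snd M (j a) w = 0" if a: "a \<in> ideal_power m (\<Sum>d\<in>D. N d)" and w: "w \<in> ?W" for a w
  proof -
    have "snd M (j a) w \<in> V.span (snd M (j a) ` D)"
      using w D(2) DW WM by (intro act_span(2)[OF M j_F]) auto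
    moreover have "snd M (j a) ` D \<subseteq> {0}"
      using N member_le_sum[of _ D N] D(1) a by auto
    ultimately show ?thesis
      using V.span_subset_zero by blast
  qed
  then have "?S (\<Sum>d\<in>D. N d) \<subseteq> {0}" by blast
  then have "?W \<subseteq> {0}"
    using pow[of "\<Sum>d\<in>D. N d"] V.span_subset_zero by blast
  then show False using ne V.subspace_0[OF weight_space_subspace[OF M]] by blast
qed

text \<open>For \<open>F\<close> the coefficients from \<open>m\<close> act last and land in mW,
  where W is the component at \<open>m\<close>; for the opposite algebra they act first, on a vector
  that \<open>m\<close> kills. So modulo mW only the classes of the coefficients modulo
  \<open>m\<close> matter.\<close>

lemma core_max_weight:
  assumes v: "v \<in> socle M" and t: "\<And>g. t g \<in> m"
  shows "proj M (snd M (\<Sum>g\<in>G. j (t g) * g) v) \<in> max_weight_space"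
proof -
  have vM: "v \<in> fst M" and mv: "\<And>a. a \<in> m \<Longrightarrow> snd M (j a) v = 0"
    using v socle_carrier by (auto simp: socle_def)
  have gF: "j (t g) * g \<in> F" if "g \<in> G" for g
    using G_F that by (intro F_mult j_F) auto
  have "proj M (snd M (\<Sum>g\<in>G. j (t g) * g) v) = (\<Sum>g\<in>G. proj M (snd M (j (t g) * g) v))"
    using gF act_closed[OF M _ vM] by (simp add: act_sum_alg[OF M vM] proj_sum[OF M hc])
  also have "\<dots> \<in> max_weight_space"
    unfolding max_weight_space_def
  proof (rule V.span_sum)
    fix g assume "g \<in> G"
    then have g: "g \<in> F" using G_F by blast
    show "proj M (snd M (j (t g) * g) v) \<in> V.span {snd M (j a) w | a w. a \<in> m \<and> w \<in> weight_space j M m}"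
    proof (cases "mul = (\<lambda>a b. a * b)")
      case True
      then have "proj M (snd M (j (t g) * g) v) = snd M (j (t g)) (proj M (snd M g v))"
        using act_j_mul_alg[OF M g vM] proj_act[OF M hc act_closed[OF M g vM]] by simp
      then show ?thesis
        using t proj_in[OF M hc act_closed[OF M g vM]] by (intro V.span_base) blast
    next
      case False
      then have "proj M (snd M (j (t g) * g) v) = 0"
        using act_j_mul_alg[OF M g vM] mv[OF t] act_0[OF M g] proj_0[OF M hc] by simp
      then show ?thesis by (simp add: V.span_zero)
    qed
  qed
  finally show ?thesis .
qed

end

text \<open>The approximation of \<open>X\<close> uses one list \<open>Z\<close> for all modules, so
  an exponent beyond the bounds of \<open>proj_tail\<close> for every member of \<open>J\<close>
  yields one \<open>c\<close> for the whole finite family.\<close>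

lemma reduce_family:
  assumes "finite J" and J: "\<And>M. M \<in> J \<Longrightarrow> is_module M \<and> harish_chandra s\<Lambda> j sV M \<and> v M \<in> socle M"
    and X: "X \<in> F"
  shows "\<exists>c. \<forall>M\<in>J. proj M (snd M (\<Sum>g\<in>G. j (c g) * g) (v M)) = proj M (snd M X (v M))"
proof -
  obtain Z where Z: "set Z \<subseteq> (UNIV \<times> m) \<union> (m \<times> UNIV)"
    "\<And>n. \<exists>c. X - (\<Sum>g\<in>G. j (c g) * g) = biact j (tensor_power Z n) X"
    using core_approximation[OF X] by blast
  have "\<exists>K. \<forall>n\<ge>K. proj M (snd M (biact j (tensor_power Z n) X) (v M)) = 0" if "M \<in> J" for M
    using proj_tail[of M "v M" X] J[OF that] X Z(1) by metis
  then obtain K where K: "\<And>M n. M \<in> J \<Longrightarrow> n \<ge> K M \<Longrightarrow> proj M (snd M (biact j (tensor_power Z n) X) (v M)) = 0"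
    by metis
  let ?n = "\<Sum>M\<in>J. K M"
  obtain c where c: "X - (\<Sum>g\<in>G. j (c g) * g) = biact j (tensor_power Z ?n) X"
    using Z(2) by blast
  let ?Y = "\<Sum>g\<in>G. j (c g) * g"
  have Y: "?Y \<in> F"
    using G_F by (intro SP.P.subspace_sum[OF F_subspace] F_mult j_F) auto
  have "proj M (snd M ?Y (v M)) = proj M (snd M X (v M))" if MJ: "M \<in> J" for M
  proof -
    have M: "is_module M" and hc: "harish_chandra s\<Lambda> j sV M" and vM: "v M \<in> fst M"
      using J[OF MJ] socle_carrier by auto
    have "K M \<le> ?n" using member_le_sum[of M J K] MJ assms(1) by simp
    then have "proj M (snd M (X - ?Y) (v M)) = 0"
      using K[OF MJ] c by simp
    moreover have "snd M X (v M) = snd M (X - ?Y) (v M) + snd M ?Y (v M)"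
      using act_diff_alg[OF M X Y vM] by simp
    moreover have "snd M (X - ?Y) (v M) \<in> fst M" "snd M ?Y (v M) \<in> fst M"
      using act_closed[OF M _ vM] X Y F_diff by auto
    ultimately show ?thesis
      using proj_add[OF M hc] by simp
  qed
  then show ?thesis by blast
qed

end


section \<open>Density and counting\<close>

lemma module_iso_refl: "module_iso A M M"
  unfolding module_iso_def by (intro exI[of _ id]) auto

lemma module_iso_trans:
  assumes "module_iso A M M'" "module_iso A M' M''"
  shows "module_iso A M M''"
proof -
  obtain \<phi> where \<phi>: "bij_betw \<phi> (fst M) (fst M')" "\<forall>v\<in>fst M. \<forall>w\<in>fst M. \<phi> (v + w) = \<phi> v + \<phi> w"
    "\<forall>a\<in>A. \<forall>v\<in>fst M. \<phi> (snd M a v) = snd M' a (\<phi> v)"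
    using assms(1) unfolding module_iso_def by blast
  obtain \<psi> where \<psi>: "bij_betw \<psi> (fst M') (fst M'')" "\<forall>v\<in>fst M'. \<forall>w\<in>fst M'. \<psi> (v + w) = \<psi> v + \<psi> w"
    "\<forall>a\<in>A. \<forall>v\<in>fst M'. \<psi> (snd M' a v) = snd M'' a (\<psi> v)"
    using assms(2) unfolding module_iso_def by blast
  have "\<phi> v \<in> fst M'" if "v \<in> fst M" for v
    using \<phi>(1) that by (rule bij_betw_apply)
  then show ?thesis
    unfolding module_iso_def using \<phi> \<psi>
    by (intro exI[of _ "\<psi> \<circ> \<phi>"]) (auto intro: bij_betw_trans)
qed

lemma module_iso_sym:
  assumes "module_iso A M M'"
    and add: "\<And>v w. v \<in> fst M \<Longrightarrow> w \<in> fst M \<Longrightarrow> v + w \<in> fst M"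
    and act: "\<And>a v. a \<in> A \<Longrightarrow> v \<in> fst M \<Longrightarrow> snd M a v \<in> fst M"
  shows "module_iso A M' M"
proof -
  obtain \<phi> where \<phi>: "bij_betw \<phi> (fst M) (fst M')" "\<forall>v\<in>fst M. \<forall>w\<in>fst M. \<phi> (v + w) = \<phi> v + \<phi> w"
    "\<forall>a\<in>A. \<forall>v\<in>fst M. \<phi> (snd M a v) = snd M' a (\<phi> v)"
    using assms(1) unfolding module_iso_def by blast
  define \<psi> where "\<psi> = inv_into (fst M) \<phi>"
  have \<psi>: "bij_betw \<psi> (fst M') (fst M)"
    unfolding \<psi>_def using \<phi>(1) by (rule bij_betw_inv_into)
  have \<psi>M: "\<psi> v \<in> fst M" "\<phi> (\<psi> v) = v" if "v \<in> fst M'" for v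
    using bij_betw_apply[OF \<psi> that] bij_betw_inv_into_right[OF \<phi>(1) that] by (simp_all add: \<psi>_def)
  have inv: "\<psi> (\<phi> v) = v" if "v \<in> fst M" for v
    using bij_betw_inv_into_left[OF \<phi>(1) that] by (simp add: \<psi>_def)
  have "\<psi> (v + w) = \<psi> v + \<psi> w" if "v \<in> fst M'" "w \<in> fst M'" for v w
    using inv[OF add[OF \<psi>M(1)[OF that(1)] \<psi>M(1)[OF that(2)]]] \<phi>(2) \<psi>M that by simp
  moreover have "\<psi> (snd M' a v) = snd M a (\<psi> v)" if "a \<in> A" "v \<in> fst M'" for a v
    using inv[OF act[OF that(1) \<psi>M(1)[OF that(2)]]] \<phi>(3) \<psi>M that by simp
  ultimately show ?thesis
    unfolding module_iso_def using \<psi> by blast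
qed

section \<open>Simple modules as orbits of left ideals, and the two finiteness statements\<close>

context galois_order_modules
begin

abbreviation is_simple :: "('p, 'v) rep \<Rightarrow> bool" where
  "is_simple \<equiv> simple_module sP F mul sV"

lemma simple_is_module: "is_simple M \<Longrightarrow> is_module M"
  by (simp add: simple_module_def)

lemma left_ideal_orbit:
  assumes M: "is_simple M" and K: "is_left_ideal K" and v: "v \<in> fst M"
    and ne: "X \<in> K" "snd M X v \<noteq> 0"
  shows "(\<lambda>X. snd M X v) ` K = fst M"
proof -
  note mod = simple_is_module[OF M]
  let ?W = "(\<lambda>X. snd M X v) ` K"
  have KF: "K \<subseteq> F" using K by (simp add: is_left_ideal_def)
  have in_F: "X \<in> F" if "X \<in> K" for X using KF that by blast
  have sub: "?W \<subseteq> fst M" using KF act_closed[OF mod _ v] by blast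
  have "V.subspace ?W"
  proof (rule V.subspaceI)
    show "0 \<in> ?W" using K act_0_alg[OF mod v] by (force simp: is_left_ideal_def)
    show "x + y \<in> ?W" if xy: "x \<in> ?W" "y \<in> ?W" for x y
    proof -
      obtain X Y where *: "X \<in> K" "Y \<in> K" "x = snd M X v" "y = snd M Y v" using xy by blast
      then have "x + y = snd M (X + Y) v" using act_add_alg[OF mod _ _ v] in_F by simp
      then show ?thesis using * K by (auto simp: is_left_ideal_def)
    qed
    show "sV c x \<in> ?W" if x: "x \<in> ?W" for c x
    proof -
      obtain X where *: "X \<in> K" "x = snd M X v" using x by blast
      then have "sV c x = snd M (sP c X) v" using act_scale_alg[OF mod _ v] in_F by simp
      then show ?thesis using * K by (auto simp: is_left_ideal_def)
    qed
  qed
  moreover have "snd M Y w \<in> ?W" if Y: "Y \<in> F" and w: "w \<in> ?W" for Y w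
  proof -
    obtain X where *: "X \<in> K" "w = snd M X v" using w by blast
    then have "snd M Y w = snd M (mul Y X) v" using act_mul[OF mod Y _ v] in_F by simp
    then show ?thesis using * K Y by (auto simp: is_left_ideal_def)
  qed
  ultimately have "left_module sP F mul sV (?W, snd M)"
    using mod sub unfolding left_module_def split_beta fst_conv snd_conv by (meson subsetD)
  then have "?W = {0} \<or> ?W = fst M"
    using M sub unfolding simple_module_def by blast
  then show ?thesis using ne by blast
qed

text \<open>Both modules are orbits of \<open>K\<close>, hence quotients of \<open>K\<close> by the
  annihilators of \<open>v\<close> and \<open>v'\<close>, and \<open>ann\<close> makes Xv \<mapsto>
  Xv' well defined. It is onto by construction and injective by simplicity of
  \<open>M\<close>.\<close>

lemma orbit_iso:
  assumes M: "is_simple M" "is_simple M'" and K: "is_left_ideal K"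
    and v: "v \<in> fst M" "X \<in> K" "snd M X v \<noteq> 0" and v': "v' \<in> fst M'" "X' \<in> K" "snd M' X' v' \<noteq> 0"
    and ann: "\<And>X. X \<in> K \<Longrightarrow> snd M X v = 0 \<Longrightarrow> snd M' X v' = 0"
  shows "module_iso F M M'"
proof -
  note mod = simple_is_module[OF M(1)] and mod' = simple_is_module[OF M(2)]
  have KF: "K \<subseteq> F" and K0: "0 \<in> K" and K_add: "\<And>X Y. X \<in> K \<Longrightarrow> Y \<in> K \<Longrightarrow> X + Y \<in> K"
    and K_scale: "\<And>c X. X \<in> K \<Longrightarrow> sP c X \<in> K" and K_mul: "\<And>Y X. Y \<in> F \<Longrightarrow> X \<in> K \<Longrightarrow> mul Y X \<in> K"
    using K by (auto simp: is_left_ideal_def)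
  have in_F: "X \<in> F" if "X \<in> K" for X using KF that by blast
  have K_diff: "X - Y \<in> K" if "X \<in> K" "Y \<in> K" for X Y
    using K_add[OF that(1) K_scale[OF that(2), of "- 1"]] by simp
  have orb: "(\<lambda>X. snd M X v) ` K = fst M" "(\<lambda>X. snd M' X v') ` K = fst M'"
    using left_ideal_orbit[OF M(1) K v] left_ideal_orbit[OF M(2) K v'] by auto
  define \<phi> where "\<phi> w = snd M' (SOME X. X \<in> K \<and> snd M X v = w) v'" for w
  have \<phi>: "\<phi> (snd M X v) = snd M' X v'" if X: "X \<in> K" for X
  proof -
    define Y where "Y = (SOME Y. Y \<in> K \<and> snd M Y v = snd M X v)"
    have Y: "Y \<in> K \<and> snd M Y v = snd M X v"
      unfolding Y_def by (rule someI[of _ X]) (use X in simp)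
    then have "snd M (Y - X) v = 0" using X Y in_F act_diff_alg[OF mod _ _ v(1), of Y X] by simp
    then have "snd M' (Y - X) v' = 0" using ann K_diff Y X by blast
    then have "snd M' Y v' = snd M' X v'" using X Y in_F act_diff_alg[OF mod' _ _ v'(1), of Y X] by simp
    then show ?thesis by (simp add: \<phi>_def Y_def)
  qed
  have ker: "snd M X v = 0" if X: "X \<in> K" "snd M' X v' = 0" for X
  proof (rule ccontr)
    assume nz: "snd M X v \<noteq> 0"
    \<comment> \<open>If this ideal moved \<open>v\<close>, its orbit would be all of
      \<open>M\<close>. Then some element of it would agree with \<open>X'\<close> at
      \<open>v\<close>, and passing to \<open>v'\<close> would give X'v' = 0.\<close>
    let ?K = "{X \<in> K. snd M' X v' = 0}"
    have "is_left_ideal ?K"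
      unfolding is_left_ideal_def
    proof (intro conjI ballI allI)
      show "?K \<subseteq> F" "0 \<in> ?K" using KF K0 act_0_alg[OF mod' v'(1)] by auto
      show "X + Y \<in> ?K" if "X \<in> ?K" "Y \<in> ?K" for X Y
        using that K_add act_add_alg[OF mod' _ _ v'(1), of X Y] KF by auto
      show "sP c X \<in> ?K" if "X \<in> ?K" for c X
        using that K_scale act_scale_alg[OF mod' _ v'(1), of X c] KF by auto
      show "mul Y X \<in> ?K" if "Y \<in> F" "X \<in> ?K" for Y X
        using that K_mul act_mul[OF mod' that(1) _ v'(1), of X] act_0[OF mod' that(1)] KF by auto
    qed
    then have "(\<lambda>X. snd M X v) ` ?K = fst M"
      using left_ideal_orbit[OF M(1) _ v(1)] X nz by blast
    then have "snd M X' v \<in> (\<lambda>X. snd M X v) ` ?K"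
      using act_closed[OF mod _ v(1)] v'(2) KF by blast
    then obtain Y where "Y \<in> ?K" "snd M X' v = snd M Y v" by blast
    then have "snd M' X' v' = 0" using \<phi>[OF v'(2)] \<phi>[of Y] by auto
    then show False using v'(3) by blast
  qed
  have "inj_on \<phi> (fst M)"
  proof (rule inj_onI)
    fix x y assume xy: "x \<in> fst M" "y \<in> fst M" "\<phi> x = \<phi> y"
    obtain X Y where XY: "X \<in> K" "Y \<in> K" "x = snd M X v" "y = snd M Y v"
      using xy(1,2) orb(1) by blast
    then have "snd M' (X - Y) v' = 0"
      using xy(3) \<phi> in_F act_diff_alg[OF mod' _ _ v'(1), of X Y] by simp
    then have "snd M (X - Y) v = 0" using ker K_diff XY by blast
    then show "x = y" using XY in_F act_diff_alg[OF mod _ _ v(1), of X Y] by simp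
  qed
  moreover have "\<phi> ` fst M = fst M'"
    unfolding orb[symmetric] image_image using \<phi> by simp
  moreover have "\<phi> (x + y) = \<phi> x + \<phi> y" if xy: "x \<in> fst M" "y \<in> fst M" for x y
  proof -
    obtain X Y where XY: "X \<in> K" "Y \<in> K" "x = snd M X v" "y = snd M Y v"
      using xy orb(1) by blast
    then have "x + y = snd M (X + Y) v" using in_F act_add_alg[OF mod _ _ v(1), of X Y] by simp
    then have "\<phi> (x + y) = snd M' (X + Y) v'" using \<phi> K_add XY by simp
    also have "\<dots> = \<phi> x + \<phi> y" using XY \<phi> in_F act_add_alg[OF mod' _ _ v'(1), of X Y] by simp
    finally show ?thesis .
  qed
  moreover have "\<phi> (snd M Y x) = snd M' Y (\<phi> x)" if Y: "Y \<in> F" and x: "x \<in> fst M" for Y x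
  proof -
    obtain X where X: "X \<in> K" "x = snd M X v" using x orb(1) by blast
    then have "snd M Y x = snd M (mul Y X) v" using in_F act_mul[OF mod Y _ v(1), of X] by simp
    then have "\<phi> (snd M Y x) = snd M' (mul Y X) v'" using \<phi> K_mul[OF Y] X by simp
    also have "\<dots> = snd M' Y (\<phi> x)" using X \<phi> in_F act_mul[OF mod' Y _ v'(1), of X] by simp
    finally show ?thesis .
  qed
  ultimately show ?thesis
    unfolding module_iso_def bij_betw_def by blast
qed

definition annihilator :: "(('p, 'v) rep \<Rightarrow> 'v) \<Rightarrow> ('p, 'v) rep set \<Rightarrow> 'p set" where
  "annihilator v T = {X \<in> F. \<forall>M\<in>T. snd M X (v M) = 0}"

lemma annihilator_left_ideal:
  assumes T: "\<And>M. M \<in> T \<Longrightarrow> is_module M \<and> v M \<in> fst M"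
  shows "is_left_ideal (annihilator v T)"
  unfolding is_left_ideal_def
proof (intro conjI ballI allI)
  show "annihilator v T \<subseteq> F" by (auto simp: annihilator_def)
  show "0 \<in> annihilator v T" using T act_0_alg by (auto simp: annihilator_def F_0)
  show "X + Y \<in> annihilator v T" if "X \<in> annihilator v T" "Y \<in> annihilator v T" for X Y
    using that T act_add_alg[of _ X Y] by (auto simp: annihilator_def F_add)
  show "sP c X \<in> annihilator v T" if "X \<in> annihilator v T" for c X
    using that T act_scale_alg[of _ X] by (auto simp: annihilator_def F_scale)
  show "mul Y X \<in> annihilator v T" if "Y \<in> F" "X \<in> annihilator v T" for Y X
    using that T act_mul[of _ Y X] act_0[of _ Y] by (auto simp: annihilator_def mul_F)
qed

text \<open>A weak form of the Jacobson density theorem with one vector for each module. Induct on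
  \<open>T\<close>: if killing one more vector \<open>v M\<close> forced the value at
  \<open>v M0\<close> to vanish, \<open>orbit_iso\<close> would identify \<open>M\<close> with
  \<open>M0\<close>. Once the annihilator moves \<open>v M0\<close>, its orbit is the whole simple
  module.\<close>

lemma density:
  assumes "finite T" and M0: "is_simple M0" "v M0 \<in> fst M0" "v M0 \<noteq> 0"
    and T: "\<And>M. M \<in> T \<Longrightarrow> is_simple M \<and> v M \<in> fst M \<and> \<not> module_iso F M M0"
    and u: "u \<in> fst M0"
  obtains X where "X \<in> annihilator v T" "snd M0 X (v M0) = u"
proof -
  have "\<exists>X\<in>annihilator v T. snd M0 X (v M0) \<noteq> 0"
    using assms(1) T
  proof (induction T)
    case empty
    show ?case
      using M0(3) act_1[OF simple_is_module[OF M0(1)] M0(2)] F_1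
      by (intro bexI[of _ 1]) (simp_all add: annihilator_def)
  next
    case (insert M T)
    let ?K = "annihilator v T"
    have K: "is_left_ideal ?K"
      by (rule annihilator_left_ideal) (use insert.prems simple_is_module in auto)
    obtain X where X: "X \<in> ?K" "snd M0 X (v M0) \<noteq> 0" using insert by auto
    have M: "is_simple M" "v M \<in> fst M" "\<not> module_iso F M M0" using insert.prems by auto
    show ?case
    proof (rule ccontr)
      assume "\<not> ?case"
      then have ann: "snd M0 Y (v M0) = 0" if "Y \<in> ?K" "snd M Y (v M) = 0" for Y
        using that by (auto simp: annihilator_def)
      then have "snd M X (v M) \<noteq> 0" using X by blast
      then have "module_iso F M M0"
        using orbit_iso[OF M(1) M0(1) K M(2) X(1) _ M0(2) X] ann by blast
      then show False using M(3) by blast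
    qed
  qed
  then obtain Y where "Y \<in> annihilator v T" "snd M0 Y (v M0) \<noteq> 0" by blast
  then have "(\<lambda>X. snd M0 X (v M0)) ` annihilator v T = fst M0"
    using T simple_is_module by (intro left_ideal_orbit M0 annihilator_left_ideal) auto
  then have "u \<in> (\<lambda>X. snd M0 X (v M0)) ` annihilator v T" using u by simp
  then obtain X where "X \<in> annihilator v T" "snd M0 X (v M0) = u" by blast
  then show ?thesis by (rule that)
qed

lemma simple_weight_space_finite_dim:
  assumes "M \<in> simple_hc_modules s\<Lambda> j sP F mul sV m"
  shows "finite_dim sV (weight_space j M m)"
proof -
  have M: "is_simple M" "harish_chandra s\<Lambda> j sV M" "weight_space j M m \<noteq> {0}"
    using assms by (auto simp: simple_hc_modules_def)
  note mod = simple_is_module[OF M(1)]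
  obtain v where v: "v \<in> socle M" "v \<noteq> 0" using socle_nonzero[OF mod M(3)] by blast
  obtain D where D: "finite D" "\<And>c. proj M (snd M (\<Sum>g\<in>G. j (c g) * g) v) \<in> V.span D"
    using core_weight_bound[OF mod M(2) v(1)] by blast
  have "u \<in> V.span D" if u: "u \<in> weight_space j M m" for u
  proof -
    have "u \<in> fst M" using u weight_space_subset[OF mod] by blast
    \<comment> \<open>For the empty family, \<open>density\<close> says that \<open>v\<close>
      generates the simple module; hence every \<open>u\<close> in the component is the projection
      of some Xv.\<close>
    then obtain X where X: "X \<in> annihilator (\<lambda>_. v) {}" "snd M X v = u"
      using density[of "{}" M "\<lambda>_. v" u] M(1) v socle_carrier by auto
    then have "X \<in> F" by (simp add: annihilator_def)
    then obtain c where "proj M (snd M (\<Sum>g\<in>G. j (c g) * g) v) = proj M (snd M X v)"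
      using reduce_family[of "{M}" "\<lambda>_. v" X] mod M(2) v(1) by auto
    then show ?thesis using D(2)[of c] X(2) proj_id[OF mod M(2) u] by simp
  qed
  then show ?thesis
    using V.finite_dim_subset[OF weight_space_subspace[OF mod] _ D(1)] by blast
qed

text \<open>Density gives elements dual to the modules: the one attached to \<open>M\<close> takes
  \<open>v M\<close> to \<open>u M\<close> and the other chosen vectors to 0. After reducing
  coefficients modulo \<open>m\<close> they lie in the span of a finite set fixed before
  \<open>J\<close>, and they remain independent because each \<open>u M\<close> avoids mW, W being
  the component at \<open>m\<close>.\<close>

lemma noniso_family_bound:
  "\<exists>N. \<forall>J. finite J \<longrightarrow> J \<subseteq> simple_hc_modules s\<Lambda> j sP F mul sV m \<longrightarrow>
     (\<forall>M\<in>J. \<forall>M'\<in>J. module_iso F M M' \<longrightarrow> M = M') \<longrightarrow> card J \<le> N"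
proof -
  \<comment> \<open>The exponent 1 yields a finite set that spans \<Lambda> modulo
    \<open>m\<close>.\<close>
  obtain B where B: "finite B" "\<And>a. \<exists>b\<in>A.span B. a - b \<in> ideal_power m (Suc 0)"
    using ideal_power_finite_codim[of "Suc 0"] by blast
  let ?G = "(\<lambda>(b, g). j b * g) ` (B \<times> G)"
  have "card J \<le> card ?G"
    if J: "finite J" "J \<subseteq> simple_hc_modules s\<Lambda> j sP F mul sV m"
      and noniso: "\<forall>M\<in>J. \<forall>M'\<in>J. module_iso F M M' \<longrightarrow> M = M'" for J
  proof -
    have simple: "is_simple M" and hc: "harish_chandra s\<Lambda> j sV M" and ne: "weight_space j M m \<noteq> {0}"
      if "M \<in> J" for M
      using J(2) that by (auto simp: simple_hc_modules_def)
    then have mod: "is_module M" if "M \<in> J" for M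
      using that simple_is_module by blast
    have "\<exists>v. M \<in> J \<longrightarrow> v \<in> socle M \<and> v \<noteq> 0" for M
      using socle_nonzero[OF mod ne] by blast
    then obtain v where v: "\<And>M. M \<in> J \<Longrightarrow> v M \<in> socle M \<and> v M \<noteq> 0" by metis
    \<comment> \<open>Nakayama's lemma requires a finite-dimensional component, so statement (ii) of
      the theorem enters the proof of (i).\<close>
    have "\<exists>u. M \<in> J \<longrightarrow> u \<in> weight_space j M m \<and> u \<notin> max_weight_space M" for M
      using nakayama[OF mod hc simple_weight_space_finite_dim ne] J(2) by blast
    then obtain u where u: "\<And>M. M \<in> J \<Longrightarrow> u M \<in> weight_space j M m \<and> u M \<notin> max_weight_space M"
      by metis
    have vM: "v M \<in> fst M" if "M \<in> J" for M using v[OF that] socle_carrier by blast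
    have "\<exists>c. \<forall>M'\<in>J. proj M' (snd M' (\<Sum>g\<in>G. j (c g) * g) (v M')) = (if M' = M then u M else 0)"
      if M: "M \<in> J" for M
    proof -
      obtain X where X: "X \<in> annihilator v (J - {M})" "snd M X (v M) = u M"
      proof (rule density[of "J - {M}" M v "u M"])
        show "u M \<in> fst M" using u[OF M] by (simp add: weight_space_def)
      qed (use J(1) M simple v vM noniso in auto)
      then have XF: "X \<in> F" by (simp add: annihilator_def)
      obtain c where c: "\<forall>M'\<in>J. proj M' (snd M' (\<Sum>g\<in>G. j (c g) * g) (v M')) = proj M' (snd M' X (v M'))"
        using reduce_family[OF J(1) _ XF, of v] mod hc v by blast
      have "proj M' (snd M' X (v M')) = (if M' = M then u M else 0)" if M': "M' \<in> J" for M'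
        using X M' proj_id[OF mod[OF M] hc[OF M]] u[OF M] proj_0[OF mod[OF M'] hc[OF M']]
        by (auto simp: annihilator_def)
      then have "\<forall>M'\<in>J. proj M' (snd M' (\<Sum>g\<in>G. j (c g) * g) (v M')) = (if M' = M then u M else 0)"
        using c by simp
      then show ?thesis by blast
    qed
    then have "\<forall>M\<in>J. \<exists>c. \<forall>M'\<in>J. proj M' (snd M' (\<Sum>g\<in>G. j (c g) * g) (v M')) = (if M' = M then u M else 0)"
      by (rule ballI)
    from bchoice[OF this] obtain c where c: "\<forall>M\<in>J. \<forall>M'\<in>J.
        proj M' (snd M' (\<Sum>g\<in>G. j (c M g) * g) (v M')) = (if M' = M then u M else 0)" ..
    obtain b where b: "\<And>a. b a \<in> A.span B" "\<And>a. a - b a \<in> m"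
      using B(2) ideal_power_Suc_sub_m[of 0] by (metis subsetD)
    define y where "y M = (\<Sum>g\<in>G. j (b (c M g)) * g)" for M
    have gF: "j a * g \<in> F" if "g \<in> G" for a g
      using G_F that by (intro F_mult j_F) auto
    have sumF: "(\<Sum>g\<in>G. j (a g) * g) \<in> F" for a
      by (rule SP.P.subspace_sum[OF F_subspace]) (rule gF)
    have "y M \<in> SP.P.span ?G" for M
      unfolding y_def
    proof (rule SP.P.span_sum)
      fix g assume g: "g \<in> G"
      show "j (b (c M g)) * g \<in> SP.P.span ?G"
        using b(1)[of "c M g"]
      proof (induction rule: A.span_induct_alt)
        case base
        show ?case by (simp add: j_0 SP.P.span_zero)
      next
        case (step r x y)
        have "j x * g \<in> SP.P.span ?G"
          using step.hyps g by (intro SP.P.span_base) force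
        then show ?case
          using step.IH by (simp add: j_add j_scale distrib_right SP.P.scale_mult_left SP.P.span_add SP.P.span_scale)
      qed
    qed
    moreover have "d M' = 0" if d: "(\<Sum>M\<in>J. sP (d M) (y M)) = 0" and M': "M' \<in> J" for d M'
    proof (rule ccontr)
      assume "d M' \<noteq> 0"
      note md = mod[OF M'] and hM = hc[OF M'] and vM' = vM[OF M']
      define \<phi> where "\<phi> X = proj M' (snd M' X (v M'))" for X
      have \<phi>_sum: "\<phi> (\<Sum>M\<in>J. sP (d M) (f M)) = (\<Sum>M\<in>J. sV (d M) (\<phi> (f M)))"
        if f: "\<And>M. f M \<in> F" for f
      proof -
        have "snd M' (\<Sum>M\<in>J. sP (d M) (f M)) (v M') = (\<Sum>M\<in>J. sV (d M) (snd M' (f M) (v M')))"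
          using f by (simp add: act_sum_alg[OF md vM'] act_scale_alg[OF md _ vM'] F_scale)
        then show ?thesis
          using f act_closed[OF md _ vM'] V.subspace_scale[OF carrier_subspace[OF md]]
          by (simp add: \<phi>_def proj_sum[OF md hM] proj_scale[OF md hM])
      qed
      \<comment> \<open>The reduction error \<open>?t\<close> has coefficients in \<open>m\<close>
        and contributes only to mW. A relation among the \<open>y M\<close> therefore leaves a
        nonzero multiple of \<open>u M'\<close> in mW.\<close>
      let ?Z = "\<lambda>M. \<Sum>g\<in>G. j (c M g) * g" and ?t = "\<lambda>M. \<Sum>g\<in>G. j (c M g - b (c M g)) * g"
      have "?Z M = y M + ?t M" for M
      proof -
        have "j (c M g) = j (b (c M g)) + j (c M g - b (c M g))" for g
          by (simp flip: j_add)
        then show ?thesis by (simp add: y_def distrib_right sum.distrib)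
      qed
      then have "(\<Sum>M\<in>J. sP (d M) (?Z M)) = (\<Sum>M\<in>J. sP (d M) (?t M))"
        using d by (simp add: SP.P.scale_right_distrib sum.distrib)
      then have "(\<Sum>M\<in>J. sV (d M) (\<phi> (?Z M))) = (\<Sum>M\<in>J. sV (d M) (\<phi> (?t M)))"
        using \<phi>_sum[of ?Z] \<phi>_sum[of ?t] sumF by simp
      moreover have "(\<Sum>M\<in>J. sV (d M) (\<phi> (?Z M))) = sV (d M') (u M')"
      proof -
        have "(\<Sum>M\<in>J. sV (d M) (\<phi> (?Z M))) = (\<Sum>M\<in>J. if M = M' then sV (d M') (u M') else 0)"
          by (rule sum.cong) (use c M' in \<open>auto simp: \<phi>_def\<close>)
        then show ?thesis using J(1) M' by simp
      qed
      moreover have sub: "V.subspace (max_weight_space M')"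
        by (simp add: max_weight_space_def[OF md hM])
      moreover have "\<phi> (?t M) \<in> max_weight_space M'" for M
        unfolding \<phi>_def using v[OF M'] b(2) by (intro core_max_weight[OF md hM]) auto
      then have "(\<Sum>M\<in>J. sV (d M) (\<phi> (?t M))) \<in> max_weight_space M'"
        by (intro V.subspace_sum V.subspace_scale sub)
      ultimately have "sV (d M') (u M') \<in> max_weight_space M'"
        by simp
      then have "sV (inverse (d M')) (sV (d M') (u M')) \<in> max_weight_space M'"
        by (rule V.subspace_scale[OF sub])
      then show False using u[OF M'] \<open>d M' \<noteq> 0\<close> by simp
    qed
    ultimately show ?thesis
      using B(1) finite_G by (intro SP.P.card_le_card_spanning[OF J(1)]) auto
  qed
  then show ?thesis by blast
qed

lemma finite_Irr: "finite (Irr s\<Lambda> j sP F mul sV m)"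
proof (rule ccontr)
  let ?X = "simple_hc_modules s\<Lambda> j sP F mul sV m"
  let ?r = "{(M, M'). M \<in> ?X \<and> M' \<in> ?X \<and> module_iso F M M'}"
  assume "infinite (Irr s\<Lambda> j sP F mul sV m)"
  then have inf: "infinite (?X // ?r)" by (simp add: Irr_def Let_def)
  have mod: "is_module M" if "M \<in> ?X" for M
    using that simple_is_module by (auto simp: simple_hc_modules_def)
  have eq: "equiv ?X ?r"
  proof (rule equivI)
    show "?r \<subseteq> ?X \<times> ?X" by auto
    show "refl_on ?X ?r" by (auto simp: refl_on_def module_iso_refl)
    show "sym ?r"
    proof (rule symI, clarify)
      fix M M' assume "M \<in> ?X" "M' \<in> ?X" "module_iso F M M'"
      then show "module_iso F M' M"
        using mod V.subspace_add[OF carrier_subspace] act_closed by (intro module_iso_sym[of F M M']) auto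
    qed
    show "trans ?r" by (rule transI) (auto intro: module_iso_trans)
  qed
  obtain N where N: "\<And>J. finite J \<Longrightarrow> J \<subseteq> ?X \<Longrightarrow>
     (\<forall>M\<in>J. \<forall>M'\<in>J. module_iso F M M' \<longrightarrow> M = M') \<Longrightarrow> card J \<le> N"
    using noniso_family_bound by blast
  \<comment> \<open>One class more than the bound allows; representatives of distinct classes are
    not isomorphic.\<close>
  obtain T where T: "finite T" "card T = Suc N" "T \<subseteq> ?X // ?r"
    using infinite_arbitrarily_large[OF inf] by blast
  have "\<exists>M. M \<in> E" if "E \<in> T" for E
    using that T(3) in_quotient_imp_non_empty[OF eq] by blast
  then obtain rep where rep: "\<And>E. E \<in> T \<Longrightarrow> rep E \<in> E" by metis
  have repX: "rep E \<in> ?X" if "E \<in> T" for E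
    using that rep T(3) in_quotient_imp_subset[OF eq] by blast
  have inj: "E = E'" if "E \<in> T" "E' \<in> T" "module_iso F (rep E) (rep E')" for E E'
    using quotient_eqI[OF eq, of E E' "rep E" "rep E'"] that rep repX T(3) by blast
  have "inj_on rep T" using inj module_iso_refl by (metis inj_onI)
  then have "card (rep ` T) = Suc N" using T(2) by (simp add: card_image)
  moreover have "card (rep ` T) \<le> N"
    using T(1) repX inj by (intro N) auto
  ultimately show False by simp
qed

end

theorem theorem4p23:
  fixes sH :: "'k::field \<Rightarrow> 'h::ring_1 \<Rightarrow> 'h"
    and \<Delta> :: "'h \<Rightarrow> ('h \<times> 'h) list" and \<epsilon> :: "'h \<Rightarrow> 'k" and S :: "'h \<Rightarrow> 'h"
    and s\<Lambda> :: "'k \<Rightarrow> 'l::idom \<Rightarrow> 'l"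
    and act :: "'h \<Rightarrow> 'l \<Rightarrow> 'l" and actL :: "'h \<Rightarrow> 'l fract \<Rightarrow> 'l fract"
    and H :: "'h set"
    and sP :: "'k \<Rightarrow> 'p::ring_1 \<Rightarrow> 'p" and iL :: "'l fract \<Rightarrow> 'p" and iH :: "'h \<Rightarrow> 'p"
    and m :: "'l set"
    and sV :: "'k \<Rightarrow> 'v::ab_group_add \<Rightarrow> 'v"
  assumes "hopf_galois_order_setting sH \<Delta> \<epsilon> S s\<Lambda> act actL H"
    and "smash_product sH \<Delta> \<epsilon> S (fract_scale s\<Lambda>) actL sP iL iH"
    and "maximal_ideal m" and "finite_dim_quotient s\<Lambda> UNIV m"
    and "finite_dim_stabilizer sH \<Delta> s\<Lambda> act H m"
    and "vector_space sV"
  shows "\<forall>F. galois_order actL H sP iL iH F \<longrightarrow>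
    (\<forall>mul \<in> {\<lambda>a b. a * b, \<lambda>a b. b * a}.
       finite (Irr s\<Lambda> (\<lambda>a. iL (to_fract a)) sP F mul sV m) \<and>
       (\<forall>E \<in> Irr s\<Lambda> (\<lambda>a. iL (to_fract a)) sP F mul sV m. \<forall>M \<in> E.
          finite_dim sV (weight_space (\<lambda>a. iL (to_fract a)) M m)))"
proof (intro allI impI ballI)
  fix F and mul :: "'p \<Rightarrow> 'p \<Rightarrow> 'p"
  assume F: "galois_order actL H sP iL iH F" and mul: "mul \<in> {\<lambda>a b. a * b, \<lambda>a b. b * a}"
  interpret hopf_galois_order_setting sH \<Delta> \<epsilon> S s\<Lambda> act actL H by (rule assms(1))
  interpret SP: smash_product sH \<Delta> \<epsilon> S "fract_scale s\<Lambda>" actL sP iL iH by (rule assms(2))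
  interpret order: galois_order_in_setting sH \<Delta> \<epsilon> S s\<Lambda> act actL H sP iL iH m F
    using assms(3-5) F by unfold_locales
  obtain G where "galois_order_core sH \<Delta> \<epsilon> S s\<Lambda> act actL H sP iL iH m F G"
    by (rule order.exists_core)
  then interpret core: galois_order_core sH \<Delta> \<epsilon> S s\<Lambda> act actL H sP iL iH m F G .
  interpret V: vector_space sV by (rule assms(6))
  interpret mods: galois_order_modules sH \<Delta> \<epsilon> S s\<Lambda> act actL H sP iL iH m F G sV mul
    using mul by unfold_locales auto
  have j: "order.j = (\<lambda>a. iL (to_fract a))"
    by (rule ext) (rule order.j_def)
  show "finite (Irr s\<Lambda> (\<lambda>a. iL (to_fract a)) sP F mul sV m) \<and>
       (\<forall>E \<in> Irr s\<Lambda> (\<lambda>a. iL (to_fract a)) sP F mul sV m. \<forall>M \<in> E.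
          finite_dim sV (weight_space (\<lambda>a. iL (to_fract a)) M m))"
  proof (intro conjI ballI)
    show "finite (Irr s\<Lambda> (\<lambda>a. iL (to_fract a)) sP F mul sV m)"
      using mods.finite_Irr unfolding j .
    fix E M assume "E \<in> Irr s\<Lambda> (\<lambda>a. iL (to_fract a)) sP F mul sV m" "M \<in> E"
    then have "M \<in> simple_hc_modules s\<Lambda> (\<lambda>a. iL (to_fract a)) sP F mul sV m"
      by (auto simp: Irr_def Let_def quotient_def)
    then show "finite_dim sV (weight_space (\<lambda>a. iL (to_fract a)) M m)"
      using mods.simple_weight_space_finite_dim unfolding j by blast
  qed
qed

end
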